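(* Let $T$ be a tiling of $\mathbb{R}^d$ with point group $G$. For $d=2$ the shape fundamental group $\varprojlim\pi_1(\Omega_r,T)$ is a $\mathbb{Z}$-cover $$\mathbb{Z}\to\varprojlim\pi_1(\Omega_r,T)\to\varprojlim\pi_1(\Omega_G,T)=\Gamma_+$$ of the positive topological space group $\Gamma_+$, and is a $\mathbb{Z}/2$-cover $$\mathbb{Z}/2\to\varprojlim\pi_1(\Omega_r,T)\to\varprojlim\pi_1(\Omega_G,T)=\Gamma_+$$ for $d>2$ (that is, these are short exact sequences of groups).
   Context: A tiling of $\mathbb{R}^d$ is a cover of $\mathbb{R}^d$ by compact $d$-dimensional polyhedral subsets (tiles), possibly labelled, meeting full face to full face and only on boundaries, each tile being a translate of one of a finite set of prototiles; tilings are assumed to have finite local complexity (finitely many $r$-patches up to translation for each $r$, the $r$-patch at $x$ being the set of tiles meeting the closed ball of radius $r$ at $x$). A patch is a finite set of tiles. A rigid motion is an orientation preserving isometry; these act on tilings tile by tile. $\Omega_t$ (resp. $\Omega_r$) is the space of tilings all of whose patches appear in $T$ up to translation (resp. rigid motion), with the topology in which two tilings are close if they agree on a large ball about the origin after a small translation followed by a small rotation of either. $T$ has point group $G$, a finite subgroup of $\mathrm{SO}(d)$, if for every patch $P$ of $T$ and $g\in G$, $g(P)$ is a patch of $T$ up to translation, and there is $r>0$ such that whenever an $r$-patch $P$ and $g(P)$, $g\in\mathrm{SO}(d)$, both occur in $T$ up to translation, then $g\in G$. $G$ acts on $\Omega_t$ by $g\cdot T'=g(T')$, and $\Omega_G=(\Omega_t\times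 EG)/G$ is the Borel construction ($EG$ a contractible free $G$-space, diagonal action). Let $K_n=\Omega_t/\!\sim_n$ and $J_n=\Omega_r/\!\sim_n$, where $T'\sim_nT''$ iff $T'$ and $T''$ agree on the closed ball $B_n(0)$. Then $\varprojlim\pi_1(\Omega_r,T)=\varprojlim_n\pi_1(J_n)$ and $\varprojlim\pi_1(\Omega_G,T)=\varprojlim_n\pi_1((K_n\times EG)/G)$, the bonding maps being induced by the forgetful maps and base points by $T$ (and an arbitrary point of $EG$). These are the shape fundamental groups, and $\Gamma_+=\varprojlim\pi_1(\Omega_G,T)$ is the positive topological space group of $T$.
   Formalization: EG is taken to be any contractible Hausdorff space with a free continuous G-action; without Hausdorff the claim fails, e.g. for the square tiling with EG the indiscrete space on G, where the Borel construction has trivial fundamental group. *)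

theory Defs
  imports
    "HOL-Analysis.Analysis"
    "HOL-Algebra.Group_Action"
    "HOL-Algebra.Elementary_Groups"
begin

section \<open>Tilings\<close>

text \<open>A tile is a set together with a label; unlabelled tiles are the case of a one-point label
  type.  Patches and tilings are sets of tiles.\<close>

type_synonym ('a, 'l) tile = "'a set \<times> 'l"
type_synonym ('a, 'l) tiling = "('a, 'l) tile set"

definition moved :: "('a \<Rightarrow> 'a) \<Rightarrow> ('a, 'l) tiling \<Rightarrow> ('a, 'l) tiling" where
  "moved f P = (\<lambda>(S, l). (f ` S, l)) ` P"

abbreviation translated :: "'a::euclidean_space \<Rightarrow> ('a, 'l) tiling \<Rightarrow> ('a, 'l) tiling" where
  "translated v \<equiv> moved (\<lambda>x. v + x)"

abbreviation rotated :: "real^'n^'n \<Rightarrow> (real^'n, 'l) tiling \<Rightarrow> (real^'n, 'l) tiling" where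
  "rotated A \<equiv> moved (\<lambda>x. A *v x)"

text \<open>Orientation preserving isometries of Euclidean space are exactly the following maps.\<close>

definition rigid_motion :: "(real^'n \<Rightarrow> real^'n) \<Rightarrow> bool" where
  "rigid_motion f \<longleftrightarrow> (\<exists>A v. rotation_matrix A \<and> f = (\<lambda>x. v + A *v x))"

text \<open>Tiles need not be convex, so the library's notion of a face of a convex set does not
  suffice.  The faces of a polyhedral set are the closures of the connected components of its
  strata, where two points lie in the same stratum if the set looks the same around both of them
  up to the translation taking one to the other.  For a convex polytope these are its nonempty
  faces, including the polytope itself.\<close>

definition polyhedral_body :: "'a::euclidean_space set \<Rightarrow> bool" where
  "polyhedral_body S \<longleftrightarrow> S \<noteq> {} \<and>
     (\<exists>F. finite F \<and> (\<forall>p\<in>F. polytope p \<and> aff_dim p = int DIM('a)) \<and> S = \<Union>F)"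

definition same_germ :: "'a::euclidean_space set \<Rightarrow> 'a \<Rightarrow> 'a \<Rightarrow> bool" where
  "same_germ S x y \<longleftrightarrow> (\<exists>\<epsilon>>0. \<forall>v. norm v < \<epsilon> \<longrightarrow> (x + v \<in> S \<longleftrightarrow> y + v \<in> S))"

definition faces :: "'a::euclidean_space set \<Rightarrow> 'a set set" where
  "faces S = {closure (connected_component_set {y \<in> S. same_germ S x y} x) | x. x \<in> S}"

text \<open>Two non-convex tiles may have several (or no) full faces in common.\<close>

definition meet_face_to_face :: "'a::euclidean_space set \<Rightarrow> 'a set \<Rightarrow> bool" where
  "meet_face_to_face S S' \<longleftrightarrow> (\<exists>F \<subseteq> faces S \<inter> faces S'. S \<inter> S' = \<Union>F)"

definition patch :: "real \<Rightarrow> 'a::euclidean_space \<Rightarrow> ('a, 'l) tiling \<Rightarrow> ('a, 'l) tiling" where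
  "patch r x T = {t \<in> T. fst t \<inter> cball x r \<noteq> {}}"

definition finite_local_complexity :: "('a::euclidean_space, 'l) tiling \<Rightarrow> bool" where
  "finite_local_complexity T \<longleftrightarrow>
     (\<forall>r>0. \<exists>\<P>. finite \<P> \<and> (\<forall>x. \<exists>P\<in>\<P>. \<exists>v. patch r x T = translated v P))"

definition tiling :: "('a::euclidean_space, 'l) tiling \<Rightarrow> bool" where
  "tiling T \<longleftrightarrow>
     (\<forall>t\<in>T. polyhedral_body (fst t)) \<and>
     (\<Union>t\<in>T. fst t) = UNIV \<and>
     (\<forall>t\<in>T. \<forall>t'\<in>T. t \<noteq> t' \<longrightarrow>
        fst t \<inter> fst t' \<subseteq> frontier (fst t) \<inter> frontier (fst t') \<and>
        meet_face_to_face (fst t) (fst t')) \<and>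
     (\<exists>\<P>. finite \<P> \<and> (\<forall>t\<in>T. \<exists>p\<in>\<P>. \<exists>v. {t} = translated v {p})) \<and>
     finite_local_complexity T"

definition occurs_up_to_translation ::
  "('a::euclidean_space, 'l) tiling \<Rightarrow> ('a, 'l) tiling \<Rightarrow> bool" where
  "occurs_up_to_translation P T \<longleftrightarrow> (\<exists>v. translated v P \<subseteq> T)"

definition occurs_up_to_rigid_motion ::
  "(real^'n, 'l) tiling \<Rightarrow> (real^'n, 'l) tiling \<Rightarrow> bool" where
  "occurs_up_to_rigid_motion P T \<longleftrightarrow> (\<exists>f. rigid_motion f \<and> moved f P \<subseteq> T)"

definition SO_group :: "(real^'n^'n) monoid" where
  "SO_group = \<lparr>carrier = {A. rotation_matrix A}, monoid.mult = (**), one = mat 1\<rparr>"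

definition has_point_group :: "(real^'n, 'l) tiling \<Rightarrow> (real^'n^'n) set \<Rightarrow> bool" where
  "has_point_group T G \<longleftrightarrow>
     finite G \<and> subgroup G SO_group \<and>
     (\<forall>P g. finite P \<and> P \<subseteq> T \<and> g \<in> G \<longrightarrow> occurs_up_to_translation (rotated g P) T) \<and>
     (\<exists>r>0. \<forall>x g. rotation_matrix g \<and> occurs_up_to_translation (rotated g (patch r x T)) T
        \<longrightarrow> g \<in> G)"


section \<open>Tiling spaces\<close>

definition agree_on_ball ::
  "real \<Rightarrow> ('a::euclidean_space, 'l) tiling \<Rightarrow> ('a, 'l) tiling \<Rightarrow> bool" where
  "agree_on_ball r T T' \<longleftrightarrow> patch r 0 T = patch r 0 T'"

definition close_by_moving ::
  "real \<Rightarrow> (real^'n, 'l) tiling \<Rightarrow> (real^'n, 'l) tiling \<Rightarrow> bool" where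
  "close_by_moving \<epsilon> T T' \<longleftrightarrow>
     (\<exists>v A. norm v < \<epsilon> \<and> rotation_matrix A \<and> norm (A - mat 1) < \<epsilon> \<and>
        agree_on_ball (1 / \<epsilon>) (rotated A (translated v T)) T')"

definition close :: "real \<Rightarrow> (real^'n, 'l) tiling \<Rightarrow> (real^'n, 'l) tiling \<Rightarrow> bool" where
  "close \<epsilon> T T' \<longleftrightarrow> close_by_moving \<epsilon> T T' \<or> close_by_moving \<epsilon> T' T"

definition tiling_topology :: "(real^'n, 'l) tiling set \<Rightarrow> (real^'n, 'l) tiling topology" where
  "tiling_topology \<Omega> =
     topology (\<lambda>U. U \<subseteq> \<Omega> \<and> (\<forall>T\<in>U. \<exists>\<epsilon>>0. \<forall>T'\<in>\<Omega>. close \<epsilon> T T' \<longrightarrow> T' \<in> U))"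

definition translational_hull :: "(real^'n, 'l) tiling \<Rightarrow> (real^'n, 'l) tiling set" where
  "translational_hull T =
     {T'. tiling T' \<and> (\<forall>P. finite P \<and> P \<subseteq> T' \<longrightarrow> occurs_up_to_translation P T)}"

definition rotational_hull :: "(real^'n, 'l) tiling \<Rightarrow> (real^'n, 'l) tiling set" where
  "rotational_hull T =
     {T'. tiling T' \<and> (\<forall>P. finite P \<and> P \<subseteq> T' \<longrightarrow> occurs_up_to_rigid_motion P T)}"

lemma close_mono:
  assumes "close \<delta> T T'" "0 < \<delta>" "\<delta> \<le> \<epsilon>"
  shows "close \<epsilon> T T'"
proof -
  have agree: "agree_on_ball (1 / \<epsilon>) S S'" if "agree_on_ball (1 / \<delta>) S S'"
    for S S' :: "(real^'a, 'b) tiling"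
  proof -
    have le: "1 / \<epsilon> \<le> 1 / \<delta>"
      using assms by (simp add: frac_le)
    have "patch (1 / \<epsilon>) 0 R = {t \<in> patch (1 / \<delta>) 0 R. fst t \<inter> cball 0 (1 / \<epsilon>) \<noteq> {}}"
      for R :: "(real^'a, 'b) tiling"
      using subset_cball[OF le, of 0] unfolding patch_def by blast
    with that show ?thesis
      by (simp add: agree_on_ball_def)
  qed
  have "close_by_moving \<epsilon> S S'" if "close_by_moving \<delta> S S'"
    for S S' :: "(real^'a, 'b) tiling"
    using that agree assms(3) unfolding close_by_moving_def
    by (meson order_less_le_trans)
  with assms(1) show ?thesis
    by (auto simp: close_def)
qed

lemma openin_tiling_topology:
  "openin (tiling_topology \<Omega>) U \<longleftrightarrow>
     U \<subseteq> \<Omega> \<and> (\<forall>T\<in>U. \<exists>\<epsilon>>0. \<forall>T'\<in>\<Omega>. close \<epsilon> T T' \<longrightarrow> T' \<in> U)"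
proof -
  let ?P = "\<lambda>U. U \<subseteq> \<Omega> \<and> (\<forall>T\<in>U. \<exists>\<epsilon>>0. \<forall>T'\<in>\<Omega>. close \<epsilon> T T' \<longrightarrow> T' \<in> U)"
  have "?P (U \<inter> V)" if U: "?P U" and V: "?P V" for U V
  proof (intro conjI ballI)
    show "U \<inter> V \<subseteq> \<Omega>" using U by blast
  next
    fix T assume "T \<in> U \<inter> V"
    then obtain a b where a: "a > 0" "\<forall>T'\<in>\<Omega>. close a T T' \<longrightarrow> T' \<in> U"
      and b: "b > 0" "\<forall>T'\<in>\<Omega>. close b T T' \<longrightarrow> T' \<in> V"
      using U V by blast
    have "T' \<in> U \<inter> V" if "T' \<in> \<Omega>" "close (min a b) T T'" for T'
      using that a b close_mono[OF that(2), of a] close_mono[OF that(2), of b] by simp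
    with a(1) b(1) show "\<exists>\<epsilon>>0. \<forall>T'\<in>\<Omega>. close \<epsilon> T T' \<longrightarrow> T' \<in> U \<inter> V"
      by (metis min_less_iff_conj)
  qed
  moreover have "?P (\<Union>\<K>)" if "\<forall>K\<in>\<K>. ?P K" for \<K>
    using that by (meson Sup_least UnionE UnionI)
  ultimately have "istopology ?P"
    unfolding istopology_def by blast
  then show ?thesis
    by (simp add: tiling_topology_def)
qed

lemma topspace_tiling_topology [simp]: "topspace (tiling_topology \<Omega>) = \<Omega>"
proof
  show "topspace (tiling_topology \<Omega>) \<subseteq> \<Omega>"
    by (meson openin_tiling_topology openin_topspace)
  have "openin (tiling_topology \<Omega>) \<Omega>"
    unfolding openin_tiling_topology by (auto intro: exI[of _ 1])
  then show "\<Omega> \<subseteq> topspace (tiling_topology \<Omega>)"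
    by (rule openin_subset)
qed


section \<open>Quotient spaces and the approximants\<close>

definition quotient_space :: "'x topology \<Rightarrow> ('x \<times> 'x) set \<Rightarrow> 'x set topology" where
  "quotient_space X R = topology (\<lambda>\<U>. \<U> \<subseteq> topspace X // R \<and> openin X (\<Union>\<U>))"

lemma in_Union_classes_iff:
  assumes "equiv A R" "\<U> \<subseteq> A // R"
  shows "x \<in> \<Union>\<U> \<longleftrightarrow> x \<in> A \<and> R `` {x} \<in> \<U>"
proof
  assume "x \<in> \<Union>\<U>"
  then obtain C where C: "C \<in> \<U>" "x \<in> C" by blast
  with assms(2) obtain y where "C = R `` {y}"
    by (blast elim: quotientE)
  with C have "(y, x) \<in> R" "C = R `` {x}"
    using equiv_class_eq[OF assms(1)] by auto
  with C show "x \<in> A \<and> R `` {x} \<in> \<U>"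
    using equiv_class_eq_iff[OF assms(1)] by simp
next
  assume "x \<in> A \<and> R `` {x} \<in> \<U>"
  then show "x \<in> \<Union>\<U>"
    using equiv_class_self[OF assms(1)] by blast
qed

lemma openin_quotient_space:
  assumes "equiv (topspace X) R"
  shows "openin (quotient_space X R) \<U> \<longleftrightarrow> \<U> \<subseteq> topspace X // R \<and> openin X (\<Union>\<U>)"
proof -
  let ?P = "\<lambda>\<U>. \<U> \<subseteq> topspace X // R \<and> openin X (\<Union>\<U>)"
  have "?P (\<U> \<inter> \<V>)" if U: "?P \<U>" and V: "?P \<V>" for \<U> \<V>
  proof -
    have sub: "\<U> \<inter> \<V> \<subseteq> topspace X // R"
      using U by blast
    have "\<Union>(\<U> \<inter> \<V>) = \<Union>\<U> \<inter> \<Union>\<V>"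
      using in_Union_classes_iff[OF assms conjunct1[OF U]] in_Union_classes_iff[OF assms sub]
        in_Union_classes_iff[OF assms conjunct1[OF V]] by blast
    with U V sub show ?thesis by (simp add: openin_Int)
  qed
  moreover have "?P (\<Union>\<K>)" if "\<forall>K\<in>\<K>. ?P K" for \<K>
  proof -
    have "\<Union>(\<Union>\<K>) = \<Union>(Union ` \<K>)" by blast
    with that show ?thesis by auto
  qed
  ultimately have "istopology ?P"
    unfolding istopology_def by blast
  then show ?thesis
    by (simp add: quotient_space_def)
qed

lemma topspace_quotient_space:
  assumes "equiv (topspace X) R"
  shows "topspace (quotient_space X R) = topspace X // R"
proof
  show "topspace (quotient_space X R) \<subseteq> topspace X // R"
    by (meson assms openin_quotient_space openin_topspace)
  have "openin (quotient_space X R) (topspace X // R)"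
    by (simp add: openin_quotient_space[OF assms] Union_quotient[OF assms])
  then show "topspace X // R \<subseteq> topspace (quotient_space X R)"
    by (rule openin_subset)
qed

lemma quotient_map_quotient_space:
  assumes "equiv (topspace X) R"
  shows "quotient_map X (quotient_space X R) (\<lambda>x. R `` {x})"
  unfolding quotient_map_def
proof (intro conjI allI impI)
  show "(\<lambda>x. R `` {x}) ` topspace X = topspace (quotient_space X R)"
    by (auto simp: topspace_quotient_space[OF assms] quotient_def)
  fix \<U> assume "\<U> \<subseteq> topspace (quotient_space X R)"
  then have U: "\<U> \<subseteq> topspace X // R"
    by (simp add: topspace_quotient_space[OF assms])
  have "{x \<in> topspace X. R `` {x} \<in> \<U>} = \<Union>\<U>"
    using in_Union_classes_iff[OF assms U] by blast
  with U show "openin X {x \<in> topspace X. R `` {x} \<in> \<U>} = openin (quotient_space X R) \<U>"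
    by (simp add: openin_quotient_space[OF assms])
qed

definition agree_rel ::
  "(real^'n, 'l) tiling set \<Rightarrow> nat \<Rightarrow> ((real^'n, 'l) tiling \<times> (real^'n, 'l) tiling) set" where
  "agree_rel \<Omega> n = {(T, T'). T \<in> \<Omega> \<and> T' \<in> \<Omega> \<and> agree_on_ball (real n) T T'}"

lemma equiv_agree_rel: "equiv \<Omega> (agree_rel \<Omega> n)"
  by (auto simp: equiv_def refl_on_def sym_def trans_def agree_rel_def agree_on_ball_def)

definition approximant ::
  "(real^'n, 'l) tiling set \<Rightarrow> nat \<Rightarrow> (real^'n, 'l) tiling set topology" where
  "approximant \<Omega> n = quotient_space (tiling_topology \<Omega>) (agree_rel \<Omega> n)"

text \<open>The forgetful map from level \<open>Suc n\<close> to level \<open>n\<close>: it sends a class of the finer relation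
  to the class of the coarser relation containing it.\<close>

definition forget ::
  "(real^'n, 'l) tiling set \<Rightarrow> nat \<Rightarrow> (real^'n, 'l) tiling set \<Rightarrow> (real^'n, 'l) tiling set" where
  "forget \<Omega> n C = agree_rel \<Omega> n `` C"


section \<open>The Borel construction\<close>

text \<open>As usual for the total space of a universal bundle, \<open>E\<close> is assumed to be Hausdorff: the
  indiscrete space on the set \<open>G\<close> is contractible with a free action, but its quotient is a point.\<close>

definition free_contractible_space ::
  "(real^'n^'n) set \<Rightarrow> 'e topology \<Rightarrow> (real^'n^'n \<Rightarrow> 'e \<Rightarrow> 'e) \<Rightarrow> bool" where
  "free_contractible_space G E \<phi> \<longleftrightarrow>
     contractible_space E \<and> Hausdorff_space E \<and>
     group_action (SO_group\<lparr>carrier := G\<rparr>) (topspace E) \<phi> \<and>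
     (\<forall>g\<in>G. continuous_map E E (\<phi> g)) \<and>
     (\<forall>g\<in>G. \<forall>e\<in>topspace E. \<phi> g e = e \<longrightarrow> g = mat 1)"

text \<open>Below, \<open>X\<close> is a space whose points are sets of tilings, on which matrices act elementwise.\<close>

definition diagonal_rel ::
  "(real^'n^'n) set \<Rightarrow> (real^'n, 'l) tiling set topology \<Rightarrow> 'e topology
    \<Rightarrow> (real^'n^'n \<Rightarrow> 'e \<Rightarrow> 'e)
    \<Rightarrow> (((real^'n, 'l) tiling set \<times> 'e) \<times> ((real^'n, 'l) tiling set \<times> 'e)) set" where
  "diagonal_rel G X E \<phi> =
     {((C, e), (C', e')). C \<in> topspace X \<and> e \<in> topspace E \<and>
        (\<exists>g\<in>G. C' = rotated g ` C \<and> e' = \<phi> g e)}"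

definition borel_approximant ::
  "(real^'n, 'l) tiling set \<Rightarrow> (real^'n^'n) set \<Rightarrow> 'e topology \<Rightarrow> (real^'n^'n \<Rightarrow> 'e \<Rightarrow> 'e)
    \<Rightarrow> nat \<Rightarrow> ((real^'n, 'l) tiling set \<times> 'e) set topology" where
  "borel_approximant \<Omega> G E \<phi> n =
     quotient_space (prod_topology (approximant \<Omega> n) E) (diagonal_rel G (approximant \<Omega> n) E \<phi>)"

definition borel_forget ::
  "(real^'n, 'l) tiling set \<Rightarrow> nat
    \<Rightarrow> ((real^'n, 'l) tiling set \<times> 'e) set \<Rightarrow> ((real^'n, 'l) tiling set \<times> 'e) set" where
  "borel_forget \<Omega> n Q = (\<lambda>(C, e). (forget \<Omega> n C, e)) ` Q"


section \<open>Fundamental groups and inverse limits\<close>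

definition loops_at :: "'x topology \<Rightarrow> 'x \<Rightarrow> (real \<Rightarrow> 'x) set" where
  "loops_at X b = {p. pathin X p \<and> p 0 = b \<and> p 1 = b}"

definition loop_class :: "'x topology \<Rightarrow> 'x \<Rightarrow> (real \<Rightarrow> 'x) \<Rightarrow> (real \<Rightarrow> 'x) set" where
  "loop_class X b p = {q. homotopic_with (\<lambda>h. h 0 = b \<and> h 1 = b) (top_of_set {0..1}) X p q}"

text \<open>The library's path concatenation is restricted to topological-space types.\<close>

definition join_loops :: "(real \<Rightarrow> 'x) \<Rightarrow> (real \<Rightarrow> 'x) \<Rightarrow> real \<Rightarrow> 'x" where
  "join_loops p q = (\<lambda>t. if t \<le> 1/2 then p (2 * t) else q (2 * t - 1))"

definition fundamental_group :: "'x topology \<Rightarrow> 'x \<Rightarrow> (real \<Rightarrow> 'x) set monoid" where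
  "fundamental_group X b =
     \<lparr>carrier = loop_class X b ` loops_at X b,
      monoid.mult = (\<lambda>A B. \<Union>p\<in>A. \<Union>q\<in>B. loop_class X b (join_loops p q)),
      one = loop_class X b (\<lambda>t. b)\<rparr>"

definition induced_map ::
  "'y topology \<Rightarrow> 'y \<Rightarrow> ('x \<Rightarrow> 'y) \<Rightarrow> (real \<Rightarrow> 'x) set \<Rightarrow> (real \<Rightarrow> 'y) set" where
  "induced_map Y b f A = (\<Union>p\<in>A. loop_class Y b (f \<circ> p))"

definition inverse_limit_group ::
  "(nat \<Rightarrow> 'g monoid) \<Rightarrow> (nat \<Rightarrow> 'g \<Rightarrow> 'g) \<Rightarrow> (nat \<Rightarrow> 'g) monoid" where
  "inverse_limit_group H \<beta> =
     \<lparr>carrier = {x. (\<forall>n. x n \<in> carrier (H n)) \<and> (\<forall>n. \<beta> n (x (Suc n)) = x n)},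
      monoid.mult = (\<lambda>x y n. x n \<otimes>\<^bsub>H n\<^esub> y n),
      one = (\<lambda>n. \<one>\<^bsub>H n\<^esub>)\<rparr>"

text \<open>The inverse limit of the fundamental groups of a tower of spaces \<open>X n\<close> with bonding maps
  \<open>f n\<close> from \<open>X (Suc n)\<close> to \<open>X n\<close> and compatible base points \<open>b n\<close>.\<close>

definition shape_group ::
  "(nat \<Rightarrow> 'x topology) \<Rightarrow> (nat \<Rightarrow> 'x \<Rightarrow> 'x) \<Rightarrow> (nat \<Rightarrow> 'x) \<Rightarrow> (nat \<Rightarrow> (real \<Rightarrow> 'x) set) monoid" where
  "shape_group X f b =
     inverse_limit_group (\<lambda>n. fundamental_group (X n) (b n)) (\<lambda>n. induced_map (X n) (b n) (f n))"

definition rotational_shape_group ::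
  "(real^'n, 'l) tiling \<Rightarrow> (nat \<Rightarrow> (real \<Rightarrow> (real^'n, 'l) tiling set) set) monoid" where
  "rotational_shape_group T =
     (let \<Omega> = rotational_hull T
      in shape_group (approximant \<Omega>) (forget \<Omega>) (\<lambda>n. agree_rel \<Omega> n `` {T}))"

definition positive_space_group ::
  "(real^'n, 'l) tiling \<Rightarrow> (real^'n^'n) set \<Rightarrow> 'e topology \<Rightarrow> (real^'n^'n \<Rightarrow> 'e \<Rightarrow> 'e) \<Rightarrow> 'e
    \<Rightarrow> (nat \<Rightarrow> (real \<Rightarrow> ((real^'n, 'l) tiling set \<times> 'e) set) set) monoid" where
  "positive_space_group T G E \<phi> e =
     (let \<Omega> = translational_hull T
      in shape_group (borel_approximant \<Omega> G E \<phi>) (borel_forget \<Omega>)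
           (\<lambda>n. diagonal_rel G (approximant \<Omega> n) E \<phi> `` {(agree_rel \<Omega> n `` {T}, e)}))"


section \<open>Short exact sequences\<close>

text \<open>The library's exact sequences require all groups to have the same element type.\<close>

definition short_exact ::
  "'a monoid \<Rightarrow> ('a \<Rightarrow> 'b) \<Rightarrow> 'b monoid \<Rightarrow> ('b \<Rightarrow> 'c) \<Rightarrow> 'c monoid \<Rightarrow> bool" where
  "short_exact A i B p C \<longleftrightarrow>
     group_hom A B i \<and> group_hom B C p \<and>
     inj_on i (carrier A) \<and> i ` carrier A = kernel B C p \<and> p ` carrier B = carrier C"

end

theory Submission
  imports Defs
begin

text \<open>Once \<open>n\<close> exceeds the radius at which patches determine their orientation up to the point group
  \<open>G\<close>, the approximant \<open>J_n\<close> is the quotient of \<open>K_n \<times> SO(d)\<close> by the free diagonal action of \<open>G\<close>,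
  while its Borel counterpart is the quotient of \<open>K_n \<times> EG\<close>. Loops in either quotient are given, up
  to homotopy, by an element \<open>g\<close> of \<open>G\<close>, a path in \<open>K_n\<close> and a path in the other factor, each running
  from the base point to its translate by \<open>g\<close>. As \<open>EG\<close> is contractible and \<open>SO(d)\<close> is connected,
  keeping \<open>g\<close> and the path in \<open>K_n\<close> defines a surjection between the fundamental groups with kernel
  \<open>\<pi>\<^sub>1(SO(d))\<close>, which is infinite cyclic for \<open>d = 2\<close> and of order two for \<open>d > 2\<close>. These kernels form a
  constant tower, so exactness survives in the inverse limit.\<close>

section \<open>Paths up to homotopy\<close>

text \<open>Little is known about the spaces K_n, so the covering argument asks nothing of them:
  neighbourhoods on which the projection is injective come from the second factor alone, where a
  finite group acts freely on a Hausdorff space. Passing to the limit could in general cost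
  surjectivity; it does not here, because the bonding maps leave the second factor alone and so act
  as the identity on the kernels. The group \<pi>_1(SO(d)) is found by hand. Moving a basis vector
  maps SO(d) to a sphere with fibre SO(d-1), and a family of rotations with few enough parameters
  can be pushed into the fibre. For loops this ends in one plane, whose full turn therefore
  generates; for d = 2 the angle counts the turns. For d > 2 a third direction lets the plane be
  flipped over, so the full turn equals its inverse. That it is not trivial is the harder half: a
  contraction has two parameters and can be pushed down only to three coordinates, where the double
  cover of SO(3) by the unit quaternions excludes it.\<close>

abbreviation unit_square :: "(real \<times> real) set" where
  "unit_square \<equiv> {0..1} \<times> {0..1}"

text \<open>Two separate end points are allowed, unlike in \<open>loop_class\<close>, because loops
  in a quotient will be cut open into paths from a base point to its translate.\<close>

definition path_hom :: "'x topology \<Rightarrow> 'x \<Rightarrow> 'x \<Rightarrow> (real \<Rightarrow> 'x) \<Rightarrow> (real \<Rightarrow> 'x) \<Rightarrow> bool" where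
  "path_hom X a b = homotopic_with (\<lambda>h. h 0 = a \<and> h 1 = b) (top_of_set {0..1}) X"

definition path_from :: "'x topology \<Rightarrow> 'x \<Rightarrow> 'x \<Rightarrow> (real \<Rightarrow> 'x) \<Rightarrow> bool" where
  "path_from X a b p \<longleftrightarrow> pathin X p \<and> p 0 = a \<and> p 1 = b"

lemma prod_top_of_set: "prod_topology (top_of_set S) (top_of_set T) = top_of_set (S \<times> T)"
  by (simp add: prod_topology_subtopology subtopology_subtopology Times_Int_Times)

lemma path_hom_iff:
  "path_hom X a b p q \<longleftrightarrow>
     (\<exists>h. continuous_map (top_of_set unit_square) X h \<and>
        (\<forall>t\<in>{0..1}. h (0, t) = p t \<and> h (1, t) = q t) \<and>
        (\<forall>s\<in>{0..1}. h (s, 0) = a \<and> h (s, 1) = b))"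
  unfolding path_hom_def
  by (subst homotopic_with) (simp_all add: prod_top_of_set ball_conj_distrib conj_assoc)

lemma path_homI:
  assumes "continuous_map (top_of_set unit_square) X h"
    and "\<And>t. t \<in> {0..1} \<Longrightarrow> h (0, t) = p t" "\<And>t. t \<in> {0..1} \<Longrightarrow> h (1, t) = q t"
    and "\<And>s. s \<in> {0..1} \<Longrightarrow> h (s, 0) = a" "\<And>s. s \<in> {0..1} \<Longrightarrow> h (s, 1) = b"
  shows "path_hom X a b p q"
  using assms unfolding path_hom_iff by blast

lemma path_hom_sym: "path_hom X a b p q \<Longrightarrow> path_hom X a b q p"
  unfolding path_hom_def by (simp add: homotopic_with_sym)

lemma path_hom_trans: "path_hom X a b p q \<Longrightarrow> path_hom X a b q r \<Longrightarrow> path_hom X a b p r"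
  unfolding path_hom_def by (rule homotopic_with_trans)

lemma path_hom_imp_path_from:
  assumes "path_hom X a b p q" shows "path_from X a b p" "path_from X a b q"
  using homotopic_with_imp_continuous_maps[OF assms[unfolded path_hom_def]]
    homotopic_with_imp_property[OF assms[unfolded path_hom_def]]
  by (auto simp: path_from_def pathin_def)

lemma path_hom_eq:
  assumes "path_from X a b p" "\<And>t. t \<in> {0..1} \<Longrightarrow> p t = q t"
  shows "path_hom X a b p q"
  unfolding path_hom_def using assms
  by (intro homotopic_with_equal) (auto simp: path_from_def pathin_def)

lemma path_hom_refl: "path_from X a b p \<Longrightarrow> path_hom X a b p p"
  by (erule path_hom_eq) simp

lemma path_hom_cong:
  assumes "path_hom X a b p q" "\<And>t. t \<in> {0..1} \<Longrightarrow> p t = p' t" "\<And>t. t \<in> {0..1} \<Longrightarrow> q t = q' t"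
  shows "path_hom X a b p' q'"
  using assms unfolding path_hom_iff by metis

lemma path_hom_compose:
  assumes "path_hom X a b p q" "continuous_map X Y f" "f a = c" "f b = d"
  shows "path_hom Y c d (f \<circ> p) (f \<circ> q)"
proof -
  obtain h where h: "continuous_map (top_of_set unit_square) X h"
    "\<forall>t\<in>{0..1}. h (0, t) = p t \<and> h (1, t) = q t" "\<forall>s\<in>{0..1}. h (s, 0) = a \<and> h (s, 1) = b"
    using assms(1) unfolding path_hom_iff by blast
  show ?thesis
    by (rule path_homI[OF continuous_map_compose[OF h(1) assms(2)]]) (use h assms in auto)
qed

lemma path_from_compose:
  assumes "path_from X a b p" "continuous_map X Y f" "f a = c" "f b = d"
  shows "path_from Y c d (f \<circ> p)"
  using path_hom_imp_path_from(1)[OF path_hom_compose[OF path_hom_refl[OF assms(1)] assms(2-)]] .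

lemma path_from_imp_topspace:
  assumes "path_from X a b p"
  shows "a \<in> topspace X" "b \<in> topspace X" "t \<in> {0..1} \<Longrightarrow> p t \<in> topspace X"
  using assms continuous_map_image_subset_topspace[of "top_of_set {0..1}" X p]
  by (auto simp: path_from_def pathin_def)

lemma path_from_const: "a \<in> topspace X \<Longrightarrow> path_from X a a (\<lambda>t. a)"
  by (simp add: path_from_def pathin_def)

text \<open>The straight-line homotopy in \<open>S\<close>, pushed along \<open>M\<close>. With
  \<open>S\<close> an interval and \<open>M\<close> a path it yields reparametrisations; with
  \<open>S\<close> the real line and \<open>M\<close> a plane rotation it compares loops of
  rotations through their angles.\<close>

lemma path_hom_in_convex:
  fixes S :: "'a::real_normed_vector set"
  assumes "convex S" "continuous_map (top_of_set S) X M"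
    and "continuous_on {0..1} u" "continuous_on {0..1} v" "u ` {0..1} \<subseteq> S" "v ` {0..1} \<subseteq> S"
    and "u 0 = v 0" "u 1 = v 1" "M (u 0) = a" "M (u 1) = b"
  shows "path_hom X a b (M \<circ> u) (M \<circ> v)"
proof (rule path_homI)
  let ?h = "\<lambda>(s, t). (1 - s) *\<^sub>R u t + s *\<^sub>R v t"
  have "continuous_on unit_square ?h"
    unfolding case_prod_unfold
    by (intro continuous_intros continuous_on_compose2[OF assms(3)]
        continuous_on_compose2[OF assms(4)]) auto
  moreover have "?h ` unit_square \<subseteq> S"
    using assms(1,5,6) by (auto intro!: convexD)
  ultimately have "continuous_map (top_of_set unit_square) (top_of_set S) ?h"
    by (auto simp: continuous_map_in_subtopology)
  from continuous_map_compose[OF this assms(2)]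
  show "continuous_map (top_of_set unit_square) X (M \<circ> ?h)" .
qed (use assms(7-) in \<open>auto simp flip: scaleR_left_distrib\<close>)

lemma path_hom_reparam:
  assumes "path_from X a b p" "continuous_on {0..1} u" "u ` {0..1} \<subseteq> {0..1}" "u 0 = 0" "u 1 = 1"
  shows "path_hom X a b p (p \<circ> u)"
proof -
  have "path_hom X a b (p \<circ> (\<lambda>t. t)) (p \<circ> u)"
    using assms by (intro path_hom_in_convex[of "{0..1}"])
      (auto simp: path_from_def pathin_def)
  then show ?thesis by (simp add: o_def)
qed

lemma path_hom_join:
  assumes "path_hom X a b p p'" "path_hom X b c q q'"
  shows "path_hom X a c (join_loops p q) (join_loops p' q')"
proof -
  obtain h where h: "continuous_map (top_of_set unit_square) X h"
    "\<forall>t\<in>{0..1}. h (0, t) = p t \<and> h (1, t) = p' t" "\<forall>s\<in>{0..1}. h (s, 0) = a \<and> h (s, 1) = b"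
    using assms(1) unfolding path_hom_iff by blast
  obtain k where k: "continuous_map (top_of_set unit_square) X k"
    "\<forall>t\<in>{0..1}. k (0, t) = q t \<and> k (1, t) = q' t" "\<forall>s\<in>{0..1}. k (s, 0) = b \<and> k (s, 1) = c"
    using assms(2) unfolding path_hom_iff by blast
  let ?H = "\<lambda>x. if snd x \<le> 1/2 then (h \<circ> (\<lambda>x. (fst x, 2 * snd x))) x
     else (k \<circ> (\<lambda>x. (fst x, 2 * snd x - 1))) x"
  have "continuous_map (top_of_set unit_square) X ?H"
  proof (rule continuous_map_cases_le)
    show "continuous_map (subtopology (top_of_set unit_square) {x \<in> topspace (top_of_set unit_square). snd x \<le> 1/2}) X
       (h \<circ> (\<lambda>x. (fst x, 2 * snd x)))"
      by (rule continuous_map_compose[OF _ h(1)])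
         (auto simp: subtopology_subtopology continuous_map_in_subtopology intro!: continuous_intros)
    show "continuous_map (subtopology (top_of_set unit_square) {x \<in> topspace (top_of_set unit_square). 1/2 \<le> snd x}) X
       (k \<circ> (\<lambda>x. (fst x, 2 * snd x - 1)))"
      by (rule continuous_map_compose[OF _ k(1)])
         (auto simp: subtopology_subtopology continuous_map_in_subtopology intro!: continuous_intros)
  next
    fix x :: "real \<times> real" assume "x \<in> topspace (top_of_set unit_square)" "snd x = 1 / 2"
    then obtain s where "x = (s, 1/2)" "s \<in> {0..1}" by (cases x) auto
    then show "(h \<circ> (\<lambda>x. (fst x, 2 * snd x))) x = (k \<circ> (\<lambda>x. (fst x, 2 * snd x - 1))) x"
      using h(3) k(3) by simp
  qed (auto intro!: continuous_intros)
  then show ?thesis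
    by (rule path_homI) (use h k in \<open>auto simp: join_loops_def\<close>)
qed

lemma path_from_join:
  assumes "path_from X a b p" "path_from X b c q"
  shows "path_from X a c (join_loops p q)"
  using path_hom_imp_path_from(1)[OF path_hom_join[OF path_hom_refl[OF assms(1)] path_hom_refl[OF assms(2)]]] .

lemma join_loops_compose: "f \<circ> join_loops p q = join_loops (f \<circ> p) (f \<circ> q)"
  by (auto simp: join_loops_def)

lemma path_hom_join_const_left:
  assumes "path_from X a b p" shows "path_hom X a b (join_loops (\<lambda>t. a) p) p"
proof -
  let ?u = "\<lambda>t::real. max (2 * t - 1) 0"
  have "path_hom X a b p (p \<circ> ?u)"
    by (rule path_hom_reparam[OF assms]) (auto intro!: continuous_intros)
  then have "path_hom X a b (p \<circ> ?u) p" by (rule path_hom_sym)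
  then show ?thesis
    by (rule path_hom_cong) (use assms in \<open>auto simp: join_loops_def max_def path_from_def\<close>)
qed

lemma path_hom_join_assoc:
  assumes "path_from X a b p" "path_from X b c q" "path_from X c d r"
  shows "path_hom X a d (join_loops (join_loops p q) r) (join_loops p (join_loops q r))"
proof -
  \<comment> \<open>\<open>?v\<close> sends 1/2 and 3/4, the break points of the right bracketing,
    to 1/4 and 1/2, those of the left one.\<close>
  let ?v = "\<lambda>t::real. if t \<le> 1/2 then t / 2 else if t \<le> 3/4 then t - 1/4 else 2 * t - 1"
  have cont: "continuous_on {0..1} ?v"
    by (intro continuous_on_cases_le continuous_intros) auto
  have P: "path_from X a d (join_loops (join_loops p q) r)"
    using assms path_from_join by metis
  have "path_hom X a d (join_loops (join_loops p q) r) (join_loops (join_loops p q) r \<circ> ?v)"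
    by (rule path_hom_reparam[OF P cont]) auto
  then show ?thesis
    by (rule path_hom_cong)
      (use assms in \<open>auto simp: join_loops_def path_from_def field_simps
        intro!: arg_cong[of _ _ q]\<close>)
qed

lemma path_hom_join_reverse:
  assumes "path_from X a b p"
  shows "path_hom X a a (join_loops p (\<lambda>t. p (1 - t))) (\<lambda>t. a)"
proof -
  \<comment> \<open>The time change for running out along \<open>p\<close> and back; within the
    interval it shrinks to the constant 0.\<close>
  let ?u = "\<lambda>t::real. min (2 * t) (2 - 2 * t)"
  have "path_hom X a a (p \<circ> ?u) (p \<circ> (\<lambda>t. 0))"
    using assms by (intro path_hom_in_convex[of "{0..1}"])
      (auto simp: path_from_def pathin_def intro!: continuous_intros)
  then show ?thesis
    by (rule path_hom_cong)
      (use assms in \<open>auto simp: join_loops_def path_from_def min_def field_simps\<close>)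
qed

lemma path_from_reverse:
  assumes "path_from X a b p" shows "path_from X b a (\<lambda>t. p (1 - t))"
proof -
  have "continuous_map (top_of_set {0..1}) X (p \<circ> (\<lambda>t. 1 - t))"
    using assms unfolding path_from_def pathin_def
    by (intro continuous_map_compose[where X'="top_of_set {0..1}"])
      (auto simp: continuous_map_in_subtopology intro!: continuous_intros)
  then show ?thesis using assms by (simp add: path_from_def pathin_def o_def)
qed

section \<open>Fundamental groups\<close>

text \<open>Products and induced maps of classes are unions over all representatives; this evaluates
  them at one representative once every choice gives the same class.\<close>

lemma UN_eq_const: "x \<in> A \<Longrightarrow> (\<And>x. x \<in> A \<Longrightarrow> f x = c) \<Longrightarrow> (\<Union>x\<in>A. f x) = c"
  by auto

lemma loops_at_iff: "p \<in> loops_at X b \<longleftrightarrow> path_from X b b p"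
  by (simp add: loops_at_def path_from_def)

lemma loop_class_eq: "loop_class X b p = {q. path_hom X b b p q}"
  by (simp add: loop_class_def path_hom_def)

lemma loop_class_eq_iff:
  assumes "path_from X b b p"
  shows "loop_class X b p = loop_class X b q \<longleftrightarrow> path_hom X b b p q"
proof
  assume "loop_class X b p = loop_class X b q"
  with path_hom_refl[OF assms] have "path_hom X b b q p"
    by (auto simp: loop_class_eq)
  then show "path_hom X b b p q"
    by (rule path_hom_sym)
next
  assume "path_hom X b b p q"
  then have "path_hom X b b p r \<longleftrightarrow> path_hom X b b q r" for r
    using path_hom_sym path_hom_trans by metis
  then show "loop_class X b p = loop_class X b q"
    by (simp add: loop_class_eq)
qed

lemma carrier_fundamental_group:
  "carrier (fundamental_group X b) = {loop_class X b p |p. path_from X b b p}"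
  by (auto simp: fundamental_group_def loops_at_iff)

lemma mult_fundamental_group:
  assumes "path_from X b b p" "path_from X b b q"
  shows "loop_class X b p \<otimes>\<^bsub>fundamental_group X b\<^esub> loop_class X b q = loop_class X b (join_loops p q)"
proof -
  have "loop_class X b (join_loops p' q') = loop_class X b (join_loops p q)"
    if "p' \<in> loop_class X b p" "q' \<in> loop_class X b q" for p' q'
  proof -
    have "path_hom X b b (join_loops p q) (join_loops p' q')"
      using that path_hom_join by (simp add: loop_class_eq)
    then show ?thesis
      using loop_class_eq_iff[OF path_from_join[OF assms]] by blast
  qed
  note const = this
  have "p \<in> loop_class X b p" "q \<in> loop_class X b q"
    using assms path_hom_refl by (auto simp: loop_class_eq)
  then have "(\<Union>p'\<in>loop_class X b p. \<Union>q'\<in>loop_class X b q. loop_class X b (join_loops p' q')) =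
      loop_class X b (join_loops p q)"
    using const by (intro UN_eq_const) assumption+
  moreover have "A \<otimes>\<^bsub>fundamental_group X b\<^esub> B = (\<Union>p\<in>A. \<Union>q\<in>B. loop_class X b (join_loops p q))"
    for A B
    by (simp add: fundamental_group_def)
  ultimately show ?thesis
    by (simp only:)
qed

lemma one_fundamental_group: "\<one>\<^bsub>fundamental_group X b\<^esub> = loop_class X b (\<lambda>t. b)"
  by (simp add: fundamental_group_def)

lemma group_fundamental_group:
  assumes "b \<in> topspace X"
  shows "group (fundamental_group X b)"
proof (rule groupI)
  let ?G = "fundamental_group X b"
  show "\<one>\<^bsub>?G\<^esub> \<in> carrier ?G"
    using path_from_const[OF assms] by (auto simp: one_fundamental_group carrier_fundamental_group)
next
  fix x y assume "x \<in> carrier (fundamental_group X b)" "y \<in> carrier (fundamental_group X b)"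
  then show "x \<otimes>\<^bsub>fundamental_group X b\<^esub> y \<in> carrier (fundamental_group X b)"
    using path_from_join by (fastforce simp: carrier_fundamental_group mult_fundamental_group)
next
  fix x y z
  assume "x \<in> carrier (fundamental_group X b)" "y \<in> carrier (fundamental_group X b)"
    "z \<in> carrier (fundamental_group X b)"
  then obtain p q r where *: "path_from X b b p" "path_from X b b q" "path_from X b b r"
    "x = loop_class X b p" "y = loop_class X b q" "z = loop_class X b r"
    by (auto simp: carrier_fundamental_group)
  then show "x \<otimes>\<^bsub>fundamental_group X b\<^esub> y \<otimes>\<^bsub>fundamental_group X b\<^esub> z =
      x \<otimes>\<^bsub>fundamental_group X b\<^esub> (y \<otimes>\<^bsub>fundamental_group X b\<^esub> z)"
    using path_hom_join_assoc[OF *(1-3)]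
      loop_class_eq_iff[OF path_from_join[OF path_from_join[OF *(1,2)] *(3)]]
    by (simp add: mult_fundamental_group path_from_join[where b=b])
next
  fix x assume "x \<in> carrier (fundamental_group X b)"
  then obtain p where p: "path_from X b b p" "x = loop_class X b p"
    by (auto simp: carrier_fundamental_group)
  then show "\<one>\<^bsub>fundamental_group X b\<^esub> \<otimes>\<^bsub>fundamental_group X b\<^esub> x = x"
    using path_hom_join_const_left[OF p(1)] path_from_const[OF assms]
      loop_class_eq_iff[OF path_from_join[OF path_from_const[OF assms] p(1)]]
    by (simp add: one_fundamental_group mult_fundamental_group)
  have rev: "path_from X b b (\<lambda>t. p (1 - t))"
    using path_from_reverse[OF p(1)] .
  have "path_hom X b b (join_loops (\<lambda>t. p (1 - t)) p) (\<lambda>t. b)"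
    using path_hom_join_reverse[OF rev] by simp
  then have "loop_class X b (\<lambda>t. p (1 - t)) \<otimes>\<^bsub>fundamental_group X b\<^esub> x = \<one>\<^bsub>fundamental_group X b\<^esub>"
    using p rev loop_class_eq_iff[OF path_from_join[OF rev p(1)]]
    by (simp add: one_fundamental_group mult_fundamental_group)
  moreover have "loop_class X b (\<lambda>t. p (1 - t)) \<in> carrier (fundamental_group X b)"
    using rev by (auto simp: carrier_fundamental_group)
  ultimately show "\<exists>y\<in>carrier (fundamental_group X b).
      y \<otimes>\<^bsub>fundamental_group X b\<^esub> x = \<one>\<^bsub>fundamental_group X b\<^esub>" ..
qed

lemma induced_map_loop_class:
  assumes "continuous_map X Y f" "f a = b" "path_from X a a p"
  shows "induced_map Y b f (loop_class X a p) = loop_class Y b (f \<circ> p)"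
proof -
  have "loop_class Y b (f \<circ> q) = loop_class Y b (f \<circ> p)" if "q \<in> loop_class X a p" for q
  proof -
    have "path_hom Y b b (f \<circ> p) (f \<circ> q)"
      using that path_hom_compose[OF _ assms(1,2,2)] by (simp add: loop_class_eq)
    then show ?thesis
      using loop_class_eq_iff[OF path_from_compose[OF assms(3,1,2,2)]] by blast
  qed
  note const = this
  have "p \<in> loop_class X a p"
    using path_hom_refl[OF assms(3)] by (simp add: loop_class_eq)
  from UN_eq_const[where f = "\<lambda>q. loop_class Y b (f \<circ> q)", OF this const] show ?thesis
    by (simp only: induced_map_def)
qed

lemma induced_map_hom:
  assumes "continuous_map X Y f" "f a = b"
  shows "induced_map Y b f \<in> hom (fundamental_group X a) (fundamental_group Y b)"
proof -
  note pc = path_from_compose[OF _ assms(1) assms(2) assms(2)]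
  show ?thesis
  proof (rule homI)
    fix x assume "x \<in> carrier (fundamental_group X a)"
    then show "induced_map Y b f x \<in> carrier (fundamental_group Y b)"
      using pc by (auto simp: carrier_fundamental_group induced_map_loop_class[OF assms])
  next
    fix x y assume "x \<in> carrier (fundamental_group X a)" "y \<in> carrier (fundamental_group X a)"
    then obtain p q where *: "path_from X a a p" "path_from X a a q"
      "x = loop_class X a p" "y = loop_class X a q"
      by (auto simp: carrier_fundamental_group)
    show "induced_map Y b f (x \<otimes>\<^bsub>fundamental_group X a\<^esub> y) =
        induced_map Y b f x \<otimes>\<^bsub>fundamental_group Y b\<^esub> induced_map Y b f y"
      using * path_from_join[OF *(1,2)] pc[OF *(1)] pc[OF *(2)]
      by (simp add: induced_map_loop_class[OF assms] mult_fundamental_group join_loops_compose)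
  qed
qed

section \<open>Lifting along free quotients\<close>

lemma connected_space_top_of_set: "connected_space (top_of_set S) \<longleftrightarrow> connected S"
  using connectedin_iff_connected[of S] by (simp add: connectedin_def)

lemma continuous_map_glue_closed:
  assumes "closed A" "closed B"
    and f: "continuous_map (top_of_set A) Y f" and g: "continuous_map (top_of_set B) Y g"
    and fg: "\<And>x. x \<in> A \<Longrightarrow> x \<in> B \<Longrightarrow> f x = g x"
  shows "continuous_map (top_of_set (A \<union> B)) Y (\<lambda>x. if x \<in> A then f x else g x)"
  unfolding continuous_map_closedin
proof (intro conjI allI impI)
  show "(\<lambda>x. if x \<in> A then f x else g x) \<in> topspace (top_of_set (A \<union> B)) \<rightarrow> topspace Y"
    using continuous_map_funspace[OF f] continuous_map_funspace[OF g] by auto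
  fix C assume C: "closedin Y C"
  have "closedin (top_of_set A) {x \<in> A. f x \<in> C}" "closedin (top_of_set B) {x \<in> B. g x \<in> C}"
    using closedin_continuous_map_preimage[OF f C] closedin_continuous_map_preimage[OF g C] by simp_all
  then have "closed ({x \<in> A. f x \<in> C} \<union> {x \<in> B. g x \<in> C})"
    using assms(1,2) closedin_closed_trans by blast
  then have "closedin (top_of_set (A \<union> B)) ({x \<in> A. f x \<in> C} \<union> {x \<in> B. g x \<in> C})"
    by (rule closed_subset[rotated]) auto
  moreover have "{x \<in> topspace (top_of_set (A \<union> B)). (if x \<in> A then f x else g x) \<in> C}
      = {x \<in> A. f x \<in> C} \<union> {x \<in> B. g x \<in> C}"
    using fg by auto
  ultimately show "closedin (top_of_set (A \<union> B))
      {x \<in> topspace (top_of_set (A \<union> B)). (if x \<in> A then f x else g x) \<in> C}" by simp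
qed

text \<open>A covering by orbits. Being open and locally injective, \<open>\<pi>\<close> has local
  sections; \<open>free\<close> says that an element with a fixed point acts trivially.
  \<open>G\<close> is a mere set of homeomorphisms, since \<open>fibre\<close> already makes the
  orbits the classes of an equivalence relation.\<close>

locale free_quotient =
  fixes Y :: "'y topology" and Q :: "'q topology" and \<pi> :: "'y \<Rightarrow> 'q"
    and G :: "'g set" and act :: "'g \<Rightarrow> 'y \<Rightarrow> 'y"
  assumes cont: "continuous_map Y Q \<pi>"
    and op: "open_map Y Q \<pi>"
    and surj: "\<pi> ` topspace Y = topspace Q"
    and act_homeo: "g \<in> G \<Longrightarrow> homeomorphic_map Y Y (act g)"
    and fibre: "y \<in> topspace Y \<Longrightarrow> y' \<in> topspace Y \<Longrightarrow> \<pi> y = \<pi> y' \<longleftrightarrow> (\<exists>g\<in>G. y' = act g y)"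
    and free: "g \<in> G \<Longrightarrow> y \<in> topspace Y \<Longrightarrow> act g y = y \<Longrightarrow> z \<in> topspace Y \<Longrightarrow> act g z = z"
    and loc_inj: "y \<in> topspace Y \<Longrightarrow> \<exists>U. openin Y U \<and> y \<in> U \<and> inj_on \<pi> U"
begin

lemma act_topspace: "g \<in> G \<Longrightarrow> y \<in> topspace Y \<Longrightarrow> act g y \<in> topspace Y"
  using homeomorphic_imp_surjective_map[OF act_homeo] by blast

text \<open>The set of agreement is clopen. It is open by local injectivity. No separation of
  \<open>Y\<close> is at hand, so its complement is treated by freeness: if
  \<open>l' z = act g (l z)\<close> differs from \<open>l z\<close>, then agreement at a nearby
  \<open>w\<close>, with \<open>l w\<close> in \<open>U\<close> and \<open>l' w\<close> in the
  translate of \<open>U\<close> by \<open>g\<close>, would give \<open>g\<close> a fixed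
  point.\<close>

lemma lift_unique:
  assumes Z: "connected_space Z" and l: "continuous_map Z Y l" and l': "continuous_map Z Y l'"
    and eq: "\<And>z. z \<in> topspace Z \<Longrightarrow> \<pi> (l z) = \<pi> (l' z)"
    and z0: "z0 \<in> topspace Z" "l z0 = l' z0" and z: "z \<in> topspace Z"
  shows "l z = l' z"
proof -
  let ?A = "{z \<in> topspace Z. l z = l' z}"
  have inY: "l z \<in> topspace Y" "l' z \<in> topspace Y" if "z \<in> topspace Z" for z
    using that continuous_map_funspace[OF l] continuous_map_funspace[OF l'] by auto
  have pre: "openin Z {w \<in> topspace Z. l w \<in> U \<and> l' w \<in> V}" if "openin Y U" "openin Y V" for U V
    using openin_Int[OF openin_continuous_map_preimage[OF l that(1)]
        openin_continuous_map_preimage[OF l' that(2)]]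
    by (rule back_subst) auto
  have "openin Z ?A"
  proof (subst openin_subopen, intro ballI)
    fix z assume z: "z \<in> ?A"
    obtain U where U: "openin Y U" "l z \<in> U" "inj_on \<pi> U"
      using loc_inj inY z by blast
    let ?W = "{w \<in> topspace Z. l w \<in> U \<and> l' w \<in> U}"
    have "?W \<subseteq> ?A"
      using eq inj_onD[OF U(3)] by blast
    then show "\<exists>T. openin Z T \<and> z \<in> T \<and> T \<subseteq> ?A"
      using pre[OF U(1,1)] z U(2) by (intro exI[of _ ?W]) auto
  qed
  moreover have "openin Z (topspace Z - ?A)"
  proof (subst openin_subopen, intro ballI)
    fix z assume z: "z \<in> topspace Z - ?A"
    obtain U where U: "openin Y U" "l z \<in> U" "inj_on \<pi> U"
      using loc_inj inY z by blast
    obtain g where g: "g \<in> G" "l' z = act g (l z)"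
      using z inY eq fibre by blast
    have V: "openin Y (act g ` U)"
      using homeomorphic_imp_open_map[OF act_homeo[OF g(1)]] U(1) by (simp add: open_map_def)
    let ?W = "{w \<in> topspace Z. l w \<in> U \<and> l' w \<in> act g ` U}"
    have "l w \<noteq> l' w" if w: "w \<in> ?W" for w
    proof
      assume e: "l w = l' w"
      from w obtain u where u: "u \<in> U" "l' w = act g u" by blast
      have uY: "u \<in> topspace Y" using u U(1) openin_subset by blast
      then have "\<pi> u = \<pi> (l w)"
        using fibre[OF uY inY(1)[of w]] w e u(2) g(1) by auto
      then have "u = l w" using inj_onD[OF U(3)] u(1) w by blast
      then have "act g u = u" using u(2) e by metis
      then have "act g (l z) = l z"
        using free[OF g(1) uY] inY z by blast
      with z g(2) show False by auto
    qed
    then show "\<exists>T. openin Z T \<and> z \<in> T \<and> T \<subseteq> topspace Z - ?A"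
      using pre[OF U(1) V] z U(2) g(2) by (intro exI[of _ ?W]) auto
  qed
  ultimately have "?A = {} \<or> ?A = topspace Z"
    using Z unfolding connected_space_clopen_in closedin_def by auto
  with z0 z show ?thesis by auto
qed

text \<open>All starting values over all points are demanded at once, so that the lift over an
  adjacent piece can be started wherever the previous one has arrived.\<close>

definition liftable :: "((real \<times> real) \<Rightarrow> 'q) \<Rightarrow> (real \<times> real) set \<Rightarrow> bool" where
  "liftable h S \<longleftrightarrow> (\<forall>z0\<in>S. \<forall>y0\<in>topspace Y. \<pi> y0 = h z0 \<longrightarrow>
     (\<exists>l. continuous_map (top_of_set S) Y l \<and> (\<forall>z\<in>S. \<pi> (l z) = h z) \<and> l z0 = y0))"

text \<open>\<open>\<pi>\<close> restricts to a homeomorphism from \<open>U\<close> onto its image;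
  the inverse \<open>r\<close> lifts \<open>h\<close>, and an element of \<open>G\<close> moves this
  lift to the one through \<open>y0\<close>.\<close>

lemma liftable_small:
  assumes h: "continuous_map (top_of_set S) Q h" and U: "openin Y U" "inj_on \<pi> U"
    and im: "h ` S \<subseteq> \<pi> ` U"
  shows "liftable h S"
  unfolding liftable_def
proof (intro ballI impI)
  fix z0 y0 assume z0: "z0 \<in> S" and y0: "y0 \<in> topspace Y" "\<pi> y0 = h z0"
  have UY: "U \<subseteq> topspace Y" using U(1) by (rule openin_subset)
  have "openin Q (\<pi> ` U)" using op U(1) by (simp add: open_map_def)
  then have VQ: "\<pi> ` U \<subseteq> topspace Q" by (rule openin_subset)
  have "homeomorphic_map (subtopology Y U) (subtopology Q (\<pi> ` U)) \<pi>"
  proof (rule bijective_open_imp_homeomorphic_map)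
    show "continuous_map (subtopology Y U) (subtopology Q (\<pi> ` U)) \<pi>"
      using cont UY by (auto simp: continuous_map_in_subtopology continuous_map_from_subtopology)
    show "open_map (subtopology Y U) (subtopology Q (\<pi> ` U)) \<pi>"
      unfolding open_map_def
    proof (intro allI impI)
      fix W assume "openin (subtopology Y U) W"
      then have W: "openin Y W" "W \<subseteq> U"
        using U(1) by (simp_all add: openin_open_subtopology)
      then have "openin Q (\<pi> ` W)" using op by (simp add: open_map_def)
      then show "openin (subtopology Q (\<pi> ` U)) (\<pi> ` W)"
        using W(2) openin_subtopology_Int[of Q "\<pi> ` W" "\<pi> ` U"] by (simp add: inf.absorb1 image_mono)
    qed
  qed (use UY VQ U(2) in \<open>auto simp: inj_on_def\<close>)
  then obtain r where r: "homeomorphic_maps (subtopology Y U) (subtopology Q (\<pi> ` U)) \<pi> r"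
    by (auto simp: homeomorphic_map_maps)
  obtain u where u: "u \<in> U" "\<pi> u = h z0" using im z0 by (metis image_eqI imageE subsetD)
  obtain g where g: "g \<in> G" "y0 = act g u"
    using fibre[of u y0] u y0 UY by auto
  have "continuous_map (top_of_set S) (subtopology Q (\<pi> ` U)) h"
    using h im by (auto simp: continuous_map_in_subtopology)
  then have "continuous_map (top_of_set S) (subtopology Y U) (r \<circ> h)"
    using r by (auto simp: homeomorphic_maps_def intro: continuous_map_compose)
  then have rh: "continuous_map (top_of_set S) Y (r \<circ> h)" "(r \<circ> h) ` S \<subseteq> U"
    by (auto simp: continuous_map_in_subtopology)
  have r\<pi>: "r (\<pi> x) = x" if "x \<in> U" for x
    using r that UY by (auto simp: homeomorphic_maps_def)
  have \<pi>r: "\<pi> (r (h z)) = h z" if "z \<in> S" for z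
  proof -
    from that im obtain x where "x \<in> U" "h z = \<pi> x" by auto
    then show ?thesis by (simp add: r\<pi>)
  qed
  have "\<pi> (act g y) = \<pi> y" if "y \<in> topspace Y" for y
    using fibre[of y "act g y"] that act_topspace g(1) by auto
  then have "\<forall>z\<in>S. \<pi> ((act g \<circ> (r \<circ> h)) z) = h z"
    using \<pi>r rh(2) UY by (auto simp: image_subset_iff)
  moreover have "continuous_map (top_of_set S) Y (act g \<circ> (r \<circ> h))"
    using rh(1) homeomorphic_imp_continuous_map[OF act_homeo[OF g(1)]] by (rule continuous_map_compose)
  moreover have "(act g \<circ> (r \<circ> h)) z0 = y0"
    using u g(2) r\<pi>[OF u(1)] by simp
  ultimately show "\<exists>l. continuous_map (top_of_set S) Y l \<and> (\<forall>z\<in>S. \<pi> (l z) = h z) \<and> l z0 = y0"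
    by blast
qed

text \<open>The lift over \<open>B\<close> is started at the value which the lift over
  \<open>A\<close> takes at a common point; by uniqueness over the connected overlap the two agree
  there and can be glued.\<close>

lemma liftable_Un:
  assumes "closed A" "closed B" "connected (A \<inter> B)" "A \<inter> B \<noteq> {}"
    and A: "liftable h A" and B: "liftable h B"
  shows "liftable h (A \<union> B)"
proof -
  have main: "\<exists>l. continuous_map (top_of_set (A \<union> B)) Y l \<and> (\<forall>z\<in>A \<union> B. \<pi> (l z) = h z) \<and> l z0 = y0"
    if hyp: "closed A" "closed B" "connected (A \<inter> B)" "A \<inter> B \<noteq> {}" "liftable h A" "liftable h B"
      and z0: "z0 \<in> A" and y0: "y0 \<in> topspace Y" "\<pi> y0 = h z0" for A B z0 y0
  proof -
    obtain l where l: "continuous_map (top_of_set A) Y l" "\<forall>z\<in>A. \<pi> (l z) = h z" "l z0 = y0"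
      using hyp z0 y0 unfolding liftable_def by blast
    obtain d where d: "d \<in> A" "d \<in> B" using hyp by blast
    then have "l d \<in> topspace Y" using continuous_map_funspace[OF l(1)] by auto
    then obtain k where k: "continuous_map (top_of_set B) Y k" "\<forall>z\<in>B. \<pi> (k z) = h z" "k d = l d"
      using hyp d l(2) unfolding liftable_def by metis
    have lk: "l z = k z" if "z \<in> A" "z \<in> B" for z
    proof (rule lift_unique[of "top_of_set (A \<inter> B)" l k d])
      show "continuous_map (top_of_set (A \<inter> B)) Y l" "continuous_map (top_of_set (A \<inter> B)) Y k"
        using l(1) k(1) continuous_map_from_subtopology_mono by blast+
    qed (use hyp l k d that in \<open>auto simp: connected_space_top_of_set\<close>)
    let ?m = "\<lambda>x. if x \<in> A then l x else k x"
    have "continuous_map (top_of_set (A \<union> B)) Y ?m"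
      using continuous_map_glue_closed[OF hyp(1,2) l(1) k(1)] lk by blast
    then show ?thesis
      using l k z0 by (intro exI[of _ ?m]) auto
  qed
  have BA: "connected (B \<inter> A)" "B \<inter> A \<noteq> {}" using assms(3,4) by (simp_all add: Int_commute)
  show ?thesis
    unfolding liftable_def
  proof (intro ballI impI)
    fix z0 y0 assume z0: "z0 \<in> A \<union> B" and y0: "y0 \<in> topspace Y" "\<pi> y0 = h z0"
    show "\<exists>l. continuous_map (top_of_set (A \<union> B)) Y l \<and> (\<forall>z\<in>A \<union> B. \<pi> (l z) = h z) \<and> l z0 = y0"
    proof (cases "z0 \<in> A")
      case True
      from main[OF assms this y0] show ?thesis .
    next
      case False
      with z0 have "z0 \<in> B" by simp
      from main[OF assms(2,1) BA B A this y0] show ?thesis by (simp only: Un_commute)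
    qed
  qed
qed

text \<open>A Lebesgue number argument: the cells of a fine grid are liftable, cells are glued to
  strips and strips to the square. The overlaps are segments, hence connected.\<close>

lemma liftable_square:
  assumes h: "continuous_map (top_of_set unit_square) Q h"
  shows "liftable h unit_square"
proof -
  let ?S = unit_square
  define \<G> where "\<G> = {T. open T \<and> (\<exists>U. openin Y U \<and> inj_on \<pi> U \<and> h ` (?S \<inter> T) \<subseteq> \<pi> ` U)}"
  have "?S \<subseteq> \<Union>\<G>"
  proof
    fix z assume z: "z \<in> ?S"
    then have "h z \<in> topspace Q" using continuous_map_funspace[OF h] by auto
    then obtain y where y: "y \<in> topspace Y" "\<pi> y = h z" using surj by (metis imageE)
    obtain U where U: "openin Y U" "y \<in> U" "inj_on \<pi> U" using loc_inj y by blast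
    have "openin Q (\<pi> ` U)" using op U(1) by (simp add: open_map_def)
    from openin_continuous_map_preimage[OF h this]
    have "openin (top_of_set ?S) {x \<in> ?S. h x \<in> \<pi> ` U}" by simp
    then obtain T where T: "open T" "{x \<in> ?S. h x \<in> \<pi> ` U} = ?S \<inter> T"
      by (auto simp: openin_open)
    have "h ` (?S \<inter> T) \<subseteq> \<pi> ` U" unfolding T(2)[symmetric] by blast
    with T(1) U have "T \<in> \<G>" unfolding \<G>_def by blast
    moreover have "h z \<in> \<pi> ` U" using y(2) U(2) by (metis imageI)
    with z T(2) have "z \<in> T" by blast
    ultimately show "z \<in> \<Union>\<G>" by blast
  qed
  moreover have "compact ?S" by (simp add: compact_Times)
  moreover have "open T" if "T \<in> \<G>" for T using that unfolding \<G>_def by blast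
  ultimately obtain e where e: "e > 0" "\<And>x. x \<in> ?S \<Longrightarrow> \<exists>T\<in>\<G>. ball x e \<subseteq> T"
    using Heine_Borel_lemma[of ?S \<G>] by metis
  \<comment> \<open>Points of a grid cell are at distance at most 2/n from its corner, each
    coordinate contributing 1/n; this has to stay below the Lebesgue number
    \<open>e\<close>.\<close>
  obtain n :: nat where n: "n > 0" "2 / real n < e"
  proof -
    obtain n :: nat where "2 / e < real n" using reals_Archimedean2 by blast
    moreover then have "n > 0" using e(1) by (metis divide_pos_pos gr0I less_asym of_nat_0 zero_less_numeral)
    ultimately show ?thesis using that e(1) by (simp add: field_simps)
  qed
  let ?I = "\<lambda>i::nat. {real i / real n .. real (Suc i) / real n}"
  have cell: "liftable h (?I i \<times> ?I j)" if "i < n" "j < n" for i j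
  proof -
    have "?I i \<subseteq> {0..1}" if "i < n" for i
      using that n(1) by (intro atLeastatMost_subset_iff[THEN iffD2] disjI2 conjI) simp_all
    then have sub: "?I i \<times> ?I j \<subseteq> ?S"
      using that by (meson Sigma_mono)
    let ?c = "(real i / real n, real j / real n)"
    have "?c \<in> ?S" using that n(1) by simp
    from e(2)[OF this] obtain T where T: "T \<in> \<G>" "ball ?c e \<subseteq> T" ..
    then obtain U where U: "openin Y U" "inj_on \<pi> U" "h ` (?S \<inter> T) \<subseteq> \<pi> ` U"
      unfolding \<G>_def by blast
    have "?I i \<times> ?I j \<subseteq> ball ?c e"
    proof clarify
      fix a b assume a: "a \<in> ?I i" and b: "b \<in> ?I j"
      have "dist ?c (a, b) \<le> dist (real i / real n) a + dist (real j / real n) b"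
        by (simp add: dist_Pair_Pair sqrt_sum_squares_le_sum)
      also have "\<dots> \<le> 2 / real n"
      proof -
        have "real (Suc i) / real n = real i / real n + 1 / real n" for i
          by (simp add: add_divide_distrib)
        then show ?thesis using a b by (simp add: dist_real_def)
      qed
      finally show "(a, b) \<in> ball ?c e" using n(2) by simp
    qed
    then have "h ` (?I i \<times> ?I j) \<subseteq> \<pi> ` U"
      using T(2) U(3) sub by blast
    then show ?thesis
      using liftable_small U continuous_map_from_subtopology_mono[OF h sub] by blast
  qed
  have split: "{0..real (Suc i) / real n} = {0..real i / real n} \<union> ?I i"
    "{0..real i / real n} \<inter> ?I i = {real i / real n}" for i
  proof -
    have *: "0 \<le> real i / real n" "real i / real n \<le> real (Suc i) / real n"
      by (simp_all add: divide_right_mono)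
    show "{0..real (Suc i) / real n} = {0..real i / real n} \<union> ?I i"
      "{0..real i / real n} \<inter> ?I i = {real i / real n}"
      using ivl_disj_un_two_touch(4)[OF *] * by (simp_all del: of_nat_Suc add: Int_atLeastAtMost)
  qed
  have strip: "liftable h ({0..real (Suc i) / real n} \<times> ?I j)" if "i < n" "j < n" for i j
    using that(1)
  proof (induction i)
    case 0
    then show ?case using cell[of 0 j] that by simp
  next
    case (Suc i)
    have "liftable h ({0..real (Suc i) / real n} \<times> ?I j \<union> ?I (Suc i) \<times> ?I j)"
    proof (rule liftable_Un)
      show "connected ({0..real (Suc i) / real n} \<times> ?I j \<inter> ?I (Suc i) \<times> ?I j)"
        by (intro convex_connected convex_Int convex_Times) auto
      show "{0..real (Suc i) / real n} \<times> ?I j \<inter> ?I (Suc i) \<times> ?I j \<noteq> {}"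
        unfolding Times_Int_Times split(2)[of "Suc i"]
        by (simp del: of_nat_Suc add: Sigma_empty_iff divide_right_mono not_less)
      show "liftable h ({0..real (Suc i) / real n} \<times> ?I j)" using Suc by simp
      show "liftable h (?I (Suc i) \<times> ?I j)" using cell Suc.prems that by blast
    qed (auto intro!: closed_Times)
    then show ?case
      unfolding split(1)[of "Suc i"] by (simp only: Sigma_Un_distrib1)
  qed
  have "liftable h ({0..1} \<times> {0..real (Suc j) / real n})" if "j < n" for j
    using that
  proof (induction j)
    case 0
    then show ?case using strip[of "n - 1" 0] n by simp
  next
    case (Suc j)
    have "liftable h ({0..1} \<times> ?I (Suc j))"
      using strip[of "n - 1" "Suc j"] n Suc by simp
    moreover have "liftable h ({0..1} \<times> {0..real (Suc j) / real n})" using Suc by simp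
    ultimately have "liftable h ({0..1} \<times> {0..real (Suc j) / real n} \<union> {0..1} \<times> ?I (Suc j))"
    proof (intro liftable_Un)
      show "connected ({0..1} \<times> {0..real (Suc j) / real n} \<inter> {0..1::real} \<times> ?I (Suc j))"
        by (intro convex_connected convex_Int convex_Times) auto
      show "{0..1} \<times> {0..real (Suc j) / real n} \<inter> {0..1::real} \<times> ?I (Suc j) \<noteq> {}"
        unfolding Times_Int_Times split(2)[of "Suc j"] by auto
    qed (auto intro!: closed_Times)
    then show ?case
      unfolding split(1)[of "Suc j"] by (simp only: Sigma_Un_distrib2)
  qed
  from this[of "n - 1"] n show ?thesis by simp
qed

text \<open>A path is treated as a homotopy that does not depend on its first coordinate, which
  leaves the square as the only case of lifting.\<close>

lemma lift_path:
  assumes p: "path_from Q (\<pi> y) b p" and y: "y \<in> topspace Y"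
  obtains l where "path_from Y y (l 1) l" "\<And>t. t \<in> {0..1} \<Longrightarrow> \<pi> (l t) = p t"
proof -
  have "continuous_map (top_of_set unit_square) Q (p \<circ> snd)"
    using p unfolding path_from_def pathin_def
    by (intro continuous_map_compose[where X'="top_of_set {0..1}"])
       (auto simp: continuous_map_in_subtopology intro!: continuous_intros)
  from liftable_square[OF this, unfolded liftable_def, rule_format, of "(0, 0)" y] p y obtain l
    where l: "continuous_map (top_of_set unit_square) Y l" "\<forall>z\<in>unit_square. \<pi> (l z) = p (snd z)" "l (0, 0) = y"
    by (auto simp: path_from_def)
  have "continuous_map (top_of_set {0..1}) Y (l \<circ> (\<lambda>t. (0, t)))"
    by (rule continuous_map_compose[OF _ l(1)])
       (auto simp: continuous_map_in_subtopology intro!: continuous_intros)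
  then show ?thesis
    using l(2,3) by (intro that[of "l \<circ> (\<lambda>t. (0, t))"]) (auto simp: path_from_def pathin_def)
qed

text \<open>The homotopy is lifted to a map \<open>m\<close> of the square, whose edges are
  determined by uniqueness of lifts: over the sides where \<open>h\<close> is constant
  \<open>m\<close> is constant, over the other two it is \<open>l\<close> and \<open>l'\<close>. So
  the end points agree and \<open>m\<close> is the homotopy sought.\<close>

lemma lift_path_hom:
  assumes l: "path_from Y y a l" and l': "path_from Y y a' l'"
    and hom: "path_hom Q (\<pi> y) b p p'"
    and p: "\<And>t. t \<in> {0..1} \<Longrightarrow> \<pi> (l t) = p t" "\<And>t. t \<in> {0..1} \<Longrightarrow> \<pi> (l' t) = p' t"
  shows "a = a'" "path_hom Y y a l l'"
proof -
  obtain h where h: "continuous_map (top_of_set unit_square) Q h"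
    "\<forall>t\<in>{0..1}. h (0, t) = p t \<and> h (1, t) = p' t"
    "\<forall>s\<in>{0..1}. h (s, 0) = \<pi> y \<and> h (s, 1) = b"
    using hom unfolding path_hom_iff by blast
  have y: "y \<in> topspace Y" using path_from_imp_topspace(1)[OF l] .
  with liftable_square[OF h(1), unfolded liftable_def, rule_format, of "(0, 0)" y] h(3) obtain m where
    m: "continuous_map (top_of_set unit_square) Y m" "\<forall>z\<in>unit_square. \<pi> (m z) = h z" "m (0, 0) = y"
    by auto
  have mc: "continuous_map (top_of_set {0..1}) Y (\<lambda>t. m (f t))"
    if "continuous_on {0..1::real} f" "f ` {0..1} \<subseteq> unit_square" for f
    using continuous_map_compose[OF _ m(1), of "top_of_set {0..1}" f] that
    by (simp add: continuous_map_in_subtopology o_def image_subset_iff_funcset)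
  have m_path: "continuous_map (top_of_set {0..1}) Y (\<lambda>s. m (s, c))"
    "continuous_map (top_of_set {0..1}) Y (\<lambda>s. m (c, s))" if "c \<in> {0..1}" for c
    using that by (auto intro!: mc continuous_intros)
  have unique: "k t = k' t"
    if "continuous_map (top_of_set {0..1}) Y k" "continuous_map (top_of_set {0..1}) Y k'"
      "\<And>t. t \<in> {0..1} \<Longrightarrow> \<pi> (k t) = \<pi> (k' t)" "k 0 = k' 0" "t \<in> {0..1::real}" for k k' t
    using lift_unique[of "top_of_set {0..1}" k k' 0 t] that by (simp add: connected_space_top_of_set)
  have ll: "continuous_map (top_of_set {0..1}) Y l" "continuous_map (top_of_set {0..1}) Y l'"
    "l 0 = y" "l 1 = a" "l' 0 = y" "l' 1 = a'"
    using l l' by (auto simp: path_from_def pathin_def)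
  have left: "m (s, 0) = y" if "s \<in> {0..1}" for s
    by (rule unique[of "\<lambda>s. m (s, 0)" "\<lambda>s. y" s]) (use that m h(3) y m_path in auto)
  have m0: "m (0, t) = l t" if "t \<in> {0..1}" for t
    by (rule unique[of "\<lambda>t. m (0, t)" l t]) (use that m h(2) ll p(1) m_path in auto)
  have m1: "m (1, t) = l' t" if "t \<in> {0..1}" for t
    by (rule unique[of "\<lambda>t. m (1, t)" l' t]) (use that m h(2) ll p(2) left[of 1] m_path in auto)
  have "m (0, 1) \<in> topspace Y"
    using continuous_map_funspace[OF m(1)] by auto
  then have "m (s, 1) = m (0, 1)" if "s \<in> {0..1}" for s
    by (intro unique[of "\<lambda>s. m (s, 1)" "\<lambda>s. m (0, 1)" s]) (use that m h(3) m_path in auto)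
  then have right: "m (s, 1) = a" if "s \<in> {0..1}" for s
    using that m0[of 1] ll(4) by simp
  show "a = a'" using right[of 1] m1[of 1] ll(6) by simp
  show "path_hom Y y a l l'"
    by (rule path_homI[OF m(1)]) (use left right m0 m1 in auto)
qed

end

section \<open>Contractible spaces\<close>

text \<open>If \<open>H\<close> contracts the space to a point, then \<open>(s, t) \<mapsto> H (s, p t)\<close> deforms \<open>p\<close> to the path
  going along the tracks of its end points, which does not depend on \<open>p\<close>.\<close>

lemma contractible_space_path_hom:
  assumes X: "contractible_space X" and p: "path_from X a b p" and q: "path_from X a b q"
  shows "path_hom X a b p q"
proof -
  obtain c H where H: "continuous_map (prod_topology (top_of_set {0..1::real}) X) X H"
    "\<And>x. H (0, x) = x" "\<And>x. H (1, x) = c"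
    using X unfolding contractible_space_def homotopic_with_def by auto
  \<comment> \<open>\<open>u\<close> runs along three sides of the square, a third of the time on
    each: \<open>H\<close> follows the track of \<open>a\<close> to the centre \<open>c\<close>,
    rests there while \<open>p\<close> is run through, and returns along the track of
    \<open>b\<close>. Only the middle third sees the interior of \<open>p\<close>, and there
    \<open>H\<close> is constant.\<close>
  define u :: "real \<Rightarrow> real \<times> real" where
    "u t = (min 1 (min (3 * t) (3 - 3 * t)), max 0 (min 1 (3 * t - 1)))" for t
  have u: "continuous_on {0..1} u" "u ` {0..1} \<subseteq> unit_square" "u 0 = (0, 0)" "u 1 = (0, 1)"
    by (auto simp: u_def[abs_def] intro!: continuous_intros)
  have step: "path_hom X a b p (\<lambda>t. H (fst (u t), p (snd (u t))))" if p: "path_from X a b p" for p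
  proof -
    let ?M = "H \<circ> (\<lambda>z. (fst z, p (snd z)))"
    have "continuous_map (top_of_set unit_square) X (p \<circ> snd)"
      using p unfolding path_from_def pathin_def
      by (intro continuous_map_compose[where X'="top_of_set {0..1}"])
         (auto simp: continuous_map_in_subtopology intro!: continuous_intros)
    then have "continuous_map (top_of_set unit_square) X ?M"
      by (intro continuous_map_compose[OF _ H(1)])
         (auto simp: continuous_map_in_subtopology continuous_map_pairwise o_def intro!: continuous_intros)
    then have "path_hom X a b (?M \<circ> (\<lambda>t. (0, t))) (?M \<circ> u)"
      using p u H by (intro path_hom_in_convex[of unit_square])
        (auto simp: path_from_def convex_Times intro!: continuous_intros)
    then show ?thesis
      by (rule path_hom_cong) (simp_all add: H(2))
  qed
  have "H (fst (u t), p (snd (u t))) = H (fst (u t), q (snd (u t)))" for t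
  proof -
    consider "t \<le> 1/3" | "1/3 \<le> t" "t \<le> 2/3" | "2/3 \<le> t" by linarith
    then have "snd (u t) = 0 \<or> fst (u t) = 1 \<or> snd (u t) = 1"
      by cases (simp_all add: u_def)
    then show ?thesis
      using p q by (auto simp: H(3) path_from_def)
  qed
  with step[OF p] step[OF q] show ?thesis
    using path_hom_sym path_hom_trans by fastforce
qed

section \<open>Quotients of products by free diagonal actions\<close>

text \<open>Used with \<open>F\<close> the rotation group and with \<open>F\<close> the space
  \<open>E\<close>, while \<open>X\<close> is an approximant. All separation is asked of
  \<open>F\<close>: freeness of the finite group there makes the projection locally injective on the
  product.\<close>

locale diagonal_quotient =
  fixes X :: "'x topology" and F :: "'f topology" and \<G> :: "'g monoid"
    and \<rho> :: "'g \<Rightarrow> 'x \<Rightarrow> 'x" and \<sigma> :: "'g \<Rightarrow> 'f \<Rightarrow> 'f"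
    and Q :: "'q topology" and \<pi> :: "'x \<times> 'f \<Rightarrow> 'q"
  assumes grp: "group \<G>" and fin: "finite (carrier \<G>)"
    and \<rho>_cont: "g \<in> carrier \<G> \<Longrightarrow> continuous_map X X (\<rho> g)"
    and \<sigma>_cont: "g \<in> carrier \<G> \<Longrightarrow> continuous_map F F (\<sigma> g)"
    and \<rho>_one: "x \<in> topspace X \<Longrightarrow> \<rho> \<one>\<^bsub>\<G>\<^esub> x = x"
    and \<sigma>_one: "f \<in> topspace F \<Longrightarrow> \<sigma> \<one>\<^bsub>\<G>\<^esub> f = f"
    and \<rho>_mult: "g \<in> carrier \<G> \<Longrightarrow> h \<in> carrier \<G> \<Longrightarrow> x \<in> topspace X \<Longrightarrow> \<rho> (g \<otimes>\<^bsub>\<G>\<^esub> h) x = \<rho> g (\<rho> h x)"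
    and \<sigma>_mult: "g \<in> carrier \<G> \<Longrightarrow> h \<in> carrier \<G> \<Longrightarrow> f \<in> topspace F \<Longrightarrow> \<sigma> (g \<otimes>\<^bsub>\<G>\<^esub> h) f = \<sigma> g (\<sigma> h f)"
    and \<sigma>_free: "g \<in> carrier \<G> \<Longrightarrow> f \<in> topspace F \<Longrightarrow> \<sigma> g f = f \<Longrightarrow> g = \<one>\<^bsub>\<G>\<^esub>"
    and Haus: "Hausdorff_space F"
    and \<pi>_cont: "continuous_map (prod_topology X F) Q \<pi>"
    and \<pi>_open: "open_map (prod_topology X F) Q \<pi>"
    and \<pi>_surj: "\<pi> ` (topspace X \<times> topspace F) = topspace Q"
    and \<pi>_eq: "x \<in> topspace X \<Longrightarrow> x' \<in> topspace X \<Longrightarrow> f \<in> topspace F \<Longrightarrow> f' \<in> topspace F \<Longrightarrow>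
      \<pi> (x, f) = \<pi> (x', f') \<longleftrightarrow> (\<exists>g\<in>carrier \<G>. x' = \<rho> g x \<and> f' = \<sigma> g f)"
begin

interpretation group \<G> by (rule grp)

lemma \<rho>_in: "g \<in> carrier \<G> \<Longrightarrow> x \<in> topspace X \<Longrightarrow> \<rho> g x \<in> topspace X"
  using continuous_map_funspace[OF \<rho>_cont] by auto

lemma \<sigma>_in: "g \<in> carrier \<G> \<Longrightarrow> f \<in> topspace F \<Longrightarrow> \<sigma> g f \<in> topspace F"
  using continuous_map_funspace[OF \<sigma>_cont] by auto

text \<open>For each \<open>g\<close> other than the identity, \<open>f\<close> and its translate
  have disjoint neighbourhoods; the finitely many resulting conditions are intersected.\<close>

lemma ex_free_nhd:
  assumes f: "f \<in> topspace F"
  shows "\<exists>V. openin F V \<and> f \<in> V \<and> (\<forall>g\<in>carrier \<G>. \<forall>v\<in>V. \<sigma> g v \<in> V \<longrightarrow> g = \<one>\<^bsub>\<G>\<^esub>)"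
proof -
  have "\<exists>V. openin F V \<and> f \<in> V \<and> (\<forall>v\<in>V. \<sigma> g v \<notin> V)" if g: "g \<in> carrier \<G>" "g \<noteq> \<one>\<^bsub>\<G>\<^esub>" for g
  proof -
    have "\<sigma> g f \<noteq> f" using \<sigma>_free g f by blast
    then obtain A B where AB: "openin F A" "openin F B" "f \<in> A" "\<sigma> g f \<in> B" "disjnt A B"
      using Haus f \<sigma>_in[OF g(1) f] unfolding Hausdorff_space_def by metis
    let ?V = "A \<inter> {v \<in> topspace F. \<sigma> g v \<in> B}"
    have "openin F ?V"
      using AB(1) openin_continuous_map_preimage[OF \<sigma>_cont[OF g(1)] AB(2)] by (rule openin_Int)
    then show ?thesis
      using AB f by (intro exI[of _ ?V]) (auto simp: disjnt_iff)
  qed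
  then obtain V where V: "\<And>g. g \<in> carrier \<G> \<Longrightarrow> g \<noteq> \<one>\<^bsub>\<G>\<^esub> \<Longrightarrow>
      openin F (V g) \<and> f \<in> V g \<and> (\<forall>v\<in>V g. \<sigma> g v \<notin> V g)"
    by metis
  let ?N = "carrier \<G> - {\<one>\<^bsub>\<G>\<^esub>}"
  let ?V = "(\<Inter>g\<in>?N. V g) \<inter> topspace F"
  have "openin F ?V"
    using V fin by (intro openin_INT) auto
  then show ?thesis
    using V f by (intro exI[of _ ?V]) blast
qed

sublocale free_quotient "prod_topology X F" Q \<pi> "carrier \<G>" "\<lambda>g (x, f). (\<rho> g x, \<sigma> g f)"
proof
  show "continuous_map (prod_topology X F) Q \<pi>" by (rule \<pi>_cont)
  show "open_map (prod_topology X F) Q \<pi>" by (rule \<pi>_open)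
  show "\<pi> ` topspace (prod_topology X F) = topspace Q" by (simp add: \<pi>_surj)
next
  fix g assume g: "g \<in> carrier \<G>"
  have "continuous_map (prod_topology X F) (prod_topology X F) (\<lambda>(x, f). (\<rho> g x, \<sigma> g f))"
    if "g \<in> carrier \<G>" for g
    using \<rho>_cont[OF that] \<sigma>_cont[OF that]
    by (simp add: continuous_map_prod_top)
  moreover have "\<rho> g (\<rho> (inv\<^bsub>\<G>\<^esub> g) x) = x" "\<rho> (inv\<^bsub>\<G>\<^esub> g) (\<rho> g x) = x" if "x \<in> topspace X" for x
    using \<rho>_mult[of g "inv\<^bsub>\<G>\<^esub> g" x] \<rho>_mult[of "inv\<^bsub>\<G>\<^esub> g" g x] g that \<rho>_one by auto
  moreover have "\<sigma> g (\<sigma> (inv\<^bsub>\<G>\<^esub> g) f) = f" "\<sigma> (inv\<^bsub>\<G>\<^esub> g) (\<sigma> g f) = f" if "f \<in> topspace F" for f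
    using \<sigma>_mult[of g "inv\<^bsub>\<G>\<^esub> g" f] \<sigma>_mult[of "inv\<^bsub>\<G>\<^esub> g" g f] g that \<sigma>_one by auto
  ultimately have "homeomorphic_maps (prod_topology X F) (prod_topology X F)
      (\<lambda>(x, f). (\<rho> g x, \<sigma> g f)) (\<lambda>(x, f). (\<rho> (inv\<^bsub>\<G>\<^esub> g) x, \<sigma> (inv\<^bsub>\<G>\<^esub> g) f))"
    using g by (auto simp: homeomorphic_maps_def)
  then show "homeomorphic_map (prod_topology X F) (prod_topology X F) (\<lambda>(x, f). (\<rho> g x, \<sigma> g f))"
    using homeomorphic_map_maps by blast
next
  fix y y' assume "y \<in> topspace (prod_topology X F)" "y' \<in> topspace (prod_topology X F)"
  then show "\<pi> y = \<pi> y' \<longleftrightarrow> (\<exists>g\<in>carrier \<G>. y' = (\<lambda>(x, f). (\<rho> g x, \<sigma> g f)) y)"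
    by (cases y; cases y') (simp add: \<pi>_eq)
next
  fix g y z
  assume "g \<in> carrier \<G>" "y \<in> topspace (prod_topology X F)" "(\<lambda>(x, f). (\<rho> g x, \<sigma> g f)) y = y"
    "z \<in> topspace (prod_topology X F)"
  then show "(\<lambda>(x, f). (\<rho> g x, \<sigma> g f)) z = z"
    using \<sigma>_free \<rho>_one \<sigma>_one by auto
next
  fix y assume "y \<in> topspace (prod_topology X F)"
  then obtain x f where y: "y = (x, f)" "x \<in> topspace X" "f \<in> topspace F" by auto
  obtain V where V: "openin F V" "f \<in> V" "\<forall>g\<in>carrier \<G>. \<forall>v\<in>V. \<sigma> g v \<in> V \<longrightarrow> g = \<one>\<^bsub>\<G>\<^esub>"
    using ex_free_nhd[OF y(3)] by blast
  have VF: "V \<subseteq> topspace F" using V(1) openin_subset by blast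
  have "inj_on \<pi> (topspace X \<times> V)"
  proof (rule inj_onI, clarify)
    fix x1 f1 x2 f2
    assume *: "x1 \<in> topspace X" "f1 \<in> V" "x2 \<in> topspace X" "f2 \<in> V" "\<pi> (x1, f1) = \<pi> (x2, f2)"
    then obtain g where "g \<in> carrier \<G>" "x2 = \<rho> g x1" "f2 = \<sigma> g f1"
      using \<pi>_eq[of x1 x2 f1 f2] VF by blast
    with * V(3) have "g = \<one>\<^bsub>\<G>\<^esub>" by blast
    then show "x1 = x2 \<and> f1 = f2"
      using * \<open>x2 = _\<close> \<open>f2 = _\<close> \<rho>_one \<sigma>_one VF by auto
  qed
  then show "\<exists>U. openin (prod_topology X F) U \<and> y \<in> U \<and> inj_on \<pi> U"
    using V y by (intro exI[of _ "topspace X \<times> V"]) (auto simp: openin_prod_Times_iff)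
qed

text \<open>A loop downstairs is recorded by an element \<open>g\<close> together with a path from the base point to
  its translate by \<open>g\<close> in each factor.\<close>

definition loop_data :: "'x \<Rightarrow> 'f \<Rightarrow> 'g \<Rightarrow> (real \<Rightarrow> 'x) \<Rightarrow> (real \<Rightarrow> 'f) \<Rightarrow> bool" where
  "loop_data x f g k p \<longleftrightarrow> g \<in> carrier \<G> \<and> path_from X x (\<rho> g x) k \<and> path_from F f (\<sigma> g f) p"

definition loop_of :: "'x \<Rightarrow> 'f \<Rightarrow> (real \<Rightarrow> 'x) \<Rightarrow> (real \<Rightarrow> 'f) \<Rightarrow> (real \<Rightarrow> 'q) set" where
  "loop_of x f k p = loop_class Q (\<pi> (x, f)) (\<lambda>t. \<pi> (k t, p t))"

lemma loop_data_topspace: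
  assumes "loop_data x f g k p" shows "x \<in> topspace X" "f \<in> topspace F" "g \<in> carrier \<G>"
  using assms path_from_imp_topspace(1)[of X] path_from_imp_topspace(1)[of F]
  unfolding loop_data_def by auto

lemma \<pi>_act: "g \<in> carrier \<G> \<Longrightarrow> x \<in> topspace X \<Longrightarrow> f \<in> topspace F \<Longrightarrow> \<pi> (\<rho> g x, \<sigma> g f) = \<pi> (x, f)"
  using \<pi>_eq[of x "\<rho> g x" f "\<sigma> g f"] \<rho>_in \<sigma>_in by auto

lemma path_from_pair:
  "path_from (prod_topology X F) a b l \<longleftrightarrow>
     path_from X (fst a) (fst b) (fst \<circ> l) \<and> path_from F (snd a) (snd b) (snd \<circ> l)"
  by (auto simp: path_from_def pathin_def continuous_map_pairwise prod_eq_iff)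

lemma path_from_loop:
  assumes "loop_data x f g k p"
  shows "path_from Q (\<pi> (x, f)) (\<pi> (x, f)) (\<lambda>t. \<pi> (k t, p t))"
proof -
  have "path_from (prod_topology X F) (x, f) (\<rho> g x, \<sigma> g f) (\<lambda>t. (k t, p t))"
    using assms by (simp add: path_from_pair loop_data_def o_def)
  from path_from_compose[OF this \<pi>_cont refl \<pi>_act] loop_data_topspace[OF assms]
  show ?thesis by (simp add: o_def)
qed

lemma loop_of_in_carrier:
  "loop_data x f g k p \<Longrightarrow> loop_of x f k p \<in> carrier (fundamental_group Q (\<pi> (x, f)))"
  using path_from_loop by (auto simp: carrier_fundamental_group loop_of_def)

text \<open>\<open>g\<close> is the monodromy: the lift of the loop through \<open>(x, f)\<close>
  ends in the fibre in which it started, hence at a translate of its starting point.\<close>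

lemma loop_decompose:
  assumes a: "a \<in> carrier (fundamental_group Q (\<pi> (x, f)))" and x: "x \<in> topspace X" and f: "f \<in> topspace F"
  obtains g k p where "loop_data x f g k p" "a = loop_of x f k p"
proof -
  obtain q where q: "path_from Q (\<pi> (x, f)) (\<pi> (x, f)) q" "a = loop_class Q (\<pi> (x, f)) q"
    using a by (auto simp: carrier_fundamental_group)
  obtain l where l: "path_from (prod_topology X F) (x, f) (l 1) l" "\<And>t. t \<in> {0..1} \<Longrightarrow> \<pi> (l t) = q t"
    using lift_path[OF q(1)] x f by auto
  have l1: "l 1 \<in> topspace X \<times> topspace F"
    using path_from_imp_topspace(2)[OF l(1)] by simp
  have "\<pi> (l 1) = \<pi> (x, f)" using l(2)[of 1] q(1) by (simp add: path_from_def)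
  then obtain g where g: "g \<in> carrier \<G>" "l 1 = (\<rho> g x, \<sigma> g f)"
    using \<pi>_eq[of x "fst (l 1)" f "snd (l 1)"] x f l1 by (metis mem_Times_iff prod.collapse)
  have data: "loop_data x f g (fst \<circ> l) (snd \<circ> l)"
    using l(1) g by (simp add: path_from_pair loop_data_def)
  have "path_hom Q (\<pi> (x, f)) (\<pi> (x, f)) q (\<lambda>t. \<pi> ((fst \<circ> l) t, (snd \<circ> l) t))"
    using path_hom_eq[OF q(1)] l(2) by simp
  then have "a = loop_of x f (fst \<circ> l) (snd \<circ> l)"
    unfolding loop_of_def q(2) using loop_class_eq_iff[OF q(1)] by simp
  with data show ?thesis by (rule that)
qed

text \<open>A homotopy of the loops lifts to the product with both ends fixed. In particular the two
  lifts end at the same point, and freeness on \<open>F\<close> turns this into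
  \<open>g = g'\<close>.\<close>

lemma loop_of_eqD:
  assumes d: "loop_data x f g k p" and d': "loop_data x f g' k' p'"
    and eq: "loop_of x f k p = loop_of x f k' p'"
  shows "g = g'" "path_hom X x (\<rho> g x) k k'" "path_hom F f (\<sigma> g f) p p'"
proof -
  note top = loop_data_topspace[OF d] loop_data_topspace(3)[OF d']
  have hom: "path_hom Q (\<pi> (x, f)) (\<pi> (x, f)) (\<lambda>t. \<pi> (k t, p t)) (\<lambda>t. \<pi> (k' t, p' t))"
    using eq loop_class_eq_iff[OF path_from_loop[OF d]] by (simp add: loop_of_def)
  have l: "path_from (prod_topology X F) (x, f) (\<rho> g x, \<sigma> g f) (\<lambda>t. (k t, p t))"
    and l': "path_from (prod_topology X F) (x, f) (\<rho> g' x, \<sigma> g' f) (\<lambda>t. (k' t, p' t))"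
    using d d' by (simp_all add: path_from_pair loop_data_def o_def)
  note lift = lift_path_hom[OF l l' hom refl refl]
  have "\<sigma> (inv\<^bsub>\<G>\<^esub> g \<otimes>\<^bsub>\<G>\<^esub> g') f = f"
    using lift(1) \<sigma>_mult[of "inv\<^bsub>\<G>\<^esub> g" g' f] \<sigma>_mult[of "inv\<^bsub>\<G>\<^esub> g" g f] \<sigma>_one top by simp
  then have "inv\<^bsub>\<G>\<^esub> g \<otimes>\<^bsub>\<G>\<^esub> g' = \<one>\<^bsub>\<G>\<^esub>"
    using \<sigma>_free top by simp
  then show "g = g'" using top by (metis inv_equality inv_inv inv_closed)
  from path_hom_compose[OF lift(2) continuous_map_fst refl refl]
    path_hom_compose[OF lift(2) continuous_map_snd refl refl]
  show "path_hom X x (\<rho> g x) k k'" "path_hom F f (\<sigma> g f) p p'"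
    by (simp_all add: o_def)
qed

lemma loop_of_eqI:
  assumes d: "loop_data x f g k p" and "path_hom X x (\<rho> g x) k k'" "path_hom F f (\<sigma> g f) p p'"
  shows "loop_of x f k p = loop_of x f k' p'" "loop_data x f g k' p'"
proof -
  show d': "loop_data x f g k' p'"
    using d path_hom_imp_path_from(2)[OF assms(2)] path_hom_imp_path_from(2)[OF assms(3)]
    by (simp add: loop_data_def)
  have "path_hom (prod_topology X F) (x, f) (\<rho> g x, \<sigma> g f) (\<lambda>t. (k t, p t)) (\<lambda>t. (k' t, p' t))"
  proof -
    obtain h where h: "continuous_map (top_of_set unit_square) X h"
      "\<forall>t\<in>{0..1}. h (0, t) = k t \<and> h (1, t) = k' t" "\<forall>s\<in>{0..1}. h (s, 0) = x \<and> h (s, 1) = \<rho> g x"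
      using assms(2) unfolding path_hom_iff by blast
    obtain j where j: "continuous_map (top_of_set unit_square) F j"
      "\<forall>t\<in>{0..1}. j (0, t) = p t \<and> j (1, t) = p' t" "\<forall>s\<in>{0..1}. j (s, 0) = f \<and> j (s, 1) = \<sigma> g f"
      using assms(3) unfolding path_hom_iff by blast
    show ?thesis
      by (rule path_homI[of _ "\<lambda>z. (h z, j z)"])
        (use h j in \<open>auto simp: continuous_map_pairwise o_def\<close>)
  qed
  from path_hom_compose[OF this \<pi>_cont refl \<pi>_act] loop_data_topspace[OF d]
  show "loop_of x f k p = loop_of x f k' p'"
    using loop_class_eq_iff[OF path_from_loop[OF d]] by (simp add: loop_of_def o_def)
qed

text \<open>The second loop has to be lifted from where the first lift ended, which translates its
  lift by \<open>g\<close>, as in a semidirect product.\<close>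

lemma loop_of_mult:
  assumes d: "loop_data x f g k p" and d': "loop_data x f g' k' p'"
  shows "loop_data x f (g \<otimes>\<^bsub>\<G>\<^esub> g') (join_loops k (\<rho> g \<circ> k')) (join_loops p (\<sigma> g \<circ> p'))"
    and "loop_of x f k p \<otimes>\<^bsub>fundamental_group Q (\<pi> (x, f))\<^esub> loop_of x f k' p' =
      loop_of x f (join_loops k (\<rho> g \<circ> k')) (join_loops p (\<sigma> g \<circ> p'))"
proof -
  note top = loop_data_topspace[OF d] loop_data_topspace(3)[OF d']
  show data: "loop_data x f (g \<otimes>\<^bsub>\<G>\<^esub> g') (join_loops k (\<rho> g \<circ> k')) (join_loops p (\<sigma> g \<circ> p'))"
    unfolding loop_data_def
  proof (intro conjI)
    show "path_from X x (\<rho> (g \<otimes>\<^bsub>\<G>\<^esub> g') x) (join_loops k (\<rho> g \<circ> k'))"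
      using d d' top path_from_compose[OF _ \<rho>_cont[of g] refl refl, of x "\<rho> g' x" k']
      by (intro path_from_join[of _ _ "\<rho> g x"]) (auto simp: loop_data_def \<rho>_mult)
    show "path_from F f (\<sigma> (g \<otimes>\<^bsub>\<G>\<^esub> g') f) (join_loops p (\<sigma> g \<circ> p'))"
      using d d' top path_from_compose[OF _ \<sigma>_cont[of g] refl refl, of f "\<sigma> g' f" p']
      by (intro path_from_join[of _ _ "\<sigma> g f"]) (auto simp: loop_data_def \<sigma>_mult)
  qed (use top in simp)
  let ?b = "\<pi> (x, f)"
  have "loop_of x f k p \<otimes>\<^bsub>fundamental_group Q ?b\<^esub> loop_of x f k' p' =
      loop_class Q ?b (join_loops (\<lambda>t. \<pi> (k t, p t)) (\<lambda>t. \<pi> (k' t, p' t)))"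
    using mult_fundamental_group path_from_loop[OF d] path_from_loop[OF d'] by (simp add: loop_of_def)
  also have "\<dots> = loop_of x f (join_loops k (\<rho> g \<circ> k')) (join_loops p (\<sigma> g \<circ> p'))"
  proof -
    have "\<pi> (\<rho> g (k' t), \<sigma> g (p' t)) = \<pi> (k' t, p' t)" if "t \<in> {0..1}" for t
    proof -
      have "path_from X x (\<rho> g' x) k'" "path_from F f (\<sigma> g' f) p'"
        using d' by (simp_all add: loop_data_def)
      from path_from_imp_topspace(3)[OF this(1) that] path_from_imp_topspace(3)[OF this(2) that]
      show ?thesis by (rule \<pi>_act[OF top(3)])
    qed
    then have "path_hom Q ?b ?b (\<lambda>t. \<pi> (join_loops k (\<rho> g \<circ> k') t, join_loops p (\<sigma> g \<circ> p') t))
        (join_loops (\<lambda>t. \<pi> (k t, p t)) (\<lambda>t. \<pi> (k' t, p' t)))"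
      by (intro path_hom_eq[OF path_from_loop[OF data]]) (auto simp: join_loops_def)
    then have "loop_class Q ?b (\<lambda>t. \<pi> (join_loops k (\<rho> g \<circ> k') t, join_loops p (\<sigma> g \<circ> p') t)) =
        loop_class Q ?b (join_loops (\<lambda>t. \<pi> (k t, p t)) (\<lambda>t. \<pi> (k' t, p' t)))"
      using loop_class_eq_iff[OF path_from_loop[OF data]] by blast
    then show ?thesis by (simp add: loop_of_def)
  qed
  finally show "loop_of x f k p \<otimes>\<^bsub>fundamental_group Q ?b\<^esub> loop_of x f k' p' =
      loop_of x f (join_loops k (\<rho> g \<circ> k')) (join_loops p (\<sigma> g \<circ> p'))" .
qed

lemma loop_data_one:
  assumes "path_from X x x k" "path_from F f f p"
  shows "loop_data x f \<one>\<^bsub>\<G>\<^esub> k p"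
  using assms path_from_imp_topspace(1)[OF assms(1)] path_from_imp_topspace(1)[OF assms(2)]
  by (simp add: loop_data_def \<rho>_one \<sigma>_one)

lemma loop_of_one: "loop_of x f (\<lambda>t. x) (\<lambda>t. f) = \<one>\<^bsub>fundamental_group Q (\<pi> (x, f))\<^esub>"
  by (simp add: loop_of_def one_fundamental_group)

end

lemma loop_class_eqI: "path_hom X b b p q \<Longrightarrow> loop_class X b p = loop_class X b q"
  using loop_class_eq_iff path_hom_imp_path_from(1) by metis

text \<open>\<open>F1\<close> stands for the rotation group, \<open>F2\<close> for the contractible
  space. Connectedness of \<open>F2\<close> lets data over \<open>F1\<close> be completed over
  \<open>F2\<close>, \<open>F2_simp\<close> makes the result independent of the path chosen, and
  connectedness of \<open>F1\<close> gives surjectivity.\<close>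

locale diagonal_pair =
  D1: diagonal_quotient X F1 \<G> \<rho> \<sigma>1 Q1 \<pi>1 + D2: diagonal_quotient X F2 \<G> \<rho> \<sigma>2 Q2 \<pi>2
  for X :: "'x topology" and F1 :: "'a topology" and F2 :: "'b topology" and \<G> :: "'g monoid"
    and \<rho> :: "'g \<Rightarrow> 'x \<Rightarrow> 'x" and \<sigma>1 :: "'g \<Rightarrow> 'a \<Rightarrow> 'a" and \<sigma>2 :: "'g \<Rightarrow> 'b \<Rightarrow> 'b"
    and Q1 :: "'p topology" and Q2 :: "'q topology" and \<pi>1 :: "'x \<times> 'a \<Rightarrow> 'p" and \<pi>2 :: "'x \<times> 'b \<Rightarrow> 'q" +
  fixes x :: 'x and f1 :: 'a and f2 :: 'b
  assumes x: "x \<in> topspace X" and f1: "f1 \<in> topspace F1" and f2: "f2 \<in> topspace F2"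
    and F1_conn: "u \<in> topspace F1 \<Longrightarrow> v \<in> topspace F1 \<Longrightarrow> \<exists>p. path_from F1 u v p"
    and F2_conn: "u' \<in> topspace F2 \<Longrightarrow> v' \<in> topspace F2 \<Longrightarrow> \<exists>p. path_from F2 u' v' p"
    and F2_simp: "path_from F2 u' v' p' \<Longrightarrow> path_from F2 u' v' q' \<Longrightarrow> path_hom F2 u' v' p' q'"
begin

abbreviation "\<Pi>1 \<equiv> fundamental_group Q1 (\<pi>1 (x, f1))"
abbreviation "\<Pi>2 \<equiv> fundamental_group Q2 (\<pi>2 (x, f2))"

text \<open>A relation is used because neither the representing data nor the path in
  \<open>F2\<close> is canonical; that it is single-valued is \<open>corresp_unique\<close>.\<close>

definition corresp :: "(real \<Rightarrow> 'p) set \<Rightarrow> (real \<Rightarrow> 'q) set \<Rightarrow> bool" where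
  "corresp a b \<longleftrightarrow> (\<exists>g k p q. D1.loop_data x f1 g k p \<and> D2.loop_data x f2 g k q \<and>
     a = D1.loop_of x f1 k p \<and> b = D2.loop_of x f2 k q)"

definition compare :: "(real \<Rightarrow> 'p) set \<Rightarrow> (real \<Rightarrow> 'q) set" where
  "compare a = (THE b. corresp a b)"

lemma groups: "group \<Pi>1" "group \<Pi>2"
proof -
  have "\<pi>1 (x, f1) \<in> topspace Q1" "\<pi>2 (x, f2) \<in> topspace Q2"
    using D1.\<pi>_surj D2.\<pi>_surj x f1 f2 by blast+
  then show "group \<Pi>1" "group \<Pi>2" by (simp_all add: group_fundamental_group)
qed

lemma corresp_carrier:
  assumes "corresp a b" shows "a \<in> carrier \<Pi>1" "b \<in> carrier \<Pi>2"
  using assms D1.loop_of_in_carrier D2.loop_of_in_carrier unfolding corresp_def by blast+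

lemma corresp_total:
  assumes "a \<in> carrier \<Pi>1" obtains b where "corresp a b"
proof -
  obtain g k p where d: "D1.loop_data x f1 g k p" "a = D1.loop_of x f1 k p"
    using D1.loop_decompose[OF assms x f1] .
  obtain q where "path_from F2 f2 (\<sigma>2 g f2) q"
    using F2_conn f2 D2.\<sigma>_in d(1) unfolding D1.loop_data_def by blast
  with d show ?thesis
    using that unfolding corresp_def D1.loop_data_def D2.loop_data_def by blast
qed

lemma corresp_surj:
  assumes "b \<in> carrier \<Pi>2" obtains a where "corresp a b"
proof -
  obtain g k p where d: "D2.loop_data x f2 g k p" "b = D2.loop_of x f2 k p"
    using D2.loop_decompose[OF assms x f2] .
  obtain q where "path_from F1 f1 (\<sigma>1 g f1) q"
    using F1_conn f1 D1.\<sigma>_in d(1) unfolding D2.loop_data_def by blast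
  with d show ?thesis
    using that unfolding corresp_def D1.loop_data_def D2.loop_data_def by blast
qed

lemma corresp_unique:
  assumes "corresp a b" "corresp a b'" shows "b = b'"
proof -
  obtain g k p q where 1: "D1.loop_data x f1 g k p" "D2.loop_data x f2 g k q"
     "a = D1.loop_of x f1 k p" "b = D2.loop_of x f2 k q"
    using assms(1) unfolding corresp_def by blast
  obtain g' k' p' q' where 2: "D1.loop_data x f1 g' k' p'" "D2.loop_data x f2 g' k' q'"
     "a = D1.loop_of x f1 k' p'" "b' = D2.loop_of x f2 k' q'"
    using assms(2) unfolding corresp_def by blast
  have eq: "D1.loop_of x f1 k p = D1.loop_of x f1 k' p'" using 1(3) 2(3) by simp
  note * = D1.loop_of_eqD[OF 1(1) 2(1) eq]
  have "path_hom F2 f2 (\<sigma>2 g f2) q q'"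
    using 1(2) 2(2) *(1) by (intro F2_simp) (simp_all add: D2.loop_data_def)
  then show ?thesis
    using D2.loop_of_eqI(1)[OF 1(2) *(2)] 1(4) 2(4) by simp
qed

lemma compare_eq: "corresp a b \<Longrightarrow> compare a = b"
  unfolding compare_def by (rule the_equality) (simp_all add: corresp_unique)

lemma corresp_compare: "a \<in> carrier \<Pi>1 \<Longrightarrow> corresp a (compare a)"
  by (metis corresp_total compare_eq)

lemma corresp_mult:
  assumes "corresp a b" "corresp a' b'"
  shows "corresp (a \<otimes>\<^bsub>\<Pi>1\<^esub> a') (b \<otimes>\<^bsub>\<Pi>2\<^esub> b')"
proof -
  obtain g k p q where 1: "D1.loop_data x f1 g k p" "D2.loop_data x f2 g k q"
     "a = D1.loop_of x f1 k p" "b = D2.loop_of x f2 k q"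
    using assms(1) unfolding corresp_def by blast
  obtain g' k' p' q' where 2: "D1.loop_data x f1 g' k' p'" "D2.loop_data x f2 g' k' q'"
     "a' = D1.loop_of x f1 k' p'" "b' = D2.loop_of x f2 k' q'"
    using assms(2) unfolding corresp_def by blast
  show ?thesis
    unfolding corresp_def 1(3,4) 2(3,4)
    using D1.loop_of_mult[OF 1(1) 2(1)] D2.loop_of_mult[OF 1(2) 2(2)] by blast
qed

lemma compare_hom: "compare \<in> hom \<Pi>1 \<Pi>2"
proof (rule homI)
  show "compare a \<in> carrier \<Pi>2" if "a \<in> carrier \<Pi>1" for a
    using corresp_carrier(2)[OF corresp_compare[OF that]] .
  show "compare (a \<otimes>\<^bsub>\<Pi>1\<^esub> b) = compare a \<otimes>\<^bsub>\<Pi>2\<^esub> compare b"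
    if "a \<in> carrier \<Pi>1" "b \<in> carrier \<Pi>1" for a b
    using compare_eq[OF corresp_mult[OF corresp_compare corresp_compare]] that by blast
qed

lemma compare_surj: "compare ` carrier \<Pi>1 = carrier \<Pi>2"
proof (intro equalityI subsetI)
  show "b \<in> carrier \<Pi>2" if "b \<in> compare ` carrier \<Pi>1" for b
    using that compare_hom by (auto simp: hom_def)
  show "b \<in> compare ` carrier \<Pi>1" if "b \<in> carrier \<Pi>2" for b
    using corresp_surj[OF that] corresp_carrier(1) compare_eq by (metis image_eqI)
qed

definition fibre_class :: "(real \<Rightarrow> 'a) \<Rightarrow> (real \<Rightarrow> 'p) set" where
  "fibre_class p = D1.loop_of x f1 (\<lambda>t. x) p"

lemma fibre_data: "path_from F1 f1 f1 p \<Longrightarrow> D1.loop_data x f1 \<one>\<^bsub>\<G>\<^esub> (\<lambda>t. x) p"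
  using D1.loop_data_one path_from_const[OF x] by blast

text \<open>Triviality over \<open>F2\<close> forces the group element to be the identity and the
  path in \<open>X\<close> to be a contractible loop, so only a loop in \<open>F1\<close>
  survives.\<close>

lemma compare_kernel:
  assumes "a \<in> carrier \<Pi>1"
  shows "compare a = \<one>\<^bsub>\<Pi>2\<^esub> \<longleftrightarrow> (\<exists>p. path_from F1 f1 f1 p \<and> a = fibre_class p)"
proof
  have one: "D2.loop_data x f2 \<one>\<^bsub>\<G>\<^esub> (\<lambda>t. x) (\<lambda>t. f2)"
    using D2.loop_data_one path_from_const x f2 by metis
  assume "compare a = \<one>\<^bsub>\<Pi>2\<^esub>"
  then have "corresp a (D2.loop_of x f2 (\<lambda>t. x) (\<lambda>t. f2))"
    using corresp_compare[OF assms] by (simp add: D2.loop_of_one)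
  then obtain g k p q where 1: "D1.loop_data x f1 g k p" "D2.loop_data x f2 g k q"
     "a = D1.loop_of x f1 k p" "D2.loop_of x f2 (\<lambda>t. x) (\<lambda>t. f2) = D2.loop_of x f2 k q"
    unfolding corresp_def by blast
  note * = D2.loop_of_eqD[OF one 1(2,4)]
  have "path_from F1 f1 f1 p"
    using 1(1) *(1) D1.\<sigma>_one[OF f1] by (auto simp: D1.loop_data_def)
  moreover have "a = fibre_class p"
    unfolding fibre_class_def 1(3)
    using D1.loop_of_eqI(1)[OF 1(1), of "\<lambda>t. x" p] path_hom_sym[OF *(2)] *(1) 1(1)
    by (auto simp: D1.loop_data_def intro: path_hom_refl)
  ultimately show "\<exists>p. path_from F1 f1 f1 p \<and> a = fibre_class p" by blast
next
  have one: "D2.loop_data x f2 \<one>\<^bsub>\<G>\<^esub> (\<lambda>t. x) (\<lambda>t. f2)"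
    using D2.loop_data_one path_from_const x f2 by metis
  assume "\<exists>p. path_from F1 f1 f1 p \<and> a = fibre_class p"
  then have "corresp a (D2.loop_of x f2 (\<lambda>t. x) (\<lambda>t. f2))"
    unfolding corresp_def fibre_class_def using one fibre_data by blast
  then show "compare a = \<one>\<^bsub>\<Pi>2\<^esub>"
    by (simp add: compare_eq D2.loop_of_one)
qed

lemma fibre_class_carrier: "path_from F1 f1 f1 p \<Longrightarrow> fibre_class p \<in> carrier \<Pi>1"
  unfolding fibre_class_def by (rule D1.loop_of_in_carrier[OF fibre_data])

text \<open>Injectivity of \<pi>_1(F1) in \<pi>_1(Q1): a homotopy in the quotient lifts to the
  product, and its \<open>F1\<close> component joins \<open>p\<close> to \<open>q\<close>.\<close>

lemma fibre_class_eq_iff: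
  assumes "path_from F1 f1 f1 p" "path_from F1 f1 f1 q"
  shows "fibre_class p = fibre_class q \<longleftrightarrow> path_hom F1 f1 f1 p q"
proof
  assume "fibre_class p = fibre_class q"
  then show "path_hom F1 f1 f1 p q"
    using D1.loop_of_eqD(3)[OF fibre_data[OF assms(1)] fibre_data[OF assms(2)]] D1.\<sigma>_one[OF f1]
    by (simp add: fibre_class_def)
next
  assume "path_hom F1 f1 f1 p q"
  then show "fibre_class p = fibre_class q"
    using D1.loop_of_eqI(1)[OF fibre_data[OF assms(1)]] D1.\<sigma>_one[OF f1] D1.\<rho>_one[OF x]
      path_hom_refl[OF path_from_const[OF x]] by (simp add: fibre_class_def)
qed

lemma fibre_class_mult:
  assumes "path_from F1 f1 f1 p" "path_from F1 f1 f1 q"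
  shows "fibre_class p \<otimes>\<^bsub>\<Pi>1\<^esub> fibre_class q = fibre_class (join_loops p q)"
proof -
  let ?p = "\<lambda>p t. \<pi>1 (x, p t)"
  have *: "path_from Q1 (\<pi>1 (x, f1)) (\<pi>1 (x, f1)) (?p p)" if "path_from F1 f1 f1 p" for p
    using D1.path_from_loop[OF fibre_data[OF that]] .
  have "join_loops (?p p) (?p q) = ?p (join_loops p q)"
    by (auto simp: join_loops_def)
  then show ?thesis
    using mult_fundamental_group[OF *[OF assms(1)] *[OF assms(2)]]
    by (simp add: fibre_class_def D1.loop_of_def)
qed

end

text \<open>Two consecutive levels: the fibres and the group stay, only \<open>X\<close> changes.
  Equivariance of \<open>\<beta>\<close> is asked along the orbit of the base point, where the paths
  of loop data end.\<close>

locale diagonal_pair_map =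
  U: diagonal_pair X F1 F2 \<G> \<rho> \<sigma>1 \<sigma>2 Q1 Q2 \<pi>1 \<pi>2 x f1 f2 +
  L: diagonal_pair X' F1 F2 \<G> \<rho>' \<sigma>1 \<sigma>2 Q1' Q2' \<pi>1' \<pi>2' x' f1 f2
  for X :: "'x topology" and F1 :: "'a topology" and F2 :: "'b topology" and \<G> :: "'g monoid"
    and \<rho> :: "'g \<Rightarrow> 'x \<Rightarrow> 'x" and \<sigma>1 :: "'g \<Rightarrow> 'a \<Rightarrow> 'a" and \<sigma>2 :: "'g \<Rightarrow> 'b \<Rightarrow> 'b"
    and Q1 :: "'p topology" and Q2 :: "'q topology" and \<pi>1 :: "'x \<times> 'a \<Rightarrow> 'p" and \<pi>2 :: "'x \<times> 'b \<Rightarrow> 'q"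
    and x f1 f2 and X' :: "'x topology" and \<rho>' :: "'g \<Rightarrow> 'x \<Rightarrow> 'x"
    and Q1' :: "'p topology" and Q2' :: "'q topology" and \<pi>1' :: "'x \<times> 'a \<Rightarrow> 'p" and \<pi>2' :: "'x \<times> 'b \<Rightarrow> 'q"
    and x' +
  fixes \<beta> :: "'x \<Rightarrow> 'x" and \<beta>1 :: "'p \<Rightarrow> 'p" and \<beta>2 :: "'q \<Rightarrow> 'q"
  assumes \<beta>_cont: "continuous_map X X' \<beta>" and \<beta>_base: "\<beta> x = x'"
    and \<beta>_equiv: "g \<in> carrier \<G> \<Longrightarrow> \<beta> (\<rho> g x) = \<rho>' g x'"
    and \<beta>1_cont: "continuous_map Q1 Q1' \<beta>1" and \<beta>2_cont: "continuous_map Q2 Q2' \<beta>2"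
    and \<beta>1_eq: "c \<in> topspace X \<Longrightarrow> d \<in> topspace F1 \<Longrightarrow> \<beta>1 (\<pi>1 (c, d)) = \<pi>1' (\<beta> c, d)"
    and \<beta>2_eq: "c \<in> topspace X \<Longrightarrow> d' \<in> topspace F2 \<Longrightarrow> \<beta>2 (\<pi>2 (c, d')) = \<pi>2' (\<beta> c, d')"
begin

lemma base: "\<beta>1 (\<pi>1 (x, f1)) = \<pi>1' (x', f1)" "\<beta>2 (\<pi>2 (x, f2)) = \<pi>2' (x', f2)"
  using \<beta>1_eq[OF U.x U.f1] \<beta>2_eq[OF U.x U.f2] \<beta>_base by simp_all

lemma data1: "U.D1.loop_data x f1 g k p \<Longrightarrow> L.D1.loop_data x' f1 g (\<beta> \<circ> k) p"
  unfolding U.D1.loop_data_def L.D1.loop_data_def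
  using path_from_compose[OF _ \<beta>_cont \<beta>_base \<beta>_equiv] by blast

lemma data2: "U.D2.loop_data x f2 g k p \<Longrightarrow> L.D2.loop_data x' f2 g (\<beta> \<circ> k) p"
  unfolding U.D2.loop_data_def L.D2.loop_data_def
  using path_from_compose[OF _ \<beta>_cont \<beta>_base \<beta>_equiv] by blast

lemma induced1:
  assumes d: "U.D1.loop_data x f1 g k p"
  shows "induced_map Q1' (\<pi>1' (x', f1)) \<beta>1 (U.D1.loop_of x f1 k p) = L.D1.loop_of x' f1 (\<beta> \<circ> k) p"
proof -
  have "\<beta>1 (\<pi>1 (k t, p t)) = \<pi>1' (\<beta> (k t), p t)" if "t \<in> {0..1}" for t
    using d that path_from_imp_topspace(3) unfolding U.D1.loop_data_def by (metis \<beta>1_eq)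
  then have eq: "path_hom Q1' (\<pi>1' (x', f1)) (\<pi>1' (x', f1)) (\<lambda>t. \<pi>1' ((\<beta> \<circ> k) t, p t)) (\<beta>1 \<circ> (\<lambda>t. \<pi>1 (k t, p t)))"
    by (intro path_hom_eq[OF L.D1.path_from_loop[OF data1[OF d]]]) simp
  show ?thesis
    unfolding U.D1.loop_of_def L.D1.loop_of_def
      induced_map_loop_class[OF \<beta>1_cont base(1) U.D1.path_from_loop[OF d]]
    by (rule loop_class_eqI[OF eq, symmetric])
qed

lemma induced2:
  assumes d: "U.D2.loop_data x f2 g k p"
  shows "induced_map Q2' (\<pi>2' (x', f2)) \<beta>2 (U.D2.loop_of x f2 k p) = L.D2.loop_of x' f2 (\<beta> \<circ> k) p"
proof -
  have "\<beta>2 (\<pi>2 (k t, p t)) = \<pi>2' (\<beta> (k t), p t)" if "t \<in> {0..1}" for t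
    using d that path_from_imp_topspace(3) unfolding U.D2.loop_data_def by (metis \<beta>2_eq)
  then have eq: "path_hom Q2' (\<pi>2' (x', f2)) (\<pi>2' (x', f2)) (\<lambda>t. \<pi>2' ((\<beta> \<circ> k) t, p t)) (\<beta>2 \<circ> (\<lambda>t. \<pi>2 (k t, p t)))"
    by (intro path_hom_eq[OF L.D2.path_from_loop[OF data2[OF d]]]) simp
  show ?thesis
    unfolding U.D2.loop_of_def L.D2.loop_of_def
      induced_map_loop_class[OF \<beta>2_cont base(2) U.D2.path_from_loop[OF d]]
    by (rule loop_class_eqI[OF eq, symmetric])
qed

lemma compare_natural:
  assumes "a \<in> carrier U.\<Pi>1"
  shows "induced_map Q2' (\<pi>2' (x', f2)) \<beta>2 (U.compare a) = L.compare (induced_map Q1' (\<pi>1' (x', f1)) \<beta>1 a)"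
proof -
  obtain g k p q where 1: "U.D1.loop_data x f1 g k p" "U.D2.loop_data x f2 g k q"
     "a = U.D1.loop_of x f1 k p" "U.compare a = U.D2.loop_of x f2 k q"
    using U.corresp_compare[OF assms] unfolding U.corresp_def by blast
  have "L.corresp (L.D1.loop_of x' f1 (\<beta> \<circ> k) p) (L.D2.loop_of x' f2 (\<beta> \<circ> k) q)"
    unfolding L.corresp_def using data1[OF 1(1)] data2[OF 1(2)] by blast
  from L.compare_eq[OF this] show ?thesis
    using induced1[OF 1(1)] induced2[OF 1(2)] 1(3,4) by simp
qed

text \<open>The bonding map does not touch the fibre component; this makes the tower of kernels
  constant.\<close>

lemma fibre_class_natural:
  assumes "path_from F1 f1 f1 p"
  shows "induced_map Q1' (\<pi>1' (x', f1)) \<beta>1 (U.fibre_class p) = L.fibre_class p"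
  using induced1[OF U.fibre_data[OF assms]] \<beta>_base
  by (simp add: U.fibre_class_def L.fibre_class_def o_def)

end

section \<open>Inverse limits of groups\<close>

lemma group_inverse_limit:
  assumes H: "\<And>n. group (H n)" and \<beta>: "\<And>n. \<beta> n \<in> hom (H (Suc n)) (H n)"
  shows "group (inverse_limit_group H \<beta>)"
proof (rule groupI)
  note simps = inverse_limit_group_def
  note gm = group.is_monoid[OF H]
  show "x \<otimes>\<^bsub>inverse_limit_group H \<beta>\<^esub> y \<in> carrier (inverse_limit_group H \<beta>)"
    if "x \<in> carrier (inverse_limit_group H \<beta>)" "y \<in> carrier (inverse_limit_group H \<beta>)" for x y
    using that hom_mult[OF \<beta>] by (auto simp: simps monoid.m_closed[OF gm])
  show "\<one>\<^bsub>inverse_limit_group H \<beta>\<^esub> \<in> carrier (inverse_limit_group H \<beta>)"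
    using hom_one[OF \<beta> H H] by (auto simp: simps monoid.one_closed[OF gm])
  show "x \<otimes>\<^bsub>inverse_limit_group H \<beta>\<^esub> y \<otimes>\<^bsub>inverse_limit_group H \<beta>\<^esub> z =
      x \<otimes>\<^bsub>inverse_limit_group H \<beta>\<^esub> (y \<otimes>\<^bsub>inverse_limit_group H \<beta>\<^esub> z)"
    if "x \<in> carrier (inverse_limit_group H \<beta>)" "y \<in> carrier (inverse_limit_group H \<beta>)"
      "z \<in> carrier (inverse_limit_group H \<beta>)" for x y z
    using that by (auto simp: simps monoid.m_assoc[OF gm])
  show "\<one>\<^bsub>inverse_limit_group H \<beta>\<^esub> \<otimes>\<^bsub>inverse_limit_group H \<beta>\<^esub> x = x"
    if "x \<in> carrier (inverse_limit_group H \<beta>)" for x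
    using that by (auto simp: simps monoid.l_one[OF gm])
  fix x assume x: "x \<in> carrier (inverse_limit_group H \<beta>)"
  let ?y = "\<lambda>n. inv\<^bsub>H n\<^esub> x n"
  have "\<beta> n (inv\<^bsub>H (Suc n)\<^esub> x (Suc n)) = inv\<^bsub>H n\<^esub> x n" for n
    using group_hom.hom_inv[OF group_hom.intro[OF H H group_hom_axioms.intro[OF \<beta>]]] x
    by (auto simp: simps)
  then have y: "?y \<in> carrier (inverse_limit_group H \<beta>)"
    using x by (auto simp: simps group.inv_closed[OF H])
  have "?y \<otimes>\<^bsub>inverse_limit_group H \<beta>\<^esub> x = \<one>\<^bsub>inverse_limit_group H \<beta>\<^esub>"
    using x by (auto simp: simps group.l_inv[OF H])
  then show "\<exists>y\<in>carrier (inverse_limit_group H \<beta>).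
      y \<otimes>\<^bsub>inverse_limit_group H \<beta>\<^esub> x = \<one>\<^bsub>inverse_limit_group H \<beta>\<^esub>"
    using y by (rule bexI)
qed

text \<open>The component that the shift drops is recovered from its neighbour by the bonding
  map.\<close>

lemma inverse_limit_shift1:
  assumes \<beta>: "\<And>n. \<beta> n \<in> hom (H (Suc n)) (H n)"
  shows "inverse_limit_group H \<beta> \<cong> inverse_limit_group (\<lambda>n. H (Suc n)) (\<lambda>n. \<beta> (Suc n))"
proof -
  let ?L = "inverse_limit_group H \<beta>"
  let ?L' = "inverse_limit_group (\<lambda>n. H (Suc n)) (\<lambda>n. \<beta> (Suc n))"
  let ?f = "\<lambda>(x :: nat \<Rightarrow> 'a) n. x (Suc n)"
  have "?f \<in> hom ?L ?L'"
    by (auto simp: hom_def inverse_limit_group_def)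
  moreover have "inj_on ?f (carrier ?L)"
  proof (rule inj_onI)
    fix x y assume x: "x \<in> carrier ?L" and y: "y \<in> carrier ?L" and eq: "?f x = ?f y"
    show "x = y"
    proof
      fix n
      have "x (Suc n) = y (Suc n)" using fun_cong[OF eq] .
      moreover have "\<beta> n (x (Suc n)) = x n" "\<beta> n (y (Suc n)) = y n"
        using x y by (auto simp: inverse_limit_group_def)
      ultimately show "x n = y n" by simp
    qed
  qed
  moreover have "y \<in> ?f ` carrier ?L" if y: "y \<in> carrier ?L'" for y
  proof
    let ?x = "\<lambda>n. case n of 0 \<Rightarrow> \<beta> 0 (y 0) | Suc m \<Rightarrow> y m"
    show "y = ?f ?x" by simp
    have "?x n \<in> carrier (H n)" "\<beta> n (?x (Suc n)) = ?x n" for n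
      using y hom_in_carrier[OF \<beta>[of 0]] by (auto simp: inverse_limit_group_def split: nat.split)
    then show "?x \<in> carrier ?L" by (simp add: inverse_limit_group_def)
  qed
  ultimately have "?f \<in> iso ?L ?L'"
    unfolding iso_def bij_betw_def by (auto dest: hom_in_carrier)
  then show ?thesis by (rule is_isoI)
qed

text \<open>Needed because the description by free quotients is available only from some level
  on.\<close>

lemma inverse_limit_shift:
  assumes H: "\<And>n. group (H n)" and \<beta>: "\<And>n. \<beta> n \<in> hom (H (Suc n)) (H n)"
  shows "inverse_limit_group H \<beta> \<cong> inverse_limit_group (\<lambda>n. H (n + N)) (\<lambda>n. \<beta> (n + N))"
proof (induction N)
  case 0
  show ?case by (simp add: iso_refl)
next
  case (Suc N)
  from Suc have "inverse_limit_group H \<beta> \<cong> inverse_limit_group (\<lambda>n. H (Suc n + N)) (\<lambda>n. \<beta> (Suc n + N))"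
    by (rule iso_trans) (rule inverse_limit_shift1, simp add: \<beta>)
  then show ?case by simp
qed

lemma short_exact_iso:
  assumes ex: "short_exact K i A' p B'" and "A \<cong> A'" "B \<cong> B'" and A: "group A" and B: "group B"
  shows "\<exists>i p. short_exact K i A p B"
proof -
  obtain f h where f: "f \<in> iso A A'" and h: "h \<in> iso B B'"
    using assms(2,3) unfolding is_iso_def by blast
  define f' where "f' = inv_into (carrier A) f"
  define h' where "h' = inv_into (carrier B) h"
  have f': "f' \<in> iso A' A" and h': "h' \<in> iso B' B"
    using group.iso_set_sym[OF A f] group.iso_set_sym[OF B h] by (simp_all add: f'_def h'_def)
  have K: "group K" and A': "group A'" and B': "group B'" and i: "i \<in> hom K A'" and p: "p \<in> hom A' B'"
    and inj: "inj_on i (carrier K)" and ker: "i ` carrier K = kernel A' B' p"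
    and surj: "p ` carrier A' = carrier B'"
    using ex by (auto simp: short_exact_def group_hom_def group_hom_axioms_def)
  have ff: "f' (f a) = a" if "a \<in> carrier A" for a
    using f that by (auto simp: f'_def iso_def bij_betw_def)
  have ff2: "f (f' a) = a" if "a \<in> carrier A'" for a
    using f that by (auto simp: f'_def iso_def bij_betw_def f_inv_into_f)
  have h'1: "h' b = \<one>\<^bsub>B\<^esub> \<longleftrightarrow> b = \<one>\<^bsub>B'\<^esub>" if "b \<in> carrier B'" for b
  proof -
    have "h' \<one>\<^bsub>B'\<^esub> = \<one>\<^bsub>B\<^esub>" using hom_one[OF iso_imp_homomorphism[OF h'] B' B] .
    moreover have "inj_on h' (carrier B')" using h' by (simp add: iso_def bij_betw_def)
    ultimately show ?thesis using that group.is_monoid[OF B'] monoid.one_closed by (metis inj_onD)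
  qed
  have fc: "f a \<in> carrier A'" if "a \<in> carrier A" for a
    using hom_in_carrier[OF iso_imp_homomorphism[OF f] that] .
  have pc: "p a \<in> carrier B'" if "a \<in> carrier A'" for a
    using hom_in_carrier[OF p that] .
  have "short_exact K (f' \<circ> i) A (h' \<circ> p \<circ> f) B"
    unfolding short_exact_def
  proof (intro conjI)
    show "group_hom K A (f' \<circ> i)"
      using K A hom_compose[OF i iso_imp_homomorphism[OF f']] by (simp add: group_hom_def group_hom_axioms_def)
    show "group_hom A B (h' \<circ> p \<circ> f)"
      using A B hom_compose[OF hom_compose[OF iso_imp_homomorphism[OF f] p] iso_imp_homomorphism[OF h']]
      by (simp add: group_hom_def group_hom_axioms_def o_assoc)
    have "inj_on f' (i ` carrier K)"
      using f' hom_in_carrier[OF i] unfolding iso_def bij_betw_def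
      by (auto intro: inj_on_subset)
    then show "inj_on (f' \<circ> i) (carrier K)"
      using inj by (rule comp_inj_on[rotated])
    have "f' ` kernel A' B' p = kernel A B (h' \<circ> p \<circ> f)"
    proof (intro equalityI subsetI)
      fix a assume "a \<in> f' ` kernel A' B' p"
      then obtain c where c: "c \<in> carrier A'" "p c = \<one>\<^bsub>B'\<^esub>" "a = f' c" by (auto simp: kernel_def)
      then show "a \<in> kernel A B (h' \<circ> p \<circ> f)"
        using hom_in_carrier[OF iso_imp_homomorphism[OF f'] c(1)] ff2 h'1[of "\<one>\<^bsub>B'\<^esub>"]
          pc[OF c(1)] by (simp add: kernel_def)
    next
      fix a assume "a \<in> kernel A B (h' \<circ> p \<circ> f)"
      then have a: "a \<in> carrier A" "p (f a) = \<one>\<^bsub>B'\<^esub>" using h'1 pc fc by (auto simp: kernel_def)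
      then have "f a \<in> kernel A' B' p" using fc by (simp add: kernel_def)
      then show "a \<in> f' ` kernel A' B' p" using ff[OF a(1)] by (metis image_eqI)
    qed
    then show "(f' \<circ> i) ` carrier K = kernel A B (h' \<circ> p \<circ> f)"
      by (simp only: image_comp[symmetric] ker)
    have "f ` carrier A = carrier A'" "h' ` carrier B' = carrier B"
      using f h' by (simp_all add: iso_def bij_betw_def)
    then show "(h' \<circ> p \<circ> f) ` carrier A = carrier B"
      by (simp only: image_comp[symmetric] surj)
  qed
  then show ?thesis by blast
qed

text \<open>Since the kernels form a constant tower, preimages can be chosen compatibly one level at a
  time, so that the limit of the projections is onto.\<close>

lemma short_exact_inverse_limit:
  fixes A :: "nat \<Rightarrow> 'a monoid" and B :: "nat \<Rightarrow> 'b monoid" and K :: "'k monoid"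
  assumes K: "group K" and A: "\<And>n. group (A n)" and B: "\<And>n. group (B n)"
    and a: "\<And>n. a n \<in> hom (A (Suc n)) (A n)" and b: "\<And>n. b n \<in> hom (B (Suc n)) (B n)"
    and i: "\<And>n. i n \<in> hom K (A n)" and inj: "\<And>n. inj_on (i n) (carrier K)"
    and ai: "\<And>n x. x \<in> carrier K \<Longrightarrow> a n (i (Suc n) x) = i n x"
    and p: "\<And>n. p n \<in> hom (A n) (B n)" and surj: "\<And>n. p n ` carrier (A n) = carrier (B n)"
    and ker: "\<And>n. i n ` carrier K = kernel (A n) (B n) (p n)"
    and bp: "\<And>n x. x \<in> carrier (A (Suc n)) \<Longrightarrow> b n (p (Suc n) x) = p n (a n x)"
  shows "\<exists>i p. short_exact K i (inverse_limit_group A a) p (inverse_limit_group B b)"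
proof -
  let ?A = "inverse_limit_group A a" and ?B = "inverse_limit_group B b"
  let ?i = "\<lambda>x n. i n x" and ?p = "\<lambda>x n. p n (x n)"
  have gA: "group ?A" and gB: "group ?B"
    using group_inverse_limit A B a b by blast+
  have kerD: "p n (i n x) = \<one>\<^bsub>B n\<^esub>" if "x \<in> carrier K" for n x
    using ker[of n] that by (auto simp: kernel_def)
  have "short_exact K ?i ?A ?p ?B"
    unfolding short_exact_def
  proof (intro conjI)
    show "group_hom K ?A ?i"
      using K gA hom_in_carrier[OF i] hom_mult[OF i] ai
      by (auto simp: group_hom_def group_hom_axioms_def inverse_limit_group_def intro!: homI)
    have "?p \<in> hom ?A ?B"
    proof (rule homI)
      show "?p x \<in> carrier ?B" if "x \<in> carrier ?A" for x
        using that hom_in_carrier[OF p] bp by (auto simp: inverse_limit_group_def)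
      show "?p (x \<otimes>\<^bsub>?A\<^esub> y) = ?p x \<otimes>\<^bsub>?B\<^esub> ?p y" if "x \<in> carrier ?A" "y \<in> carrier ?A" for x y
        using that hom_mult[OF p] by (auto simp: inverse_limit_group_def)
    qed
    then show "group_hom ?A ?B ?p"
      using gA gB by (simp add: group_hom_def group_hom_axioms_def)
    show "inj_on ?i (carrier K)"
      using inj[of 0] by (auto simp: inj_on_def dest: fun_cong[where x = 0])
    show "?i ` carrier K = kernel ?A ?B ?p"
    proof (intro equalityI subsetI)
      fix y assume "y \<in> ?i ` carrier K"
      then show "y \<in> kernel ?A ?B ?p"
        using hom_in_carrier[OF i] ai kerD by (auto simp: kernel_def inverse_limit_group_def)
    next
      fix y assume y: "y \<in> kernel ?A ?B ?p"
      have "y n \<in> i n ` carrier K" for n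
        unfolding ker using y by (auto simp: kernel_def inverse_limit_group_def fun_eq_iff)
      then have "\<exists>m. m \<in> carrier K \<and> y n = i n m" for n by blast
      then obtain m where "\<And>n. m n \<in> carrier K \<and> y n = i n (m n)" by metis
      then have m: "m n \<in> carrier K" "y n = i n (m n)" for n by simp_all
      have ay: "a n (y (Suc n)) = y n" for n
        using y by (auto simp: kernel_def inverse_limit_group_def)
      \<comment> \<open>Both sides equal \<open>y n\<close>, the left one as the image of
        \<open>y (Suc n)\<close> under the bonding map. Hence the same element of \<open>K\<close>
        serves all levels.\<close>
      have "i n (m (Suc n)) = i n (m n)" for n
        using ay[of n] ai[OF m(1), of n "Suc n"] unfolding m(2) by simp
      then have "m (Suc n) = m n" for n using inj_onD[OF inj] m(1) by blast
      then have m0: "m n = m 0" for n by (induction n) auto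
      have "y n = i n (m 0)" for n using m(2)[of n] unfolding m0[of n] .
      then have "y = ?i (m 0)" by blast
      then show "y \<in> ?i ` carrier K" using m(1) by blast
    qed
    show "?p ` carrier ?A = carrier ?B"
    proof (intro equalityI subsetI)
      fix y assume "y \<in> ?p ` carrier ?A"
      then show "y \<in> carrier ?B"
        using hom_in_carrier[OF p] bp by (auto simp: inverse_limit_group_def)
    next
      fix y assume y: "y \<in> carrier ?B"
      then have yc: "y n \<in> carrier (B n)" and yb: "b n (y (Suc n)) = y n" for n
        by (auto simp: inverse_limit_group_def)
      have "\<exists>x. \<forall>n. (x n \<in> carrier (A n) \<and> p n (x n) = y n) \<and> a n (x (Suc n)) = x n"
      proof (rule dependent_nat_choice)
        show "\<exists>x. x \<in> carrier (A 0) \<and> p 0 x = y 0"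
          using surj[of 0] yc[of 0] by (metis imageE)
      next
        fix x n assume x: "x \<in> carrier (A n) \<and> p n x = y n"
        interpret An: group "A n" by (rule A)
        interpret AS: group "A (Suc n)" by (rule A)
        interpret Bn: group "B n" by (rule B)
        interpret BS: group "B (Suc n)" by (rule B)
        interpret gK: group K by (rule K)
        obtain w where w: "w \<in> carrier (A (Suc n))" "p (Suc n) w = y (Suc n)"
          using surj[of "Suc n"] yc[of "Suc n"] by (metis imageE)
        have aw: "a n w \<in> carrier (A n)" using hom_in_carrier[OF a w(1)] .
        have paw: "p n (a n w) = y n" using bp[OF w(1)] w(2) yb by simp
        have "p n (x \<otimes>\<^bsub>A n\<^esub> inv\<^bsub>A n\<^esub> a n w) = \<one>\<^bsub>B n\<^esub>"
          using x aw paw hom_mult[OF p] group_hom.hom_inv[OF group_hom.intro[OF A B group_hom_axioms.intro[OF p]] aw]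
            yc[of n] by simp
        then have "x \<otimes>\<^bsub>A n\<^esub> inv\<^bsub>A n\<^esub> a n w \<in> i n ` carrier K"
          unfolding ker using x aw by (simp add: kernel_def)
        then obtain m where m: "m \<in> carrier K" "x \<otimes>\<^bsub>A n\<^esub> inv\<^bsub>A n\<^esub> a n w = i n m" by blast
        \<comment> \<open>\<open>w\<close> is an arbitrary preimage of \<open>y (Suc n)\<close>. Its
          image one level below misses \<open>x\<close> by a kernel element, and the same element of
          \<open>K\<close> corrects it at the level above.\<close>
        let ?z = "i (Suc n) m \<otimes>\<^bsub>A (Suc n)\<^esub> w"
        have im: "i (Suc n) m \<in> carrier (A (Suc n))" using hom_in_carrier[OF i m(1)] .
        have "p (Suc n) ?z = y (Suc n)"
          using hom_mult[OF p im w(1)] kerD[OF m(1)] w yc[of "Suc n"] by simp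
        moreover have "a n ?z = x"
          using hom_mult[OF a im w(1)] ai[OF m(1)] m(2) x aw An.inv_solve_right'[of "i n m"]
          by (metis An.inv_closed An.l_inv An.m_assoc An.r_one)
        ultimately show "\<exists>z. (z \<in> carrier (A (Suc n)) \<and> p (Suc n) z = y (Suc n)) \<and> a n z = x"
          using im w(1) by blast
      qed
      then obtain x where "\<forall>n. (x n \<in> carrier (A n) \<and> p n (x n) = y n) \<and> a n (x (Suc n)) = x n" ..
      then have "x \<in> carrier ?A" "y = ?p x" by (auto simp: inverse_limit_group_def)
      then show "y \<in> ?p ` carrier ?A" by blast
    qed
  qed
  then show ?thesis by blast
qed

section \<open>Loops of rotations\<close>

lemma continuous_on_matrix_mult:
  fixes A :: "'a::topological_space \<Rightarrow> real^'n^'m" and B :: "'a \<Rightarrow> real^'k^'n"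
  assumes "continuous_on S A" "continuous_on S B"
  shows "continuous_on S (\<lambda>x. A x ** B x)"
  unfolding matrix_matrix_mult_def using assms by (intro continuous_intros) auto

lemma continuous_on_matrix_vector:
  fixes A :: "'a::topological_space \<Rightarrow> real^'n^'m" and v :: "'a \<Rightarrow> real^'n"
  assumes "continuous_on S A" "continuous_on S v"
  shows "continuous_on S (\<lambda>x. A x *v v x)"
  unfolding matrix_vector_mult_def using assms by (intro continuous_intros) auto

lemma continuous_on_det:
  fixes A :: "'a::topological_space \<Rightarrow> real^'n^'n"
  assumes "continuous_on S A"
  shows "continuous_on S (\<lambda>x. det (A x))"
  unfolding det_def using assms by (intro continuous_intros) auto

text \<open>On orthogonal matrices the determinant only takes the values 1 and -1, so it is constant
  along a connected family. This spares most computations of determinants.\<close>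

lemma rotation_matrix_connected:
  fixes A :: "'a::topological_space \<Rightarrow> real^'n^'n"
  assumes "continuous_on S A" "connected S" "\<And>x. x \<in> S \<Longrightarrow> orthogonal_matrix (A x)"
    and "x0 \<in> S" "rotation_matrix (A x0)" "x \<in> S"
  shows "rotation_matrix (A x)"
proof -
  have "connected ((\<lambda>x. det (A x)) ` S)"
    using assms(1,2) by (intro connected_continuous_image continuous_on_det)
  moreover have sub: "(\<lambda>x. det (A x)) ` S \<subseteq> {1, -1}"
    using assms(3) det_orthogonal_matrix by blast
  then have "finite ((\<lambda>x. det (A x)) ` S)" using finite_subset by blast
  ultimately obtain c where c: "(\<lambda>x. det (A x)) ` S = {c}"
    using assms(4) by (metis connected_finite_iff_sing image_is_empty empty_iff)
  have "(\<lambda>x. det (A x)) y \<in> {c}" if "y \<in> S" for y using c that by blast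
  then have "det (A x) = det (A x0)" using assms(4,6) by simp
  then show ?thesis using assms(3,5,6) by (simp add: rotation_matrix_def)
qed

text \<open>For \<open>w = 0\<close> the division by zero makes this the identity.\<close>

definition refl_mat :: "real^'n \<Rightarrow> real^'n^'n" where
  "refl_mat w = (\<chi> i j. (if i = j then 1 else 0) - 2 * w$i * w$j / (w \<bullet> w))"

lemma refl_mat_mult: "refl_mat w *v x = x - (2 * (w \<bullet> x) / (w \<bullet> w)) *\<^sub>R w"
proof (subst vec_eq_iff, intro allI)
  fix i
  have "(refl_mat w *v x) $ i = (\<Sum>j\<in>UNIV. (if i = j then x$j else 0) - 2 * w$i / (w \<bullet> w) * (w$j * x$j))"
    by (auto simp: refl_mat_def matrix_vector_mult_def algebra_simps intro!: sum.cong)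
  also have "\<dots> = x$i - 2 * w$i / (w \<bullet> w) * (w \<bullet> x)"
    by (simp add: sum_subtractf sum_distrib_left inner_vec_def[of w x])
  finally show "(refl_mat w *v x) $ i = (x - (2 * (w \<bullet> x) / (w \<bullet> w)) *\<^sub>R w) $ i"
    by (simp add: algebra_simps)
qed

lemma refl_mat_involution: "refl_mat w *v (refl_mat w *v x) = x"
proof -
  have "w \<bullet> (refl_mat w *v x) = - (w \<bullet> x)"
    by (cases "w = 0") (simp_all add: refl_mat_mult inner_diff_right)
  then show ?thesis
    by (subst refl_mat_mult) (simp add: refl_mat_mult)
qed

lemma refl_mat_scaleR: "c \<noteq> 0 \<Longrightarrow> refl_mat (c *\<^sub>R w) = refl_mat w"
  by (simp add: refl_mat_def vec_eq_iff)

lemma orthogonal_matrix_transformation: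
  "orthogonal_matrix A \<Longrightarrow> orthogonal_transformation ((*v) A)" for A :: "real^'n^'n"
  by (simp add: orthogonal_transformation_matrix)

lemma orthogonal_refl_mat: "orthogonal_matrix (refl_mat w)"
proof -
  have "transpose (refl_mat w) = refl_mat w"
    by (auto simp: refl_mat_def transpose_def vec_eq_iff algebra_simps)
  moreover have "refl_mat w ** refl_mat w = mat 1"
    by (simp add: matrix_eq matrix_vector_mul_assoc[symmetric] refl_mat_involution)
  ultimately show ?thesis by (simp add: orthogonal_matrix_def)
qed

lemma continuous_on_refl_mat:
  assumes "continuous_on S f" "\<And>x. x \<in> S \<Longrightarrow> f x \<noteq> 0"
  shows "continuous_on S (\<lambda>x. refl_mat (f x))"
  unfolding refl_mat_def using assms by (intro continuous_intros) auto

lemma refl_mat_axis: "w $ j = 0 \<Longrightarrow> refl_mat w *v axis j 1 = axis j 1"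
  by (simp add: refl_mat_mult inner_axis)

text \<open>A product of two reflections, hence a rotation in the plane of \<open>u\<close> and
  \<open>v\<close>; for unit vectors that are not antipodal it takes \<open>u\<close> to
  \<open>v\<close>. The formula is continuous in both vectors, so a moving vector can be
  followed.\<close>

definition turn :: "real^'n \<Rightarrow> real^'n \<Rightarrow> real^'n^'n" where
  "turn u v = refl_mat (u + v) ** refl_mat u"

lemma unit_add_nonzero:
  fixes u v :: "'a::real_inner"
  assumes "norm u = 1" "norm v = 1" "dist u v < 1"
  shows "u + v \<noteq> 0"
proof
  assume "u + v = 0"
  then have "v = - u" by (simp add: eq_neg_iff_add_eq_0 add.commute)
  then have "dist u v = norm (2 *\<^sub>R u)" by (simp add: dist_norm scaleR_2)
  with assms show False by simp
qed

lemma turn_mult: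
  assumes "norm u = 1" "norm v = 1" "u + v \<noteq> 0"
  shows "turn u v *v u = v"
proof -
  have uu: "u \<bullet> u = 1" "v \<bullet> v = 1" using assms by (simp_all add: norm_eq_1)
  have s: "(u + v) \<bullet> (u + v) = 2 * ((u + v) \<bullet> u)"
    by (simp add: inner_simps uu inner_commute)
  have "refl_mat u *v u = - u" by (simp add: refl_mat_mult uu scaleR_2)
  moreover have "refl_mat (u + v) *v (- u) = v"
  proof -
    have "(u + v) \<bullet> u \<noteq> 0" using s assms(3) by auto
    then show ?thesis using s by (simp add: refl_mat_mult)
  qed
  ultimately show ?thesis
    by (simp add: turn_def matrix_vector_mul_assoc[symmetric])
qed

lemma orthogonal_turn: "orthogonal_matrix (turn u v)"
  unfolding turn_def by (intro orthogonal_matrix_mul orthogonal_refl_mat)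

lemma turn_self: "turn u u = mat 1"
  by (simp add: turn_def matrix_eq matrix_vector_mul_assoc[symmetric] refl_mat_involution refl_mat_scaleR
      flip: scaleR_2)

lemma turn_axis: "u $ j = 0 \<Longrightarrow> v $ j = 0 \<Longrightarrow> turn u v *v axis j 1 = axis j 1"
  by (simp add: turn_def matrix_vector_mul_assoc[symmetric] refl_mat_axis)

lemma continuous_on_turn:
  assumes "continuous_on S u" "continuous_on S v" "\<And>x. x \<in> S \<Longrightarrow> u x \<noteq> 0" "\<And>x. x \<in> S \<Longrightarrow> u x + v x \<noteq> 0"
  shows "continuous_on S (\<lambda>x. turn (u x) (v x))"
  unfolding turn_def using assms
  by (intro continuous_on_matrix_mult continuous_on_refl_mat continuous_intros) auto

section \<open>Rotations of a coordinate subspace and their compression\<close>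

text \<open>A copy of SO(k), with k the cardinality of \<open>W\<close>, inside the full rotation
  group, so that induction on the dimension takes place within one matrix type. The stabiliser of
  the axis \<open>i\<close> in it is the copy for \<open>W - {i}\<close>.\<close>

definition SO_sub :: "'n set \<Rightarrow> (real^'n^'n) set" where
  "SO_sub W = {A. rotation_matrix A \<and> (\<forall>j. j \<notin> W \<longrightarrow> A *v axis j 1 = axis j 1)}"

lemma SO_sub_mono: "V \<subseteq> W \<Longrightarrow> SO_sub V \<subseteq> SO_sub W"
  by (auto simp: SO_sub_def)

lemma SO_sub_UNIV: "SO_sub UNIV = {A. rotation_matrix A}"
  by (simp add: SO_sub_def)

lemma mat_1_in_SO_sub: "mat 1 \<in> SO_sub W"
  by (simp add: SO_sub_def rotation_matrix_def orthogonal_matrix_id)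

text \<open>As \<open>A\<close> preserves inner products and fixes the axis \<open>j\<close>, it
  preserves the \<open>j\<close>-th component.\<close>

lemma SO_sub_component:
  assumes "A \<in> SO_sub W" "j \<notin> W" "x $ j = 0"
  shows "(A *v x) $ j = 0"
proof -
  have o: "orthogonal_transformation ((*v) A)"
    using assms(1) by (simp add: SO_sub_def rotation_matrix_def orthogonal_matrix_transformation)
  have "(A *v x) $ j = (A *v x) \<bullet> (A *v axis j 1)"
    using assms(1,2) by (simp add: SO_sub_def inner_axis)
  also have "\<dots> = x \<bullet> axis j 1"
    using o by (simp add: orthogonal_transformation_def)
  finally show ?thesis using assms(3) by (simp add: inner_axis)
qed

lemma norm_SO_sub: "A \<in> SO_sub W \<Longrightarrow> norm (A *v x) = norm x"
  by (simp add: SO_sub_def rotation_matrix_def orthogonal_matrix_transformation orthogonal_transformation_norm)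

text \<open>Homotopy lifting for the map sending a rotation to the image of a basis vector: subdivide the
  homotopy into short pieces and follow each piece by the rotations \<^const>\<open>turn\<close>.\<close>

lemma sphere_homotopy_lift:
  fixes k :: "real \<times> 'z::metric_space \<Rightarrow> real^'n" and f :: "'z \<Rightarrow> real^'n^'n"
  assumes Z: "compact Z" and k: "continuous_on ({0..1} \<times> Z) k"
    and k1: "\<And>p. p \<in> {0..1} \<times> Z \<Longrightarrow> norm (k p) = 1"
    and kW: "\<And>p j. p \<in> {0..1} \<times> Z \<Longrightarrow> j \<notin> W \<Longrightarrow> k p $ j = 0"
    and f: "continuous_on Z f" and fW: "\<And>z. z \<in> Z \<Longrightarrow> f z \<in> SO_sub W"
    and k0: "\<And>z. z \<in> Z \<Longrightarrow> k (0, z) = f z *v axis i 1"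
  shows "\<exists>h. continuous_on ({0..1} \<times> Z) h \<and>
    (\<forall>p\<in>{0..1} \<times> Z. h p \<in> SO_sub W \<and> h p *v axis i 1 = k p) \<and>
    (\<forall>z\<in>Z. h (0, z) = f z \<and>
       ((\<forall>s\<in>{0..1}. k (s, z) = k (0, z)) \<longrightarrow> (\<forall>s\<in>{0..1}. h (s, z) = f z)))"
proof -
  let ?D = "{0..1::real} \<times> Z"
  have "uniformly_continuous_on ?D k"
    using Z k by (intro compact_uniformly_continuous) (auto simp: compact_Times)
  \<comment> \<open>Unit vectors at distance below 1 are not antipodal, so \<open>turn\<close> moves
    one to the other along each short piece.\<close>
  then obtain d where d: "d > 0" "\<And>p q. p \<in> ?D \<Longrightarrow> q \<in> ?D \<Longrightarrow> dist q p < d \<Longrightarrow> dist (k q) (k p) < 1"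
    unfolding uniformly_continuous_on_def by (metis zero_less_one)
  obtain N :: nat where N: "N > 0" "1 / real N < d"
    using d(1) by (metis inverse_eq_divide ex_inverse_of_nat_less)
  define \<delta> where "\<delta> = 1 / real N"
  have \<delta>: "0 \<le> \<delta>" "\<delta> < d" "real N * \<delta> = 1" using N by (simp_all add: \<delta>_def)
  \<comment> \<open>Time stopped at \<open>j * \<delta>\<close>. The factor \<open>T j\<close> below
    is the identity before the \<open>j\<close>-th piece and frozen after it, so the product of the
    first \<open>j\<close> factors, applied to \<open>f\<close>, carries the axis along
    \<open>k\<close> up to the stopped time.\<close>
  define m where "m j s = min s (real j * \<delta>)" for j :: nat and s :: real
  have m: "m j s \<in> {0..1}" if "s \<in> {0..1}" for j s
    using that \<delta>(1) by (auto simp: m_def)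
  have mN: "m N s = s" if "s \<in> {0..1}" for s using that \<delta>(3) by (simp add: m_def)
  have m0: "m 0 s = 0" if "s \<in> {0..1}" for s using that by (simp add: m_def)
  have m0': "m j 0 = 0" for j using \<delta>(1) by (simp add: m_def)
  have mdist: "dist (m j s) (m (Suc j) s) < d" for j s
    using \<delta>(1,2) by (auto simp: m_def dist_real_def min_def distrib_right abs_if)
  have mc: "continuous_on S (\<lambda>x. m j (g x))" if "continuous_on S g" for S j and g :: "real \<times> 'z \<Rightarrow> real"
    unfolding m_def using that by (intro continuous_intros)
  define T where "T j p = turn (k (m j (fst p), snd p)) (k (m (Suc j) (fst p), snd p))" for j p
  define H where "H = rec_nat (\<lambda>p. f (snd p)) (\<lambda>j h p. T j p ** h p)"
  have H0: "H 0 p = f (snd p)" and HS: "H (Suc j) p = T j p ** H j p" for j p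
    by (simp_all add: H_def)
  have kd: "(m j (fst p), snd p) \<in> ?D" if "p \<in> ?D" for j p using that m by auto
  have nz: "k (m j (fst p), snd p) + k (m (Suc j) (fst p), snd p) \<noteq> 0" if "p \<in> ?D" for j p
    using mdist[of j "fst p"] kd[OF that]
    by (intro unit_add_nonzero k1 d(2)) (auto simp: dist_Pair_Pair)
  have nz1: "k p \<noteq> 0" if "p \<in> ?D" for p using k1[OF that] by auto
  have kc: "continuous_on ?D (\<lambda>p. k (m j (fst p), snd p))" for j
    by (rule continuous_on_compose2[OF k]) (use kd in \<open>auto intro!: continuous_intros mc\<close>)
  have cont: "continuous_on ?D (H j)" for j
  proof (induction j)
    case 0
    have "continuous_on ?D (\<lambda>p. f (snd p))"
      by (rule continuous_on_compose2[OF f]) (auto intro!: continuous_intros)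
    then show ?case by (simp add: H0[abs_def])
  next
    case (Suc j)
    have "continuous_on ?D (T j)"
      unfolding T_def[abs_def] using nz nz1 kd kc by (intro continuous_on_turn) auto
    from continuous_on_matrix_mult[OF this Suc] show ?case by (simp add: HS[abs_def])
  qed
  have orth: "orthogonal_matrix (H j p)" if "p \<in> ?D" for j p
    using that fW by (induction j)
      (auto simp: H0 HS T_def SO_sub_def rotation_matrix_def intro!: orthogonal_matrix_mul orthogonal_turn)
  have axis_fixed: "H j p *v axis l 1 = axis l 1" if "p \<in> ?D" "l \<notin> W" for j p l
    using that fW kW kd
    by (induction j) (auto simp: H0 HS T_def SO_sub_def matrix_vector_mul_assoc[symmetric] intro!: turn_axis)
  have zero: "H j (0, z) = f z" if "z \<in> Z" for j z
    by (induction j) (simp_all add: H0 HS T_def m0' turn_self)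
  have track: "H j p *v axis i 1 = k (m j (fst p), snd p)" if "p \<in> ?D" for j p
  proof (induction j)
    case 0
    then show ?case using that k0 by (auto simp: H0 m0)
  next
    case (Suc j)
    then show ?case
      using turn_mult[OF k1 k1 nz] kd that by (simp add: HS T_def matrix_vector_mul_assoc[symmetric])
  qed
  \<comment> \<open>Where \<open>k\<close> stands still every factor is \<open>turn u u\<close>, the
    identity; this is what keeps a homotopy fixed on prescribed points.\<close>
  have const: "H j (s, z) = f z" if "z \<in> Z" "s \<in> {0..1}" "\<forall>s\<in>{0..1}. k (s, z) = k (0, z)" for j s z
  proof (induction j)
    case (Suc j)
    have "k (m j s, z) = k (m (Suc j) s, z)"
      using that m by metis
    with Suc show ?case by (simp add: HS T_def turn_self)
  qed (simp add: H0)
  have "H N p \<in> SO_sub W" if "p \<in> ?D" for p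
  proof -
    let ?S = "{0..1::real} \<times> {snd p}"
    have sub: "?S \<subseteq> ?D" using that by auto
    have "rotation_matrix (H N p)"
    proof (rule rotation_matrix_connected[of ?S "H N" "(0, snd p)"])
      show "continuous_on ?S (H N)" using continuous_on_subset[OF cont sub] .
      show "connected ?S" by (intro connected_Times connected_Icc connected_sing)
      show "rotation_matrix (H N (0, snd p))"
        using zero fW that by (auto simp: SO_sub_def)
    qed (use orth sub that in auto)
    then show ?thesis using axis_fixed that by (simp add: SO_sub_def)
  qed
  moreover have "H N p *v axis i 1 = k p" if "p \<in> ?D" for p
  proof -
    have "fst p \<in> {0..1}" using that by auto
    then show ?thesis using track[OF that, of N] by (simp add: mN)
  qed
  ultimately show ?thesis
    using cont[of N] zero const by blast
qed

text \<open>Presents the unit sphere of the coordinates in \<open>W\<close> as the relative frontier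
  of a convex body of dimension \<open>card W\<close>, the kind of target to which maps from cell
  complexes of smaller dimension extend.\<close>

lemma aff_dim_unit_ball_coords:
  fixes W :: "'n::finite set"
  shows "aff_dim (cball 0 1 \<inter> {x::real^'n. \<forall>j. j \<notin> W \<longrightarrow> x$j = 0}) = int (card W)"
    and "rel_frontier (cball 0 1 \<inter> {x::real^'n. \<forall>j. j \<notin> W \<longrightarrow> x$j = 0})
      = sphere 0 1 \<inter> {x. \<forall>j. j \<notin> W \<longrightarrow> x$j = 0}"
    and "convex (cball 0 1 \<inter> {x::real^'n. \<forall>j. j \<notin> W \<longrightarrow> x$j = 0})"
proof -
  let ?S = "{x::real^'n. \<forall>j. j \<notin> W \<longrightarrow> x$j = 0}"
  have sub: "subspace ?S" by (auto simp: subspace_def)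
  let ?d = "(\<lambda>i. axis i (1::real)) ` W"
  have "?S = {x. \<forall>i\<in>Basis. i \<notin> ?d \<longrightarrow> x \<bullet> i = 0}"
    by (auto simp: Basis_vec_def inner_axis axis_eq_axis)
  then have "dim ?S = card ?d"
    using dim_substandard[of ?d] by (auto simp: Basis_vec_def)
  also have "\<dots> = card W" by (intro card_image) (auto simp: inj_on_def axis_eq_axis)
  finally have dim: "aff_dim ?S = int (card W)" by (simp add: aff_dim_subspace sub)
  have "0 \<in> interior (cball (0::real^'n) 1) \<inter> ?S" using subspace_0[OF sub] by simp
  then have ne: "interior (cball 0 1) \<inter> ?S \<noteq> {}" by blast
  have "aff_dim (?S \<inter> cball 0 1) = aff_dim ?S"
    using ne by (intro aff_dim_convex_Int_nonempty_interior subspace_imp_convex[OF sub]) (simp add: Int_commute)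
  then show "aff_dim (cball 0 1 \<inter> ?S) = int (card W)" by (simp add: dim Int_commute)
  show "rel_frontier (cball 0 1 \<inter> ?S) = sphere 0 1 \<inter> ?S"
    using convex_affine_rel_frontier_Int[OF convex_cball subspace_imp_affine[OF sub] ne] by simp
  show "convex (cball 0 1 \<inter> ?S)"
    by (intro convex_Int convex_cball subspace_imp_convex[OF sub])
qed

text \<open>Evaluation at the axis \<open>i\<close> maps the family into a sphere of dimension
  \<open>card W - 1\<close>. Over the prism on the cube this map extends, with the axis itself as
  value on the top and over \<open>B\<close>, because the dimension \<open>DIM('z) + 1\<close> of
  the prism does not exceed that of the sphere. Lifting the extension to rotations gives a homotopy
  into the stabiliser of the axis, at rest on \<open>B\<close>.\<close>

lemma SO_sub_compress:
  fixes f :: "'z::euclidean_space \<Rightarrow> real^'n^'n"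
  assumes f: "continuous_on (cbox a b) f" and fW: "\<And>z. z \<in> cbox a b \<Longrightarrow> f z \<in> SO_sub W"
    and B: "closed B" "B \<subseteq> cbox a b" and fB: "\<And>z. z \<in> B \<Longrightarrow> f z \<in> SO_sub (W - {i})"
    and i: "i \<in> W" and dim: "DIM('z) + 1 < card W"
  shows "\<exists>h. continuous_on ({0..1::real} \<times> cbox a b) h \<and> (\<forall>p\<in>{0..1} \<times> cbox a b. h p \<in> SO_sub W) \<and>
    (\<forall>z\<in>cbox a b. h (0, z) = f z \<and> h (1, z) \<in> SO_sub (W - {i})) \<and>
    (\<forall>z\<in>B. \<forall>s\<in>{0..1}. h (s, z) = f z)"
proof -
  let ?Z = "cbox a b" and ?e = "axis i 1 :: real^'n"
  let ?S = "{x::real^'n. \<forall>j. j \<notin> W \<longrightarrow> x$j = 0}"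
  let ?K = "cbox (0::real, a) (1, b)"
  have K: "?K = {0..1} \<times> ?Z" by (simp add: cbox_Pair_eq)
  \<comment> \<open>\<open>?B0\<close> is the bottom of the prism, carrying the given family;
    \<open>?B1\<close> consists of the top and the walls over \<open>B\<close>, where the axis is
    prescribed.\<close>
  let ?B0 = "{0::real} \<times> ?Z" and ?B1 = "{1::real} \<times> ?Z \<union> {0..1::real} \<times> B"
  let ?g = "\<lambda>p. if p \<in> ?B0 then f (snd p) *v ?e else ?e"
  have fixB: "f z *v ?e = ?e" if "z \<in> B" for z
    using fB[OF that] by (simp add: SO_sub_def)
  have cont: "continuous_on (?B0 \<union> ?B1) ?g"
  proof (rule continuous_on_cases)
    show "closed ?B0" "closed ?B1" using B(1) by (auto intro!: closed_Times closed_Un)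
    have "continuous_on ?B0 (\<lambda>p. f (snd p))"
      by (rule continuous_on_compose2[OF f]) (auto intro!: continuous_intros)
    then show "continuous_on ?B0 (\<lambda>p. f (snd p) *v ?e)"
      by (intro continuous_on_matrix_vector continuous_intros)
  qed (use fixB in \<open>auto intro!: continuous_intros\<close>)
  have e0: "?e $ j = 0" if "j \<notin> W" for j using that i by (auto simp: axis_def)
  have inS: "f z *v ?e \<in> sphere 0 1 \<inter> ?S" if "z \<in> ?Z" for z
    using fW[OF that] SO_sub_component[OF fW[OF that] _ e0] by (simp add: norm_SO_sub)
  have e: "?e \<in> sphere 0 1 \<inter> ?S" using e0 by simp
  have aff: "aff_dim X < aff_dim (cball 0 1 \<inter> ?S)" if "X \<in> {?K}" for X
    using aff_dim_le_DIM[of ?K] dim that by (simp add: aff_dim_unit_ball_coords)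
  obtain k where k: "continuous_on (\<Union>{?K}) k" "k \<in> \<Union>{?K} \<rightarrow> rel_frontier (cball 0 1 \<inter> ?S)"
    "\<And>x. x \<in> ?B0 \<union> ?B1 \<Longrightarrow> k x = ?g x"
  proof (rule extend_map_cell_complex_to_sphere[of "{?K}" "?B0 \<union> ?B1" "cball 0 1 \<inter> ?S" ?g])
    show "?B0 \<union> ?B1 \<subseteq> \<Union>{?K}" using B(2) unfolding K by auto
    show "closed (?B0 \<union> ?B1)" using B(1) by (auto intro!: closed_Times closed_Un)
    show "convex (cball 0 1 \<inter> ?S)" by (rule aff_dim_unit_ball_coords)
    show "bounded (cball 0 1 \<inter> ?S)" by (intro bounded_Int) simp
    show "polytope X" if "X \<in> {?K}" for X using that polytope_interval by blast
    show "X \<inter> Y face_of X" if "X \<in> {?K}" "Y \<in> {?K}" for X Y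
      using that by (auto intro!: face_of_refl)
    show "?g \<in> ?B0 \<union> ?B1 \<rightarrow> rel_frontier (cball 0 1 \<inter> ?S)"
      unfolding aff_dim_unit_ball_coords using inS e by auto
  qed (use cont aff in \<open>auto simp only: finite.intros\<close>)
  have kD: "norm (k p) = 1" "j \<notin> W \<Longrightarrow> k p $ j = 0" if "p \<in> {0..1} \<times> ?Z" for p j
    using k(2) that unfolding aff_dim_unit_ball_coords by (auto simp: K Pi_iff)
  have kc: "continuous_on ({0..1} \<times> ?Z) k" using k(1) by (simp add: K)
  have kf: "k (0, z) = f z *v ?e" if "z \<in> ?Z" for z using k(3)[of "(0, z)"] that by simp
  obtain h where h: "continuous_on ({0..1} \<times> ?Z) h"
    "\<forall>p\<in>{0..1} \<times> ?Z. h p \<in> SO_sub W \<and> h p *v ?e = k p"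
    "\<forall>z\<in>?Z. h (0, z) = f z \<and>
       ((\<forall>s\<in>{0..1}. k (s, z) = k (0, z)) \<longrightarrow> (\<forall>s\<in>{0..1}. h (s, z) = f z))"
    by (rule exE[OF sphere_homotopy_lift[OF compact_cbox kc kD f fW kf]])
      (assumption+, elim conjE, rule that)
  have "h (1, z) \<in> SO_sub (W - {i})" if "z \<in> ?Z" for z
  proof -
    have "k (1, z) = ?e" using k(3)[of "(1, z)"] that by auto
    then have "h (1, z) *v ?e = ?e" "h (1, z) \<in> SO_sub W" using bspec[OF h(2), of "(1, z)"] that by simp_all
    then show ?thesis by (auto simp: SO_sub_def)
  qed
  moreover have "\<forall>s\<in>{0..1}. h (s, z) = f z" if "z \<in> B" for z
  proof -
    have "k (s, z) = ?e" if "s \<in> {0..1}" for s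
      using k(3)[of "(s, z)"] fixB \<open>z \<in> B\<close> that by auto
    then have "\<forall>s\<in>{0..1}. k (s, z) = k (0, z)" by simp
    then show ?thesis using h(3) B(2) that by blast
  qed
  ultimately show ?thesis using h(1,2,3) by (intro exI[of _ h]) simp
qed

section \<open>Rotations of a coordinate plane and their angles\<close>

text \<open>The rotation by \<theta> in the plane of \<open>a\<close> and \<open>b\<close>: the two
  mirror normals enclose the angle \<theta>/2. Written with reflections it inherits their continuity
  and orthogonality.\<close>

definition plane_rot :: "'n \<Rightarrow> 'n \<Rightarrow> real \<Rightarrow> real^'n^'n" where
  "plane_rot a b \<theta> = refl_mat (cos (\<theta>/2) *\<^sub>R axis a 1 + sin (\<theta>/2) *\<^sub>R axis b 1) ** refl_mat (axis a 1)"

lemma half_angle_nonzero: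
  assumes "a \<noteq> b"
  shows "cos t *\<^sub>R axis a 1 + sin t *\<^sub>R axis b 1 \<noteq> (0 :: real^'n)"
proof
  assume *: "cos t *\<^sub>R axis a 1 + sin t *\<^sub>R axis b 1 = (0 :: real^'n)"
  have "cos t = 0" using arg_cong[OF *, of "\<lambda>x. x $ a"] assms by (simp add: axis_def)
  moreover have "sin t = 0" using arg_cong[OF *, of "\<lambda>x. x $ b"] assms by (simp add: axis_def)
  ultimately show False using sin_cos_squared_add[of t] by simp
qed

lemma SO_sub_imp_rotation: "A \<in> SO_sub W \<Longrightarrow> rotation_matrix A"
  by (simp add: SO_sub_def)

lemma continuous_on_plane_rot:
  fixes f :: "'z::t2_space \<Rightarrow> real"
  assumes "a \<noteq> b" "continuous_on S f"
  shows "continuous_on S (\<lambda>x. plane_rot a b (f x))"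
  unfolding plane_rot_def using assms(2) half_angle_nonzero[OF assms(1)]
  by (intro continuous_on_matrix_mult continuous_on_refl_mat continuous_intros) auto

lemma plane_rot_0: "plane_rot a b 0 = mat 1"
  by (simp add: plane_rot_def matrix_eq matrix_vector_mul_assoc[symmetric] refl_mat_involution)

lemma plane_rot_in_SO_sub:
  assumes "a \<noteq> b" shows "plane_rot a b \<theta> \<in> SO_sub {a, b}"
proof -
  have "rotation_matrix (plane_rot a b \<theta>)"
  proof (rule rotation_matrix_connected[of UNIV "plane_rot a b" 0])
    show "continuous_on UNIV (plane_rot a b)"
      using continuous_on_plane_rot[OF assms continuous_on_id] by simp
    show "orthogonal_matrix (plane_rot a b x)" for x
      unfolding plane_rot_def by (intro orthogonal_matrix_mul orthogonal_refl_mat)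
    show "rotation_matrix (plane_rot a b 0)"
      using mat_1_in_SO_sub[of UNIV] by (simp add: plane_rot_0 SO_sub_def)
  qed auto
  moreover have "plane_rot a b \<theta> *v axis j 1 = axis j 1" if "j \<notin> {a, b}" for j
  proof -
    have "(axis a 1 :: real^'a) $ j = 0" "(axis b 1 :: real^'a) $ j = 0"
      using that by (simp_all add: axis_def)
    then show ?thesis
      by (simp add: plane_rot_def matrix_vector_mul_assoc[symmetric] refl_mat_axis)
  qed
  ultimately show ?thesis by (simp add: SO_sub_def)
qed

lemma plane_rot_axis:
  fixes a b :: "'n::finite"
  assumes "a \<noteq> b"
  shows "plane_rot a b \<theta> *v axis a 1 = cos \<theta> *\<^sub>R axis a 1 + sin \<theta> *\<^sub>R axis b 1"
proof -
  let ?w = "cos (\<theta>/2) *\<^sub>R axis a 1 + sin (\<theta>/2) *\<^sub>R axis b 1 :: real^'n"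
  have wa: "?w $ a = cos (\<theta>/2)" "?w $ b = sin (\<theta>/2)" using assms by (simp_all add: axis_def)
  have "?w \<bullet> ?w = 1"
    using assms sin_cos_squared_add[of "\<theta>/2"]
    by (simp add: inner_add_left inner_axis' wa power2_eq_square del: vector_add_component vector_scaleR_component)
  then have "plane_rot a b \<theta> *v axis a 1 = (2 * cos (\<theta>/2)) *\<^sub>R ?w - axis a 1"
    by (simp add: plane_rot_def matrix_vector_mul_assoc[symmetric] refl_mat_mult inner_axis_axis
        inner_add_left inner_add_right inner_axis assms assms[symmetric] wa scaleR_2
        matrix_vector_mult_diff_distrib del: vector_add_component vector_scaleR_component)
  also have "\<dots> = (2 * cos (\<theta>/2) * cos (\<theta>/2) - 1) *\<^sub>R axis a 1 + (2 * sin (\<theta>/2) * cos (\<theta>/2)) *\<^sub>R axis b 1"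
    by (simp add: algebra_simps)
  also have "2 * cos (\<theta>/2) * cos (\<theta>/2) - 1 = cos \<theta>"
    using cos_double_cos[of "\<theta>/2"] by (simp add: power2_eq_square)
  also have "2 * sin (\<theta>/2) * cos (\<theta>/2) = sin \<theta>"
    using sin_double[of "\<theta>/2"] by simp
  finally show ?thesis .
qed

text \<open>\<open>D = transpose B ** A\<close> is orthogonal and fixes every axis except possibly
  that of \<open>b\<close>. Hence it is diagonal with a single entry in question, which the
  determinant forces to be 1.\<close>

lemma SO_sub_pair_unique:
  assumes ab: "a \<noteq> b" and A: "A \<in> SO_sub {a, b}" and B: "B \<in> SO_sub {a, b}"
    and eq: "A *v axis a 1 = B *v axis a 1"
  shows "A = B"
proof -
  have oA: "orthogonal_matrix A" "det A = 1" and oB: "orthogonal_matrix B" "det B = 1"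
    using A B by (simp_all add: SO_sub_def rotation_matrix_def)
  define D where "D = transpose B ** A"
  have oD: "orthogonal_matrix D" and dD: "det D = 1"
    using oA oB by (simp_all add: D_def orthogonal_matrix_mul det_mul)
  have BtB: "transpose B *v (B *v x) = x" and BBt: "B *v (transpose B *v x) = x" for x
    using oB(1) unfolding orthogonal_matrix_def
    by (simp_all only: matrix_vector_mul_assoc matrix_vector_mul_lid)
  have eqj: "A *v axis j 1 = B *v axis j 1" if "j \<noteq> b" for j
    using eq A B that by (cases "j = a") (auto simp: SO_sub_def)
  have fixD: "D *v axis j 1 = axis j 1" if "j \<noteq> b" for j
    using eqj[OF that] by (simp only: D_def matrix_vector_mul_assoc[symmetric] BtB)
  have oDt: "orthogonal_transformation ((*v) D)"
    using oD by (rule orthogonal_matrix_transformation)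
  have entry: "D $ i $ j = (D *v axis j 1) $ i" for i j
    by (simp add: matrix_vector_mult_basis column_def)
  have "D $ i $ b = 0" if "i \<noteq> b" for i
  proof -
    have "D $ i $ b = (D *v axis b 1) \<bullet> (D *v axis i 1)"
      by (simp add: entry fixD[OF that] inner_axis)
    also have "\<dots> = axis b 1 \<bullet> (axis i 1 :: real^'a)"
      using oDt by (simp add: orthogonal_transformation_def)
    finally show ?thesis using that by (simp add: inner_axis_axis)
  qed
  then have diag: "D $ i $ j = 0" if "i \<noteq> j" for i j
    using that fixD[of j] by (cases "j = b") (auto simp: entry axis_def)
  have diag1: "D $ i $ i = 1" if "i \<noteq> b" for i
    using fixD[OF that] by (simp add: entry axis_def)
  have "det D = (\<Prod>i\<in>UNIV. D $ i $ i)" by (rule det_diagonal) (rule diag)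
  also have "\<dots> = D $ b $ b * (\<Prod>i\<in>UNIV - {b}. D $ i $ i)"
    by (simp add: prod.remove)
  also have "(\<Prod>i\<in>UNIV - {b}. D $ i $ i) = 1" by (rule prod.neutral) (simp add: diag1)
  finally have "D $ b $ b = 1" using dD by simp
  then have D1: "D = mat 1" using diag diag1 by (simp add: vec_eq_iff mat_def) metis
  have "B ** D = A"
    by (simp only: matrix_eq D_def matrix_vector_mul_assoc[symmetric] BBt simp_thms)
  then show ?thesis by (simp add: D1)
qed

text \<open>The image of the axis \<open>a\<close> is read as a complex number of modulus 1. On a
  contractible set it has a continuous logarithm, whose imaginary part is the angle.\<close>

lemma SO_sub_pair_angle:
  fixes A :: "'z::real_normed_vector \<Rightarrow> real^'n^'n"
  assumes ab: "a \<noteq> b" and S: "contractible S" and A: "continuous_on S A" "\<And>z. z \<in> S \<Longrightarrow> A z \<in> SO_sub {a, b}"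
  obtains \<theta> where "continuous_on S \<theta>" "\<And>z. z \<in> S \<Longrightarrow> A z = plane_rot a b (\<theta> z)"
proof -
  define c where "c z = Complex ((A z *v axis a 1) $ a) ((A z *v axis a 1) $ b)" for z
  have split: "A z *v axis a 1 = Re (c z) *\<^sub>R axis a 1 + Im (c z) *\<^sub>R axis b 1" if "z \<in> S" for z
  proof (subst vec_eq_iff, intro allI)
    fix j show "(A z *v axis a 1) $ j = (Re (c z) *\<^sub>R axis a 1 + Im (c z) *\<^sub>R axis b 1) $ j"
    proof (cases "j \<in> {a, b}")
      case False
      then have "(A z *v axis a 1) $ j = 0"
        by (intro SO_sub_component[OF A(2)[OF that]]) (auto simp: axis_def)
      then show ?thesis using False by (simp add: axis_def)
    qed (use ab in \<open>auto simp: c_def axis_def\<close>)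
  qed
  have cc: "continuous_on S c"
    unfolding c_def Complex_eq
    by (intro continuous_intros continuous_on_matrix_vector A)
  have norm1: "cmod (c z) = 1" if "z \<in> S" for z
  proof -
    have "(A z *v axis a 1) \<bullet> (A z *v axis a 1) = 1"
      using norm_SO_sub[OF A(2)[OF that], of "axis a 1"] by (simp add: dot_square_norm)
    then have "(Re (c z))\<^sup>2 + (Im (c z))\<^sup>2 = 1"
      unfolding split[OF that] using ab
      by (simp add: inner_add_left inner_add_right inner_axis_axis power2_eq_square)
    then show ?thesis by (simp add: cmod_def)
  qed
  obtain g where g: "continuous_on S g" "\<And>z. z \<in> S \<Longrightarrow> c z = exp (g z)"
    using continuous_logarithm_on_contractible[OF cc S] norm1 by (metis norm_zero zero_neq_one)
  have "A z = plane_rot a b (Im (g z))" if "z \<in> S" for z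
  proof (rule SO_sub_pair_unique[OF ab A(2)[OF that] plane_rot_in_SO_sub[OF ab]])
    have "exp (Re (g z)) = 1" using norm1[OF that] g(2)[OF that] by (simp add: norm_exp_eq_Re)
    then have "Re (c z) = cos (Im (g z))" "Im (c z) = sin (Im (g z))"
      using g(2)[OF that] by (simp_all add: Re_exp Im_exp)
    then show "A z *v axis a 1 = plane_rot a b (Im (g z)) *v axis a 1"
      by (simp add: split[OF that] plane_rot_axis[OF ab])
  qed
  moreover have "continuous_on S (\<lambda>z. Im (g z))" by (intro continuous_intros g)
  ultimately show ?thesis using that by blast
qed

lemma plane_rot_periodic:
  assumes "a \<noteq> b" shows "plane_rot a b (\<theta> + 2 * pi * of_int m) = plane_rot a b \<theta>"
proof (rule SO_sub_pair_unique[OF assms plane_rot_in_SO_sub[OF assms] plane_rot_in_SO_sub[OF assms]])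
  show "plane_rot a b (\<theta> + 2 * pi * of_int m) *v axis a 1 = plane_rot a b \<theta> *v axis a 1"
    by (simp only: plane_rot_axis[OF assms] cos_add sin_add sin_int_2pin cos_int_2pin) simp
qed

lemma plane_rot_eq_1D:
  assumes "a \<noteq> b" "plane_rot a b \<theta> = mat 1"
  obtains m :: int where "\<theta> = 2 * pi * of_int m"
proof -
  have "cos \<theta> *\<^sub>R axis a 1 + sin \<theta> *\<^sub>R axis b 1 = (axis a 1 :: real^'a)"
    using plane_rot_axis[OF assms(1), of \<theta>] assms(2) by simp
  from arg_cong[OF this, of "\<lambda>x. x $ a"] have "cos \<theta> = 1"
    using assms(1) by (simp add: axis_def)
  then show ?thesis using that by (auto simp: cos_one_2pi_int)
qed

abbreviation SO_top :: "(real^'n^'n) topology" where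
  "SO_top \<equiv> top_of_set {A. rotation_matrix A}"

definition rot_loop :: "'n \<Rightarrow> 'n \<Rightarrow> int \<Rightarrow> real \<Rightarrow> real^'n^'n" where
  "rot_loop a b m t = plane_rot a b (2 * pi * of_int m * t)"

lemma continuous_map_plane_rot:
  assumes "a \<noteq> b" shows "continuous_map (top_of_set UNIV) SO_top (plane_rot a b)"
  using plane_rot_in_SO_sub[OF assms] continuous_on_plane_rot[OF assms continuous_on_id]
  by (auto simp: continuous_map_in_subtopology SO_sub_def)

lemma path_from_rot_loop:
  assumes "a \<noteq> b" shows "path_from SO_top (mat 1) (mat 1) (rot_loop a b m)"
proof -
  have "continuous_on {0..1} (rot_loop a b m)"
    unfolding rot_loop_def by (intro continuous_on_plane_rot assms continuous_intros)
  moreover have "rot_loop a b m t \<in> {A. rotation_matrix A}" for t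
    using plane_rot_in_SO_sub[OF assms] by (simp add: rot_loop_def SO_sub_def)
  ultimately show ?thesis
    using plane_rot_periodic[OF assms, of 0 m]
    by (auto simp: path_from_def pathin_def continuous_map_in_subtopology rot_loop_def plane_rot_0)
qed

lemma rot_loop_join:
  assumes "a \<noteq> b"
  shows "path_hom SO_top (mat 1) (mat 1) (join_loops (rot_loop a b m) (rot_loop a b k)) (rot_loop a b (m + k))"
proof -
  \<comment> \<open>\<open>?u\<close> is the angle along the joined loops, continued past the middle
    by adding the full turns already made. It ends at the same value as the linear angle
    \<open>?v\<close>, so a straight-line homotopy of angles joins the two.\<close>
  let ?u = "\<lambda>t::real. if t \<le> 1/2 then 2 * pi * of_int m * (2 * t) else 2 * pi * of_int k * (2 * t - 1) + 2 * pi * of_int m"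
  let ?v = "\<lambda>t::real. 2 * pi * of_int (m + k) * t"
  have c: "continuous_on {0..1} ?u"
  proof (rule continuous_on_cases_le)
    show "2 * pi * of_int m * (2 * t) = 2 * pi * of_int k * (2 * t - 1) + 2 * pi * of_int m"
      if "t = 1/2" for t :: real
      unfolding that by simp
  qed (intro continuous_intros)+
  have one: "plane_rot a b (2 * pi * of_int (m + k)) = mat 1"
    using plane_rot_periodic[OF assms, of 0 "m + k"] by (simp add: plane_rot_0)
  have "path_hom SO_top (mat 1) (mat 1) (plane_rot a b \<circ> ?u) (plane_rot a b \<circ> ?v)"
  proof (rule path_hom_in_convex[OF convex_UNIV continuous_map_plane_rot[OF assms] c])
    show "continuous_on {0..1} ?v" by (intro continuous_intros)
    show "?u 1 = ?v 1" by (simp add: algebra_simps)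
    then show "plane_rot a b (?u 1) = mat 1" using one by simp
  qed (simp_all add: plane_rot_0)
  then show ?thesis
    by (rule path_hom_cong)
      (simp_all add: join_loops_def rot_loop_def plane_rot_periodic[OF assms])
qed

text \<open>The fibre transport \<open>SO_sub_compress\<close> pushes a loop into a smaller rotation group as long as
  the sphere in question is simply connected.\<close>

lemma SO_sub_loop_reduce:
  assumes "finite W" "a \<in> W" "b \<in> W" "a \<noteq> b"
    and "path_from (top_of_set (SO_sub W)) A (mat 1) p" and "A \<in> SO_sub {a, b}"
  shows "\<exists>q. path_from (top_of_set (SO_sub {a, b})) A (mat 1) q \<and> path_hom SO_top A (mat 1) p q"
  using assms(1,2,3,5)
proof (induction "card W" arbitrary: W p rule: less_induct)
  case (less W)
  have sub: "SO_sub W \<subseteq> {A. rotation_matrix A}" by (auto simp: SO_sub_def)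
  have pc: "continuous_on {0..1} p" "\<And>t. t \<in> {0..1} \<Longrightarrow> p t \<in> SO_sub W" "p 0 = A" "p 1 = mat 1"
    using less.prems(4) by (auto simp: path_from_def pathin_def continuous_map_in_subtopology)
  show ?case
  proof (cases "W = {a, b}")
    case True
    have "path_from SO_top A (mat 1) p"
      using pc(1,3,4) subsetD[OF sub pc(2)] by (simp add: path_from_def pathin_def continuous_map_in_subtopology Pi_iff)
    from path_hom_refl[OF this] show ?thesis using True less.prems(4) by blast
  next
    case False
    then obtain i where i: "i \<in> W" "i \<noteq> a" "i \<noteq> b" using less.prems by blast
    \<comment> \<open>With a third index present the sphere has dimension at least 2, as the prism
      over a one-parameter family requires.\<close>
    have "card {a, b, i} \<le> card W" using less.prems i by (intro card_mono) auto
    then have card: "DIM(real) + 1 < card W" using i assms(4) by simp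
    have ends: "p z \<in> SO_sub (W - {i})" if "z \<in> {0, 1}" for z
    proof -
      have "SO_sub {a, b} \<subseteq> SO_sub (W - {i})" using less.prems i by (intro SO_sub_mono) auto
      then show ?thesis using that pc assms(6) mat_1_in_SO_sub by auto
    qed
    have "\<exists>h. continuous_on ({0..1::real} \<times> cbox 0 1) h \<and> (\<forall>p\<in>{0..1} \<times> cbox 0 1. h p \<in> SO_sub W) \<and>
      (\<forall>z\<in>cbox 0 1. h (0, z) = p z \<and> h (1, z) \<in> SO_sub (W - {i})) \<and>
      (\<forall>z\<in>{0, 1}. \<forall>s\<in>{0..1}. h (s, z) = p z)"
      by (rule SO_sub_compress[OF _ _ _ _ ends i(1) card]) (use pc in auto)
    then obtain h where h: "continuous_on unit_square h" "\<forall>p\<in>unit_square. h p \<in> SO_sub W"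
      "\<forall>z\<in>{0..1}. h (0, z) = p z \<and> h (1, z) \<in> SO_sub (W - {i})"
      "\<forall>z\<in>{0, 1}. \<forall>s\<in>{0..1}. h (s, z) = p z"
      by (auto simp: cbox_interval)
    let ?q = "\<lambda>t. h (1, t)"
    have q: "path_from (top_of_set (SO_sub (W - {i}))) A (mat 1) ?q"
    proof -
      have "continuous_on {0..1} ?q"
        by (rule continuous_on_compose2[OF h(1)]) (auto intro!: continuous_intros)
      then show ?thesis
        using h pc by (auto simp: path_from_def pathin_def continuous_map_in_subtopology)
    qed
    have "card (W - {i}) < card W" using i(1) less.prems(1) by (rule card_Diff1_less[rotated])
    from less.hyps[OF this _ _ _ q] less.prems i obtain r where
      r: "path_from (top_of_set (SO_sub {a, b})) A (mat 1) r" "path_hom SO_top A (mat 1) ?q r" by auto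
    have "path_hom SO_top A (mat 1) p ?q"
      by (rule path_homI[of _ h]) (use h pc in \<open>auto simp: continuous_map_in_subtopology intro: SO_sub_imp_rotation\<close>)
    from path_hom_trans[OF this r(2)] r(1) show ?thesis by blast
  qed
qed

text \<open>Once the loop lies in the plane, its angle starts and ends at multiples of 2\<pi>. Their
  difference is the winding number \<open>m\<close>, and a straight-line homotopy of angles leads to
  the uniform turn.\<close>

lemma rot_loop_generates:
  assumes ab: "a \<noteq> b" and p: "path_from SO_top (mat 1) (mat 1) p"
  obtains m where "path_hom SO_top (mat 1) (mat 1) p (rot_loop a b m)"
proof -
  obtain q where q: "path_from (top_of_set (SO_sub {a, b})) (mat 1) (mat 1) q"
    "path_hom SO_top (mat 1) (mat 1) p q"
    using SO_sub_loop_reduce[of UNIV a b "mat 1" p] ab p mat_1_in_SO_sub by (auto simp: SO_sub_UNIV)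
  have qc: "continuous_on {0..1} q" "\<And>t. t \<in> {0..1} \<Longrightarrow> q t \<in> SO_sub {a, b}" "q 0 = mat 1" "q 1 = mat 1"
    using q(1) by (auto simp: path_from_def pathin_def continuous_map_in_subtopology)
  obtain \<theta> where \<theta>: "continuous_on {0..1} \<theta>" "\<And>t. t \<in> {0..1} \<Longrightarrow> q t = plane_rot a b (\<theta> t)"
    by (rule SO_sub_pair_angle[OF ab _ qc(1,2)]) (auto intro: convex_imp_contractible)
  obtain m0 m1 :: int where m: "\<theta> 0 = 2 * pi * of_int m0" "\<theta> 1 = 2 * pi * of_int m1"
    using \<theta>(2)[of 0] \<theta>(2)[of 1] qc(3,4) plane_rot_eq_1D[OF ab] by (metis atLeastAtMost_iff order_refl zero_le_one)
  let ?u = "\<lambda>t. \<theta> t + 2 * pi * of_int (- m0)"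
  let ?v = "\<lambda>t. 2 * pi * of_int (m1 - m0) * t"
  have one: "plane_rot a b (2 * pi * of_int (m1 - m0)) = mat 1"
    using plane_rot_periodic[OF ab, of 0 "m1 - m0"] by (simp add: plane_rot_0)
  have "path_hom SO_top (mat 1) (mat 1) (plane_rot a b \<circ> ?u) (plane_rot a b \<circ> ?v)"
  proof (rule path_hom_in_convex[OF convex_UNIV continuous_map_plane_rot[OF ab]])
    show "continuous_on {0..1} ?u" using \<theta>(1) by (intro continuous_intros)
    show "continuous_on {0..1} ?v" by (intro continuous_intros)
    show "?u 0 = ?v 0" using m by simp
    then show "plane_rot a b (?u 0) = mat 1" by (simp add: plane_rot_0)
    show "?u 1 = ?v 1" using m by (simp add: algebra_simps)
    then show "plane_rot a b (?u 1) = mat 1" using one by simp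
  qed simp_all
  then have "path_hom SO_top (mat 1) (mat 1) q (rot_loop a b (m1 - m0))"
    by (rule path_hom_cong) (simp_all add: rot_loop_def \<theta>(2) plane_rot_periodic[OF ab] del: of_int_minus)
  from path_hom_trans[OF q(2) this] show ?thesis by (rule that)
qed

text \<open>Compression of a constant family, with nothing held fixed: the track of one point is a
  path into the next smaller group. In the plane the angle is scaled down to 0.\<close>

lemma SO_top_path_connected:
  assumes ab: "(a::'n::finite) \<noteq> b" and A: "rotation_matrix (A :: real^'n^'n)"
  shows "\<exists>p. path_from SO_top A (mat 1) p"
proof -
  have "\<exists>p. path_from SO_top A (mat 1) p"
    if "finite W" "a \<in> W" "b \<in> W" "A \<in> SO_sub W" for W and A :: "real^'n^'n"
    using that
  proof (induction "card W" arbitrary: W A rule: less_induct)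
    case (less W)
    have sub: "SO_sub W \<subseteq> {A. rotation_matrix A}" by (auto simp: SO_sub_def)
    show ?case
    proof (cases "W = {a, b}")
      case True
      obtain \<theta> where "A = plane_rot a b (\<theta> (0::real))"
        by (rule SO_sub_pair_angle[OF ab, of "{0::real}" "\<lambda>_. A"]) (use less True in auto)
      then have \<theta>: "A = plane_rot a b (\<theta> 0)" .
      let ?p = "\<lambda>t. plane_rot a b ((1 - t) * \<theta> 0)"
      have "continuous_on {0..1} ?p"
        by (intro continuous_on_plane_rot ab continuous_intros)
      then have "path_from SO_top A (mat 1) ?p"
        using plane_rot_in_SO_sub[OF ab] \<theta>
        by (auto simp: path_from_def pathin_def continuous_map_in_subtopology SO_sub_def plane_rot_0)
      then show ?thesis by blast
    next
      case False
      then obtain i where i: "i \<in> W" "i \<noteq> a" "i \<noteq> b" using less.prems by blast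
      have "card {a, b, i} \<le> card W" using less.prems i by (intro card_mono) auto
      then have card: "DIM(real) + 1 < card W" using i ab by simp
      have "\<exists>h. continuous_on ({0..1::real} \<times> cbox 0 (1::real)) h \<and> (\<forall>p\<in>{0..1} \<times> cbox 0 1. h p \<in> SO_sub W) \<and>
        (\<forall>z\<in>cbox 0 1. h (0, z) = A \<and> h (1, z) \<in> SO_sub (W - {i})) \<and>
        (\<forall>z\<in>{}. \<forall>s\<in>{0..1}. h (s, z) = A)"
        by (rule SO_sub_compress[OF _ _ _ _ _ i(1) card]) (use less in auto)
      then obtain h where h: "continuous_on unit_square h" "\<forall>p\<in>unit_square. h p \<in> SO_sub W"
        "\<forall>z\<in>{0..1}. h (0, z) = A \<and> h (1, z) \<in> SO_sub (W - {i})"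
        by (auto simp: cbox_interval)
      have "continuous_on {0..1} (\<lambda>s. h (s, 0))"
        by (rule continuous_on_compose2[OF h(1)]) (auto intro!: continuous_intros)
      then have q: "path_from SO_top A (h (1, 0)) (\<lambda>s. h (s, 0))"
        using h(2,3)
        by (auto simp: path_from_def pathin_def continuous_map_in_subtopology intro: SO_sub_imp_rotation[of _ W])
      have "card (W - {i}) < card W" using i(1) less.prems(1) by (rule card_Diff1_less[rotated])
      from less.hyps[OF this, of "h (1, 0)"] less.prems i h(3)
      obtain r where "path_from SO_top (h (1, 0)) (mat 1) r" by auto
      from path_from_join[OF q this] show ?thesis by blast
    qed
  qed
  from this[of UNIV] A show ?thesis by (simp add: SO_sub_UNIV)
qed

section \<open>Homotopies between multiples of the full turn\<close>

text \<open>The difference of the two angle functions is continuous on an interval with values in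
  the multiples of 2\<pi>, hence constant.\<close>

lemma plane_rot_angle_diff:
  assumes ab: "a \<noteq> b" and f: "continuous_on {0..1::real} f" and g: "continuous_on {0..1} g"
    and eq: "\<And>t. t \<in> {0..1} \<Longrightarrow> plane_rot a b (f t) = plane_rot a b (g t)"
  shows "f 1 - f 0 = g 1 - g 0"
proof -
  have int: "\<exists>n::int. f t - g t = 2 * pi * of_int n" if "t \<in> {0..1}" for t
  proof -
    have *: "cos (f t) *\<^sub>R axis a 1 + sin (f t) *\<^sub>R axis b 1
        = cos (g t) *\<^sub>R axis a 1 + sin (g t) *\<^sub>R (axis b 1 :: real^'a)"
      using eq[OF that] plane_rot_axis[OF ab] by metis
    have "cos (f t) = cos (g t)" "sin (f t) = sin (g t)"
      using arg_cong[OF *, of "\<lambda>x. x $ a"] arg_cong[OF *, of "\<lambda>x. x $ b"] ab by (simp_all add: axis_def)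
    then obtain n :: int where "f t = g t + 2 * pi * of_int n"
      using sin_cos_eq_iff by blast
    then show ?thesis by auto
  qed
  have "(\<lambda>t. f t - g t) constant_on {0..1}"
  proof (rule continuous_discrete_range_constant)
    show "continuous_on {0..1} (\<lambda>t. f t - g t)" by (intro continuous_intros f g)
    fix x :: real assume x: "x \<in> {0..1}"
    have "2 * pi \<le> norm ((f y - g y) - (f x - g x))"
      if "y \<in> {0..1}" "f y - g y \<noteq> f x - g x" for y
    proof -
      obtain m n :: int where mn: "f y - g y = 2 * pi * of_int m" "f x - g x = 2 * pi * of_int n"
        using int[OF \<open>y \<in> {0..1}\<close>] int[OF x] by blast
      then have "m \<noteq> n" using that(2) by auto
      then have "1 \<le> \<bar>real_of_int (m - n)\<bar>" by linarith
      then have "2 * pi * 1 \<le> 2 * pi * \<bar>real_of_int (m - n)\<bar>" by (intro mult_left_mono) auto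
      also have "\<dots> = norm ((f y - g y) - (f x - g x))"
        unfolding mn by (simp add: abs_mult flip: right_diff_distrib)
      finally show ?thesis by simp
    qed
    then show "\<exists>e>0. \<forall>y. y \<in> {0..1} \<and> f y - g y \<noteq> f x - g x \<longrightarrow> e \<le> norm ((f y - g y) - (f x - g x))"
      by (intro exI[of _ "2 * pi"]) auto
  qed simp
  then obtain c where "\<And>t. t \<in> {0..1} \<Longrightarrow> f t - g t = c"
    unfolding constant_on_def by blast
  from this[of 0] this[of 1] show ?thesis by simp
qed

text \<open>In dimension 2 every rotation is a plane rotation, so the homotopy has an angle over the
  whole square. The angle does not change along the two sides where the rotation is the identity,
  and grows by \<open>2 * pi * m\<close> and \<open>2 * pi * k\<close> along the other two.\<close>

lemma rot_loop_inj_2: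
  fixes a b :: "'n::finite"
  assumes ab: "a \<noteq> b" and card: "CARD('n) = 2"
    and hom: "path_hom SO_top (mat 1) (mat 1) (rot_loop a b m) (rot_loop a b k)"
  shows "m = k"
proof -
  have "UNIV = {a, b}"
    by (rule card_subset_eq[symmetric]) (use card ab in auto)
  then have SO: "{A. rotation_matrix A} = SO_sub {a, b}" by (metis SO_sub_UNIV)
  obtain h where h: "continuous_map (top_of_set unit_square) SO_top h"
    "\<forall>t\<in>{0..1}. h (0, t) = rot_loop a b m t \<and> h (1, t) = rot_loop a b k t"
    "\<forall>s\<in>{0..1}. h (s, 0) = mat 1 \<and> h (s, 1) = mat 1"
    using hom unfolding path_hom_iff by blast
  have hc: "continuous_on unit_square h" "\<And>z. z \<in> unit_square \<Longrightarrow> h z \<in> SO_sub {a, b}"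
    using h(1) SO by (auto simp: continuous_map_in_subtopology)
  obtain \<theta> where \<theta>: "continuous_on unit_square \<theta>" "\<And>z. z \<in> unit_square \<Longrightarrow> h z = plane_rot a b (\<theta> z)"
    by (rule SO_sub_pair_angle[OF ab _ hc]) (auto intro: convex_imp_contractible convex_Times)
  have edge: "continuous_on {0..1} (\<lambda>t. \<theta> (u t))" if "continuous_on {0..1::real} u" "u ` {0..1} \<subseteq> unit_square" for u
    by (rule continuous_on_compose2[OF \<theta>(1) that])
  have e: "continuous_on {0..1} (\<lambda>t. \<theta> (c, t))" "continuous_on {0..1} (\<lambda>t. \<theta> (t, c))" if "c \<in> {0..1}" for c
    using that by (auto intro!: edge continuous_intros)
  have lin: "continuous_on {0..1} (\<lambda>t. 2 * pi * of_int j * t)" for j :: int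
    by (intro continuous_intros)
  have "\<theta> (0, 1) - \<theta> (0, 0) = 2 * pi * of_int m * 1 - 2 * pi * of_int m * 0"
    by (rule plane_rot_angle_diff[OF ab e(1) lin]) (use \<theta>(2)[symmetric] h(2) in \<open>auto simp: rot_loop_def\<close>)
  moreover have "\<theta> (1, 1) - \<theta> (1, 0) = 2 * pi * of_int k * 1 - 2 * pi * of_int k * 0"
    by (rule plane_rot_angle_diff[OF ab e(1) lin]) (use \<theta>(2)[symmetric] h(2) in \<open>auto simp: rot_loop_def\<close>)
  moreover have "\<theta> (1, 0) - \<theta> (0, 0) = 0 - 0"
    by (rule plane_rot_angle_diff[OF ab e(2) continuous_on_const])
      (use \<theta>(2)[symmetric] h(3) in \<open>auto simp: plane_rot_0\<close>)
  moreover have "\<theta> (1, 1) - \<theta> (0, 1) = 0 - 0"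
    by (rule plane_rot_angle_diff[OF ab e(2) continuous_on_const])
      (use \<theta>(2)[symmetric] h(3) in \<open>auto simp: plane_rot_0\<close>)
  ultimately have "pi * of_int m = pi * of_int k" by simp
  then show ?thesis by simp
qed

text \<open>Turning the plane of rotation about one of its axes through a third direction reverses the
  sense of rotation.\<close>

lemma rot_loop_reverse:
  fixes a b c :: "'n::finite"
  assumes "a \<noteq> b" "c \<noteq> a" "c \<noteq> b"
  shows "path_hom SO_top (mat 1) (mat 1) (rot_loop a b 1) (rot_loop a b (- 1))"
proof -
  \<comment> \<open>The half-angle vector of a full turn. The direction accompanying the axis
    \<open>a\<close> turns from \<open>b\<close> through \<open>c\<close> to minus \<open>b\<close>
    as \<open>fst z\<close> grows. At \<open>snd z = 1\<close> the vector is the negative of the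
    axis \<open>a\<close>, which gives the same reflection.\<close>
  define w :: "real \<times> real \<Rightarrow> real^'n" where
    "w z = cos (pi * snd z) *\<^sub>R axis a 1 + sin (pi * snd z) *\<^sub>R
       (cos (pi * fst z) *\<^sub>R axis b 1 + sin (pi * fst z) *\<^sub>R axis c 1)" for z
  define h where "h z = refl_mat (w z) ** refl_mat (axis a 1)" for z
  have "w z \<noteq> 0" for z
  proof
    assume w: "w z = 0"
    have "cos (pi * snd z) = 0" "sin (pi * snd z) * cos (pi * fst z) = 0" "sin (pi * snd z) * sin (pi * fst z) = 0"
      using arg_cong[OF w, of "\<lambda>x. x $ a"] arg_cong[OF w, of "\<lambda>x. x $ b"] arg_cong[OF w, of "\<lambda>x. x $ c"] assms
      by (simp_all add: w_def axis_def)
    then show False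
      using sin_zero_abs_cos_one[of "pi * snd z"] sin_zero_abs_cos_one[of "pi * fst z"] by auto
  qed
  then have cont: "continuous_on unit_square h"
    unfolding h_def by (intro continuous_on_matrix_mult continuous_on_refl_mat)
      (auto simp: w_def intro!: continuous_intros)
  have bottom: "h (s, 0) = mat 1" for s
    by (simp add: h_def w_def matrix_eq matrix_vector_mul_assoc[symmetric] refl_mat_involution)
  have "w (s, 1) = (-1) *\<^sub>R axis a 1" for s by (simp add: w_def)
  then have top: "h (s, 1) = mat 1" for s
    by (simp only: h_def refl_mat_scaleR[of "-1"])
      (simp add: matrix_eq matrix_vector_mul_assoc[symmetric] refl_mat_involution)
  have "rotation_matrix (h z)" if "z \<in> unit_square" for z
  proof (rule rotation_matrix_connected[OF cont _ _ _ _ that])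
    show "connected unit_square" by (intro connected_Times connected_Icc)
    show "rotation_matrix (h (0, 0))" using bottom mat_1_in_SO_sub[of UNIV] by (simp add: SO_sub_def)
    show "orthogonal_matrix (h x)" for x
      unfolding h_def by (intro orthogonal_matrix_mul orthogonal_refl_mat)
  qed simp
  then have "continuous_map (top_of_set unit_square) SO_top h"
    using cont by (auto simp: continuous_map_in_subtopology)
  then show ?thesis
    by (rule path_homI) (simp_all add: bottom top, simp_all add: h_def w_def rot_loop_def plane_rot_def mult.commute)
qed

lemma rot_loop_0: "rot_loop a b 0 = (\<lambda>t. mat 1)"
  by (rule ext) (simp add: rot_loop_def plane_rot_0)

lemma rot_loop_2_null:
  fixes a b c :: "'n::finite"
  assumes "a \<noteq> b" "c \<noteq> a" "c \<noteq> b"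
  shows "path_hom SO_top (mat 1) (mat 1) (rot_loop a b 2) (\<lambda>t. mat 1)"
proof -
  have "path_hom SO_top (mat 1) (mat 1) (rot_loop a b 2) (join_loops (rot_loop a b 1) (rot_loop a b 1))"
    using path_hom_sym[OF rot_loop_join[OF assms(1), of 1 1]] by simp
  moreover have "path_hom SO_top (mat 1) (mat 1) (join_loops (rot_loop a b 1) (rot_loop a b 1))
      (join_loops (rot_loop a b 1) (rot_loop a b (- 1)))"
    by (rule path_hom_join[OF path_hom_refl[OF path_from_rot_loop[OF assms(1)]] rot_loop_reverse[OF assms]])
  moreover have "path_hom SO_top (mat 1) (mat 1) (join_loops (rot_loop a b 1) (rot_loop a b (- 1))) (\<lambda>t. mat 1)"
    using rot_loop_join[OF assms(1), of 1 "- 1"] by (simp add: rot_loop_0)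
  ultimately show ?thesis by (blast intro: path_hom_trans)
qed

subsection \<open>Unit quaternions\<close>

text \<open>The pair \<open>(w, u)\<close> stands for the quaternion with real part \<open>w\<close> and imaginary part \<open>u\<close>, acting
  on imaginary quaternions by conjugation.\<close>

definition quat_rot :: "real \<times> (real^3) \<Rightarrow> real^3^3" where
  "quat_rot q = matrix (\<lambda>v. ((fst q)\<^sup>2 - snd q \<bullet> snd q) *\<^sub>R v + (2 * (snd q \<bullet> v)) *\<^sub>R snd q
     + (2 * fst q) *\<^sub>R cross3 (snd q) v)"

lemma quat_rot_mult:
  "quat_rot (w, u) *v v = (w\<^sup>2 - u \<bullet> u) *\<^sub>R v + (2 * (u \<bullet> v)) *\<^sub>R u + (2 * w) *\<^sub>R cross3 u v"
proof -
  have "linear (\<lambda>v. (w\<^sup>2 - u \<bullet> u) *\<^sub>R v + (2 * (u \<bullet> v)) *\<^sub>R u + (2 * w) *\<^sub>R cross3 u v)"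
    by (rule linearI)
      (simp_all add: inner_add_right cross_add_right cross_mult_right algebra_simps)
  then show ?thesis by (simp add: quat_rot_def matrix_works)
qed

lemma continuous_on_quat_rot: "continuous_on S quat_rot"
  unfolding quat_rot_def[abs_def] matrix_def
  by (intro continuous_intros continuous_on_cross)

lemma inner_cross3_self: "cross3 u v \<bullet> cross3 u v = (u \<bullet> u) * (v \<bullet> v) - (u \<bullet> v)\<^sup>2"
  by (simp add: cross3_simps power2_eq_square)

text \<open>Conjugation by a quaternion multiplies squared lengths by the square of its squared
  norm, an identity obtained by expanding.\<close>

lemma orthogonal_quat_rot:
  assumes "w\<^sup>2 + u \<bullet> u = 1"
  shows "orthogonal_matrix (quat_rot (w, u))"
proof -
  have "(quat_rot (w, u) *v v) \<bullet> (quat_rot (w, u) *v v) = (w\<^sup>2 + u \<bullet> u)\<^sup>2 * (v \<bullet> v)" for v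
    unfolding quat_rot_mult
    by (simp add: inner_add_left inner_add_right dot_cross_self inner_cross3_self inner_commute[of v u]
        power2_eq_square algebra_simps)
  then have "norm (quat_rot (w, u) *v v) = norm v" for v
    by (simp add: norm_eq_sqrt_inner assms)
  then have "orthogonal_transformation ((*v) (quat_rot (w, u)))"
    by (simp add: orthogonal_transformation)
  then show ?thesis by (simp add: orthogonal_transformation_matrix)
qed

abbreviation quat_sphere :: "(real \<times> (real^3)) set" where
  "quat_sphere \<equiv> sphere 0 1"

lemma in_quat_sphere: "(w, u) \<in> quat_sphere \<longleftrightarrow> w\<^sup>2 + u \<bullet> u = 1"
  by (simp add: norm_eq_1 inner_prod_def power2_eq_square)

lemma rotation_quat_rot:
  assumes "q \<in> quat_sphere" shows "rotation_matrix (quat_rot q)"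
proof (rule rotation_matrix_connected[OF continuous_on_quat_rot, of quat_sphere "(1, 0)"])
  have "connected (sphere (0 :: real \<times> (real^3)) 1)"
    by (rule connected_sphere) simp
  then show "connected quat_sphere" .
  show "orthogonal_matrix (quat_rot q)" if "q \<in> quat_sphere" for q
    using that orthogonal_quat_rot by (cases q) (simp only: in_quat_sphere)
  have "quat_rot (1, 0) = mat 1" by (simp add: matrix_eq quat_rot_mult)
  then show "rotation_matrix (quat_rot (1, 0))"
    using mat_1_in_SO_sub[of UNIV] by (simp add: SO_sub_def)
qed (use assms in \<open>simp_all add: norm_Pair\<close>)

lemma quat_rot_uminus: "quat_rot (- q) = quat_rot q"
  by (cases q) (simp add: matrix_eq quat_rot_mult cross_minus_left)

lemma quat_rot_entry:
  "quat_rot (w, u) $ i $ j = (w\<^sup>2 - u \<bullet> u) * (if i = j then 1 else 0) + 2 * u $ i * u $ j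
     + 2 * w * cross3 u (axis j 1) $ i"
proof -
  have "quat_rot (w, u) $ i $ j = (quat_rot (w, u) *v axis j 1) $ i"
    by (simp add: matrix_vector_mult_basis column_def)
  moreover have "(axis j 1 :: real^3) $ i = (if i = j then 1 else 0)" by (simp add: axis_def)
  ultimately show ?thesis by (simp add: quat_rot_mult inner_axis)
qed

lemma quat_rot_entries:
  "quat_rot (w, u) $ 1 $ 1 = w\<^sup>2 - u \<bullet> u + 2 * u$1 * u$1"
  "quat_rot (w, u) $ 2 $ 2 = w\<^sup>2 - u \<bullet> u + 2 * u$2 * u$2"
  "quat_rot (w, u) $ 3 $ 3 = w\<^sup>2 - u \<bullet> u + 2 * u$3 * u$3"
  "quat_rot (w, u) $ 1 $ 2 = 2 * u$1 * u$2 - 2 * w * u$3" "quat_rot (w, u) $ 2 $ 1 = 2 * u$1 * u$2 + 2 * w * u$3"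
  "quat_rot (w, u) $ 1 $ 3 = 2 * u$1 * u$3 + 2 * w * u$2" "quat_rot (w, u) $ 3 $ 1 = 2 * u$1 * u$3 - 2 * w * u$2"
  "quat_rot (w, u) $ 2 $ 3 = 2 * u$2 * u$3 - 2 * w * u$1" "quat_rot (w, u) $ 3 $ 2 = 2 * u$2 * u$3 + 2 * w * u$1"
  by (simp_all add: quat_rot_entry cross3_def axis_def)

text \<open>The matrix determines all products of two coordinates of the unit quaternion. A nonzero
  coordinate is thus known up to sign, and its products with the others pass this sign on to
  them.\<close>

lemma quat_rot_eqD:
  assumes q: "w\<^sup>2 + u \<bullet> u = 1" "w'\<^sup>2 + u' \<bullet> u' = 1" and eq: "quat_rot (w, u) = quat_rot (w', u')"
  shows "(w', u') = (w, u) \<or> (w', u') = - (w, u)"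
proof -
  have ent: "quat_rot (w, u) $ i $ j = quat_rot (w', u') $ i $ j" for i j by (simp add: eq)
  have sq: "u \<bullet> u = u$1 * u$1 + u$2 * u$2 + u$3 * u$3" for u :: "real^3"
    by (simp add: inner_vec_def sum_3)
  note E = ent[of 1 1] ent[of 2 2] ent[of 3 3] ent[of 1 2] ent[of 2 1] ent[of 1 3] ent[of 3 1] ent[of 2 3] ent[of 3 2]
  note E = E[unfolded quat_rot_entries power2_eq_square]
  note q' = q[unfolded power2_eq_square]
  have ww: "w * w = w' * w'"
    using E(1,2,3) q' unfolding sq by linarith
  have wu: "w * u $ 1 = w' * u' $ 1" "w * u $ 2 = w' * u' $ 2" "w * u $ 3 = w' * u' $ 3"
    using E(4-9) by linarith+
  have mm: "u $ 1 * u $ 1 = u' $ 1 * u' $ 1" "u $ 2 * u $ 2 = u' $ 2 * u' $ 2" "u $ 3 * u $ 3 = u' $ 3 * u' $ 3"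
    using E(1-3) q' ww by linarith+
  have mn: "u $ 1 * u $ 2 = u' $ 1 * u' $ 2" "u $ 1 * u $ 3 = u' $ 1 * u' $ 3" "u $ 2 * u $ 3 = u' $ 2 * u' $ 3"
    using E(4-9) by linarith+
  note mm = mm mn
  have main: "\<exists>\<epsilon>::real. (\<epsilon> = 1 \<or> \<epsilon> = - 1) \<and> y = \<epsilon> * x"
    if "x * x = y * y" for x y :: real
    using that by (metis mult_1 mult_minus1 square_eq_iff)
  have cancel: "z' = \<epsilon> * z" if "x * z = x' * z'" "x' = \<epsilon> * x" "\<epsilon> = 1 \<or> \<epsilon> = - 1" "x \<noteq> 0" for x x' z z' \<epsilon> :: real
    using that by auto
  have "\<exists>\<epsilon>::real. (\<epsilon> = 1 \<or> \<epsilon> = - 1) \<and> w' = \<epsilon> * w \<and> u' $ 1 = \<epsilon> * u $ 1 \<and> u' $ 2 = \<epsilon> * u $ 2 \<and> u' $ 3 = \<epsilon> * u $ 3"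
  proof -
    consider "w \<noteq> 0" | "u $ 1 \<noteq> 0" | "u $ 2 \<noteq> 0" | "u $ 3 \<noteq> 0"
      using q(1) unfolding sq by force
    then show ?thesis
    proof cases
      case 1
      obtain \<epsilon> :: real where e: "\<epsilon> = 1 \<or> \<epsilon> = - 1" "w' = \<epsilon> * w" using main[OF ww] by blast
      note c = cancel[OF _ e(2,1) 1]
      show ?thesis using e c[OF wu(1)] c[OF wu(2)] c[OF wu(3)] by blast
    next
      case 2
      obtain \<epsilon> :: real where e: "\<epsilon> = 1 \<or> \<epsilon> = - 1" "u' $ 1 = \<epsilon> * u $ 1" using main[OF mm(1)] by blast
      note c = cancel[OF _ e(2,1) 2]
      show ?thesis using e c[of w w'] wu(1) c[OF mm(4)] c[OF mm(5)] by (auto simp: mult.commute)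
    next
      case 3
      obtain \<epsilon> :: real where e: "\<epsilon> = 1 \<or> \<epsilon> = - 1" "u' $ 2 = \<epsilon> * u $ 2" using main[OF mm(2)] by blast
      note c = cancel[OF _ e(2,1) 3]
      show ?thesis using e c[of w w'] wu(2) c[of "u $ 1" "u' $ 1"] mm(4) c[OF mm(6)] by (auto simp: mult.commute)
    next
      case 4
      obtain \<epsilon> :: real where e: "\<epsilon> = 1 \<or> \<epsilon> = - 1" "u' $ 3 = \<epsilon> * u $ 3" using main[OF mm(3)] by blast
      note c = cancel[OF _ e(2,1) 4]
      show ?thesis using e c[of w w'] wu(3) c[of "u $ 1" "u' $ 1"] mm(5) c[of "u $ 2" "u' $ 2"] mm(6)
        by (auto simp: mult.commute)
    qed
  qed
  then show ?thesis by (auto simp: vec_eq_iff forall_3)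
qed

lemma in_SO_sub_12:
  fixes A :: "real^3^3"
  assumes "rotation_matrix A" "A *v axis 3 1 = axis 3 1"
  shows "A \<in> SO_sub {1, 2}"
proof -
  have "j = 3" if "j \<notin> {1, 2}" for j :: 3 using exhaust_3[of j] that by auto
  then show ?thesis using assms unfolding SO_sub_def by blast
qed

text \<open>Rotation by \<theta> lifts to a quaternion at angle \<theta>/2: a full turn of the plane
  gets only halfway around the unit quaternions.\<close>

lemma plane_rot_quat:
  "plane_rot 1 2 \<theta> = quat_rot (cos (\<theta>/2), sin (\<theta>/2) *\<^sub>R axis 3 1)"
proof (rule SO_sub_pair_unique[of 1 2])
  let ?q = "(cos (\<theta>/2), sin (\<theta>/2) *\<^sub>R axis 3 1 :: real^3)"
  have n: "(cos (\<theta>/2))\<^sup>2 + (sin (\<theta>/2) *\<^sub>R axis 3 1 :: real^3) \<bullet> (sin (\<theta>/2) *\<^sub>R axis 3 1) = 1"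
    using sin_cos_squared_add[of "\<theta>/2"] by (simp add: inner_axis_axis power2_eq_square)
  show "(1::3) \<noteq> 2" by simp
  show "plane_rot (1::3) 2 \<theta> \<in> SO_sub {1, 2}" by (rule plane_rot_in_SO_sub) simp
  have "quat_rot ?q *v axis 3 1 = axis 3 1"
    using n by (simp add: quat_rot_mult inner_axis_axis cross_mult_left power2_eq_square add.commute
        flip: scaleR_left_distrib)
  moreover have "?q \<in> quat_sphere" unfolding in_quat_sphere by (rule n)
  ultimately show "quat_rot ?q \<in> SO_sub {1, 2}"
    by (intro in_SO_sub_12 rotation_quat_rot)
  have cross: "cross3 (axis 3 1) (axis 1 1) = axis 2 1"
    by (simp add: cross3_def vec_eq_iff forall_3 axis_def)
  have "cos \<theta> = (cos (\<theta>/2))\<^sup>2 - (sin (\<theta>/2))\<^sup>2" "sin \<theta> = 2 * sin (\<theta>/2) * cos (\<theta>/2)"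
    using cos_double[of "\<theta>/2"] sin_double[of "\<theta>/2"] by simp_all
  then show "plane_rot 1 2 \<theta> *v axis (1::3) 1 = quat_rot ?q *v axis 1 1"
    by (simp add: plane_rot_axis quat_rot_mult inner_axis_axis cross_mult_left cross power2_eq_square)
qed

text \<open>In odd dimension 1 is an eigenvalue: \<open>A - mat 1\<close> equals \<open>A\<close>
  times the transpose of \<open>mat 1 - A\<close>, so its determinant equals its own
  negative.\<close>

lemma rotation_matrix_has_axis:
  fixes A :: "real^3^3"
  assumes A: "rotation_matrix A"
  obtains u where "norm u = 1" "A *v u = u"
proof -
  have o: "A ** transpose A = mat 1" "det A = 1"
    using A by (simp_all add: rotation_matrix_def orthogonal_matrix_def)
  have "A - mat 1 = A ** transpose (mat 1 - A)"
    using o(1) by (simp add: transpose_def matrix_matrix_mult_def vec_eq_iff mat_def algebra_simps sum_subtractf sum_3 forall_3)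
  then have "det (A - mat 1) = det (mat 1 - A)"
    using o(2) by (metis det_mul det_transpose mult_1)
  also have "\<dots> = - det (A - mat 1)" by (simp add: det_3 mat_def algebra_simps)
  finally have "det (A - mat 1) = 0" by simp
  then have "\<not> invertible (A - mat 1)" by (simp add: invertible_det_nz)
  then obtain x where x: "(A - mat 1) *v x = 0" "x \<noteq> 0"
    by (metis invertible_left_inverse matrix_left_invertible_ker)
  have "A *v x = x" using x(1) by (simp add: matrix_vector_mult_diff_rdistrib)
  then have "A *v (x /\<^sub>R norm x) = x /\<^sub>R norm x"
    by (simp add: matrix_vector_mult_scaleR)
  moreover have "norm (x /\<^sub>R norm x) = 1" using x(2) by simp
  ultimately show ?thesis using that by blast
qed

text \<open>Conjugating by a rotation \<open>C\<close> that takes the third axis to the axis of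
  \<open>A\<close> leaves a rotation of the first two coordinates, whose quaternion is known. As
  \<open>C\<close> respects inner and cross products, moving the axis back moves the quaternion with
  it.\<close>

lemma quat_rot_surj:
  assumes A: "rotation_matrix A"
  obtains q where "q \<in> quat_sphere" "A = quat_rot q"
proof -
  obtain u where u: "norm u = 1" "A *v u = u" using rotation_matrix_has_axis[OF A] .
  obtain C where C: "rotation_matrix C" "C *v axis 3 1 = u"
    by (rule rotation_matrix_exists_basis[of u 3]) (use u in auto)
  have oC: "C ** transpose C = mat 1" "transpose C ** C = mat 1" "orthogonal_transformation ((*v) C)"
    using C(1) orthogonal_matrix_transformation by (auto simp: rotation_matrix_def orthogonal_matrix_def)
  define B where "B = transpose C ** (A ** C)"
  have CB: "A = C ** (B ** transpose C)"
    using oC by (simp add: B_def matrix_mul_assoc) (simp add: matrix_mul_assoc[symmetric] oC)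
  have "rotation_matrix B"
    using A C(1) by (simp add: B_def rotation_matrix_def orthogonal_matrix_mul det_mul)
  moreover have "B *v axis 3 1 = axis 3 1"
    using C(2) u(2) oC(2) unfolding B_def by (metis matrix_vector_mul_assoc matrix_vector_mul_lid)
  ultimately have B: "B \<in> SO_sub {1, 2}"
    by (rule in_SO_sub_12)
  obtain \<theta> where "B = plane_rot 1 2 (\<theta> (0::real))"
    by (rule SO_sub_pair_angle[of 1 2 "{0::real}" "\<lambda>_. B"]) (use B in auto)
  then have B': "B = quat_rot (cos (\<theta> 0/2), sin (\<theta> 0/2) *\<^sub>R axis 3 1)"
    by (simp add: plane_rot_quat)
  let ?w = "cos (\<theta> 0/2)" and ?s = "sin (\<theta> 0/2)"
  have "A = quat_rot (?w, ?s *\<^sub>R u)"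
  proof (subst matrix_eq, intro allI)
    fix x
    define y where "y = transpose C *v x"
    have x: "x = C *v y" unfolding y_def by (simp only: matrix_vector_mul_assoc oC matrix_vector_mul_lid)
    have "A *v x = C *v (B *v y)" unfolding CB y_def by (simp only: matrix_vector_mul_assoc)
    also have "\<dots> = quat_rot (?w, ?s *\<^sub>R u) *v (C *v y)"
      unfolding B' quat_rot_mult C(2)[symmetric]
      using oC(3) cross_rotation_matrix[OF C(1)]
      by (simp add: orthogonal_transformation_def matrix_vector_right_distrib matrix_vector_mult_scaleR cross_mult_left)
    finally show "A *v x = quat_rot (?w, ?s *\<^sub>R u) *v x" by (simp only: x)
  qed
  moreover have "(?w, ?s *\<^sub>R u) \<in> quat_sphere"
    unfolding in_quat_sphere using u(1) sin_cos_squared_add[of "\<theta> 0/2"]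
    by (simp add: norm_eq_1 power2_eq_square)
  ultimately show ?thesis using that by blast
qed

text \<open>The double cover of SO(3) by the 3-sphere, with the scalars 1 and -1 as deck
  transformations. It is injective on the open hemisphere around a point, and open because the
  complement of a saturated open set is compact and so has closed image.\<close>

interpretation quat: free_quotient "top_of_set quat_sphere" SO_top quat_rot "{1, -1::real}" scaleR
proof
  show cont: "continuous_map (top_of_set quat_sphere) SO_top quat_rot"
    using continuous_on_quat_rot rotation_quat_rot by (auto simp: continuous_map_in_subtopology)
  show surj: "quat_rot ` topspace (top_of_set quat_sphere) = topspace SO_top"
  proof (intro equalityI subsetI)
    show "A \<in> quat_rot ` topspace (top_of_set quat_sphere)" if "A \<in> topspace SO_top" for A
    proof -
      from that have "rotation_matrix A" by simp
      from quat_rot_surj[OF this] obtain q where "q \<in> quat_sphere" "A = quat_rot q" .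
      then show ?thesis by simp
    qed
  qed (use rotation_quat_rot in auto)
  show homeo: "homeomorphic_map (top_of_set quat_sphere) (top_of_set quat_sphere) ((*\<^sub>R) g)" if "g \<in> {1, -1}" for g
  proof -
    have "homeomorphic_maps (top_of_set quat_sphere) (top_of_set quat_sphere) ((*\<^sub>R) g) ((*\<^sub>R) g)"
      using that by (auto simp: homeomorphic_maps_def continuous_map_in_subtopology norm_Pair intro!: continuous_intros)
    then show ?thesis using homeomorphic_map_maps by blast
  qed
  show fibre: "quat_rot y = quat_rot y' \<longleftrightarrow> (\<exists>g\<in>{1, -1}. y' = g *\<^sub>R y)"
    if "y \<in> topspace (top_of_set quat_sphere)" "y' \<in> topspace (top_of_set quat_sphere)" for y y'
  proof
    obtain w u w' u' where y: "y = (w, u)" "y' = (w', u')" by fastforce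
    assume "quat_rot y = quat_rot y'"
    then have "y' = y \<or> y' = - y"
      using that quat_rot_eqD[of w u w' u'] unfolding topspace_euclidean_subtopology y in_quat_sphere by simp
    then show "\<exists>g\<in>{1, -1}. y' = g *\<^sub>R y" by auto
  next
    assume "\<exists>g\<in>{1, -1}. y' = g *\<^sub>R y"
    then have "y' = y \<or> y' = - y" by auto
    then show "quat_rot y = quat_rot y'" by (metis quat_rot_uminus)
  qed
  show "g *\<^sub>R z = z" if "g \<in> {1, -1}" "y \<in> topspace (top_of_set quat_sphere)" "g *\<^sub>R y = y" for g and y z :: "real \<times> (real^3)"
  proof -
    have "g \<noteq> - 1"
    proof
      assume "g = - 1"
      then have "- y = y" using that(3) by simp
      then have "y + y = 0" by (metis add.right_inverse)
      then have "2 *\<^sub>R y = 0" by (simp only: scaleR_2)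
      then show False using that(2) by simp
    qed
    then show ?thesis using that(1) by simp
  qed
  show "\<exists>U. openin (top_of_set quat_sphere) U \<and> y \<in> U \<and> inj_on quat_rot U"
    if "y \<in> topspace (top_of_set quat_sphere)" for y
  proof -
    let ?U = "quat_sphere \<inter> {z. y \<bullet> z > 0}"
    have "openin (top_of_set quat_sphere) ?U"
      by (intro openin_open_Int open_Collect_less continuous_intros)
    moreover have "y \<in> ?U" using that by (auto simp: norm_eq_1)
    moreover have "inj_on quat_rot ?U"
    proof (rule inj_onI)
      fix p q assume pq: "p \<in> ?U" "q \<in> ?U" "quat_rot p = quat_rot q"
      then have "\<exists>g\<in>{1, -1::real}. q = g *\<^sub>R p" using fibre[of p q] by simp
      then obtain g where "g \<in> {1, -1::real}" "q = g *\<^sub>R p" ..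
      with pq show "p = q" by auto
    qed
    ultimately show ?thesis by blast
  qed
  show "open_map (top_of_set quat_sphere) SO_top quat_rot"
    unfolding open_map_def
  proof (intro allI impI)
    fix U assume U: "openin (top_of_set quat_sphere) U"
    have sub: "U \<subseteq> quat_sphere" using openin_imp_subset[OF U] .
    have "openin (top_of_set quat_sphere) (uminus ` U)"
      using homeomorphic_imp_open_map[OF homeo[of "-1"]] U by (simp add: open_map_def)
    then have "openin (top_of_set quat_sphere) (U \<union> uminus ` U)" using U by (rule openin_Un[rotated])
    then have "closedin (top_of_set quat_sphere) (quat_sphere - (U \<union> uminus ` U))"
      by (simp add: closedin_diff)
    then have "compact (quat_sphere - (U \<union> uminus ` U))"
      by (rule closedin_compact[rotated]) simp
    then have "closed (quat_rot ` (quat_sphere - (U \<union> uminus ` U)))"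
      using continuous_on_quat_rot compact_continuous_image compact_imp_closed by blast
    moreover have "quat_rot ` U = {A. rotation_matrix A} - quat_rot ` (quat_sphere - (U \<union> uminus ` U))"
    proof (intro equalityI subsetI)
      fix A assume "A \<in> quat_rot ` U"
      then obtain y where y: "y \<in> U" "A = quat_rot y" by blast
      have "A \<noteq> quat_rot z" if z: "z \<in> quat_sphere" "z \<notin> U \<union> uminus ` U" for z
      proof
        assume "A = quat_rot z"
        then have "\<exists>g\<in>{1, -1::real}. z = g *\<^sub>R y"
          using fibre[of y z] y sub z(1) by auto
        then obtain g where "g \<in> {1, -1::real}" "z = g *\<^sub>R y" ..
        then show False using z(2) y(1) by auto
      qed
      then show "A \<in> {A. rotation_matrix A} - quat_rot ` (quat_sphere - (U \<union> uminus ` U))"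
        using y sub rotation_quat_rot by blast
    next
      fix A assume A: "A \<in> {A. rotation_matrix A} - quat_rot ` (quat_sphere - (U \<union> uminus ` U))"
      then obtain q where "q \<in> quat_sphere" "A = quat_rot q" using quat_rot_surj by blast
      with A have "q \<in> U \<or> q \<in> uminus ` U" by blast
      then show "A \<in> quat_rot ` U" using \<open>A = _\<close> quat_rot_uminus by (metis image_iff)
    qed
    ultimately show "openin SO_top (quat_rot ` U)"
      by (metis Diff_eq open_Compl openin_open_Int)
  qed
qed

text \<open>The full turn lifts to half a great circle, from the quaternion 1 to -1, and the
  constant loop to a constant path; homotopic loops would have lifts with the same end
  point.\<close>

lemma rot_loop_3_not_null:
  "\<not> path_hom SO_top (mat 1) (mat 1) (rot_loop (1::3) 2 1) (\<lambda>t. mat 1)"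
proof
  assume hom: "path_hom SO_top (mat 1) (mat 1) (rot_loop (1::3) 2 1) (\<lambda>t. mat 1)"
  let ?l = "\<lambda>t. (cos (pi * t), sin (pi * t) *\<^sub>R axis 3 1) :: real \<times> (real^3)"
  have one: "quat_rot (1, 0) = mat 1" by (simp add: matrix_eq quat_rot_mult)
  have "continuous_on {0..1} ?l" by (intro continuous_intros)
  moreover have "?l t \<in> quat_sphere" for t
    unfolding in_quat_sphere using sin_cos_squared_add[of "pi * t"] by (simp add: inner_axis_axis power2_eq_square)
  ultimately have "path_from (top_of_set quat_sphere) (1, 0) (- 1, 0) ?l"
    unfolding path_from_def pathin_def continuous_map_in_subtopology by auto
  moreover have "path_from (top_of_set quat_sphere) (1, 0) (1, 0) (\<lambda>t. (1, 0))"
    by (rule path_from_const) simp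
  moreover have "path_hom SO_top (quat_rot (1, 0)) (mat 1) (rot_loop (1::3) 2 1) (\<lambda>t. mat 1)"
    using hom one by simp
  ultimately have "(- 1, 0) = (1::real, 0::real^3)"
    by (rule quat.lift_path_hom(1)) (simp_all add: one rot_loop_def plane_rot_quat)
  then show False by simp
qed

section \<open>The full turn is not contractible\<close>

definition rot_contraction :: "'n::finite set \<Rightarrow> 'n \<Rightarrow> 'n \<Rightarrow> (real \<times> real \<Rightarrow> real^'n^'n) \<Rightarrow> bool" where
  "rot_contraction W a b h \<longleftrightarrow> continuous_on unit_square h \<and> (\<forall>z\<in>unit_square. h z \<in> SO_sub W) \<and>
     (\<forall>t\<in>{0..1}. h (0, t) = rot_loop a b 1 t \<and> h (1, t) = mat 1) \<and>
     (\<forall>s\<in>{0..1}. h (s, 0) = mat 1 \<and> h (s, 1) = mat 1)"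

text \<open>As the second homotopy group of the spheres of dimension at least three vanishes, a contraction
  can be compressed until only three coordinates are moved.\<close>

lemma rot_contraction_reduce:
  fixes a b :: "'n::finite"
  assumes ab: "a \<noteq> b" and "a \<in> W" "b \<in> W" "3 \<le> card W" "rot_contraction W a b h"
  shows "\<exists>W' h'. a \<in> W' \<and> b \<in> W' \<and> card W' = 3 \<and> rot_contraction W' a b h'"
  using assms(2-)
proof (induction "card W" arbitrary: W h rule: less_induct)
  case (less W)
  show ?case
  proof (cases "card W = 3")
    case True
    with less.prems show ?thesis by blast
  next
    case False
    have fin: "finite W" by simp
    have "\<not> W \<subseteq> {a, b}"
      using card_mono[of "{a, b}" W] less.prems(3) ab by auto
    then obtain i where i: "i \<in> W" "i \<noteq> a" "i \<noteq> b" by blast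
    \<comment> \<open>Four or more indices: the sphere has dimension at least 3, as the prism over a
      two-parameter family requires. At three indices the process stops.\<close>
    have card: "DIM(real \<times> real) + 1 < card W" using False less.prems(3) by simp
    have h: "continuous_on unit_square h" "\<And>z. z \<in> unit_square \<Longrightarrow> h z \<in> SO_sub W"
      "\<And>t. t \<in> {0..1} \<Longrightarrow> h (0, t) = rot_loop a b 1 t" "\<And>t. t \<in> {0..1} \<Longrightarrow> h (1, t) = mat 1"
      "\<And>s. s \<in> {0..1} \<Longrightarrow> h (s, 0) = mat 1" "\<And>s. s \<in> {0..1} \<Longrightarrow> h (s, 1) = mat 1"
      using less.prems(4) unfolding rot_contraction_def by blast+
    \<comment> \<open>The whole boundary of the square is held fixed, so that the result is again a
      contraction of the same loop.\<close>
    let ?B = "{0, 1} \<times> {0..1} \<union> {0..1} \<times> {0, 1 :: real} :: (real \<times> real) set"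
    have sq: "cbox (0, 0) (1, 1) = unit_square" by (simp add: cbox_Pair_eq)
    have sub: "SO_sub {a, b} \<subseteq> SO_sub (W - {i})" using less.prems i by (intro SO_sub_mono) auto
    have loop: "rot_loop a b 1 t \<in> SO_sub (W - {i})" for t
      using subsetD[OF sub plane_rot_in_SO_sub[OF ab]] by (simp add: rot_loop_def)
    have B: "h z \<in> SO_sub (W - {i})" if "z \<in> ?B" for z
      using that h(3-6) loop mat_1_in_SO_sub by fastforce
    have "\<exists>H. continuous_on ({0..1::real} \<times> cbox (0, 0) (1, 1)) H \<and>
      (\<forall>p\<in>{0..1} \<times> cbox (0, 0) (1, 1). H p \<in> SO_sub W) \<and>
      (\<forall>z\<in>cbox (0, 0) (1, 1). H (0, z) = h z \<and> H (1, z) \<in> SO_sub (W - {i})) \<and>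
      (\<forall>z\<in>?B. \<forall>s\<in>{0..1}. H (s, z) = h z)"
    proof (rule SO_sub_compress[OF _ _ _ _ B i(1) card])
      show "closed ?B" by (intro closed_Un closed_Times) auto
    qed (use h(1,2) in \<open>auto simp: sq\<close>)
    then obtain H where H: "continuous_on ({0..1::real} \<times> unit_square) H"
      "\<And>z. z \<in> unit_square \<Longrightarrow> H (1, z) \<in> SO_sub (W - {i})"
      "\<And>z. z \<in> ?B \<Longrightarrow> H (1, z) = h z"
      unfolding sq by auto
    have "continuous_on unit_square (\<lambda>z. H (1, z))"
      by (rule continuous_on_compose2[OF H(1)]) (auto intro!: continuous_intros)
    then have con: "rot_contraction (W - {i}) a b (\<lambda>z. H (1, z))"
      unfolding rot_contraction_def using H(2,3) h(3-6) by simp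
    have "card (W - {i}) < card W" using i(1) fin by (rule card_Diff1_less[rotated])
    moreover have "3 \<le> card (W - {i})" using False less.prems(3) i(1) by simp
    ultimately show ?thesis
      using less.hyps[OF _ _ _ _ con] less.prems(1,2) i by blast
  qed
qed

text \<open>A column with index in \<open>W\<close> vanishes outside the rows in \<open>W\<close>,
  so deleting the other rows and columns keeps the remaining columns orthonormal.\<close>

lemma restrict_SO_sub:
  fixes \<sigma> :: "'m::finite \<Rightarrow> 'n::finite" and A :: "real^'n^'n"
  assumes \<sigma>: "bij_betw \<sigma> UNIV W" and A: "A \<in> SO_sub W"
  shows "orthogonal_matrix ((\<chi> i j. A $ \<sigma> i $ \<sigma> j) :: real^'m^'m)"
proof -
  let ?M = "(\<chi> i j. A $ \<sigma> i $ \<sigma> j) :: real^'m^'m"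
  have inj: "\<sigma> i = \<sigma> j \<longleftrightarrow> i = j" for i j using \<sigma> by (auto simp: bij_betw_def inj_on_def)
  have zero: "A $ k $ \<sigma> i = 0" if "k \<notin> W" for k i
  proof -
    have "\<sigma> i \<in> W" using \<sigma> by (auto simp: bij_betw_def)
    then have "(A *v axis (\<sigma> i) 1) $ k = 0"
      using that by (intro SO_sub_component[OF A]) (auto simp: axis_def)
    then show ?thesis by (simp add: matrix_vector_mult_basis column_def)
  qed
  have "transpose A ** A = mat 1" using A by (simp add: SO_sub_def rotation_matrix_def orthogonal_matrix)
  then have *: "(\<Sum>k\<in>UNIV. A $ k $ i * A $ k $ j) = (if i = j then 1 else 0)" for i j
    by (simp add: vec_eq_iff matrix_matrix_mult_def transpose_def mat_def)
  have "(\<Sum>k\<in>UNIV. A $ \<sigma> k $ \<sigma> i * A $ \<sigma> k $ \<sigma> j) = (if i = j then 1 else 0)" for i j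
  proof -
    have "(\<Sum>k\<in>UNIV. A $ \<sigma> k $ \<sigma> i * A $ \<sigma> k $ \<sigma> j) = (\<Sum>k\<in>W. A $ k $ \<sigma> i * A $ k $ \<sigma> j)"
      by (rule sum.reindex_bij_betw[OF \<sigma>])
    also have "\<dots> = (\<Sum>k\<in>UNIV. A $ k $ \<sigma> i * A $ k $ \<sigma> j)"
      by (rule sum.mono_neutral_left) (auto simp: zero)
    finally show ?thesis by (simp add: * inj)
  qed
  then show ?thesis
    by (simp add: orthogonal_matrix vec_eq_iff matrix_matrix_mult_def transpose_def mat_def)
qed

text \<open>A contraction compressed to three coordinates becomes, after renumbering them by
  \<open>\<sigma>\<close>, a contraction of the full turn in SO(3).\<close>

lemma rot_loop_1_not_null:
  fixes a b :: "'n::finite"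
  assumes ab: "a \<noteq> b" and card: "3 \<le> CARD('n)"
  shows "\<not> path_hom SO_top (mat 1) (mat 1) (rot_loop a b 1) (\<lambda>t. mat 1)"
proof
  assume "path_hom SO_top (mat 1) (mat 1) (rot_loop a b 1) (\<lambda>t. mat 1)"
  then obtain h0 where h0: "continuous_map (top_of_set unit_square) SO_top h0"
    "\<forall>t\<in>{0..1}. h0 (0, t) = rot_loop a b 1 t \<and> h0 (1, t) = mat 1"
    "\<forall>s\<in>{0..1}. h0 (s, 0) = mat 1 \<and> h0 (s, 1) = mat 1"
    unfolding path_hom_iff by blast
  then have "rot_contraction UNIV a b h0"
    by (auto simp: rot_contraction_def continuous_map_in_subtopology SO_sub_UNIV)
  then obtain W h where W: "a \<in> W" "b \<in> W" "card W = 3" and h: "rot_contraction W a b h"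
    using rot_contraction_reduce[OF ab _ _ card] by blast
  obtain c where c: "c \<in> W" "c \<noteq> a" "c \<noteq> b"
  proof -
    have "\<not> W \<subseteq> {a, b}" using card_mono[of "{a, b}" W] W(3) ab by auto
    then show ?thesis using that by blast
  qed
  have Wabc: "W = {a, b, c}"
    using card_subset_eq[of W "{a, b, c}"] W c ab by auto
  define \<sigma> :: "3 \<Rightarrow> 'n" where "\<sigma> i = (if i = 1 then a else if i = 2 then b else c)" for i
  have \<sigma>: "\<sigma> 1 = a" "\<sigma> 2 = b" "\<sigma> 3 = c" by (simp_all add: \<sigma>_def)
  have bij: "bij_betw \<sigma> UNIV W"
    unfolding bij_betw_def inj_on_def Wabc UNIV_3 using \<sigma> ab c by auto
  have inj: "\<sigma> i = \<sigma> j \<longleftrightarrow> i = j" for i j using bij by (auto simp: bij_betw_def inj_on_def)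
  define M where "M A = ((\<chi> i j. A $ \<sigma> i $ \<sigma> j) :: real^3^3)" for A :: "real^'n^'n"
  have M1: "M (mat 1) = mat 1" by (simp add: M_def mat_def vec_eq_iff inj)
  have hW: "h z \<in> SO_sub W" if "z \<in> unit_square" for z
    using h that unfolding rot_contraction_def by blast
  have edge: "h (0, t) = rot_loop a b 1 t" "h (1, t) = mat 1" "h (t, 0) = mat 1" "h (t, 1) = mat 1" if "t \<in> {0..1}" for t
    using h that unfolding rot_contraction_def by blast+
  have cont: "continuous_on unit_square (\<lambda>z. M (h z))"
    using h unfolding rot_contraction_def M_def by (intro continuous_intros) auto
  have rot: "rotation_matrix (M (h z))" if "z \<in> unit_square" for z
  proof (rule rotation_matrix_connected[OF cont _ _ _ _ that])
    show "connected unit_square" by (intro connected_Times connected_Icc)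
    show "rotation_matrix (M (h (0, 0)))"
      using edge(3)[of 0] mat_1_in_SO_sub[of UNIV] by (simp add: M1 SO_sub_def)
    show "orthogonal_matrix (M (h x))" if "x \<in> unit_square" for x
      unfolding M_def by (rule restrict_SO_sub[OF bij hW[OF that]])
  qed simp
  have Mcol: "(M A *v axis j 1) $ i = (A *v axis (\<sigma> j) 1) $ \<sigma> i" for A i j
    by (simp add: M_def matrix_vector_mult_basis column_def)
  have loop: "M (h (0, t)) = rot_loop 1 2 1 t" if t: "t \<in> {0..1}" for t
  proof (rule SO_sub_pair_unique[of 1 2])
    let ?A = "plane_rot a b (2 * pi * t)"
    have A: "h (0, t) = ?A" using edge(1)[OF t] by (simp add: rot_loop_def)
    have "?A *v axis c 1 = axis c 1"
      using plane_rot_in_SO_sub[OF ab, of "2 * pi * t"] c by (simp add: SO_sub_def)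
    then have "M ?A *v axis 3 1 = axis 3 1"
      by (simp add: vec_eq_iff Mcol \<sigma>) (simp add: axis_def inj flip: \<sigma>(3))
    moreover have "rotation_matrix (M ?A)" using rot[of "(0, t)"] t by (simp add: A)
    ultimately show "M (h (0, t)) \<in> SO_sub {1, 2}" unfolding A by (intro in_SO_sub_12)
    show "rot_loop 1 2 1 t \<in> SO_sub {1::3, 2}" unfolding rot_loop_def by (rule plane_rot_in_SO_sub) simp
    have ax: "axis a 1 $ \<sigma> i = (axis 1 1 :: real^3) $ i" "axis b 1 $ \<sigma> i = (axis 2 1 :: real^3) $ i" for i
      using inj[of i 1] inj[of i 2] by (simp_all add: axis_def \<sigma>)
    show "M (h (0, t)) *v axis 1 1 = rot_loop 1 2 1 t *v axis (1::3) 1"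
      by (simp add: A vec_eq_iff Mcol \<sigma> rot_loop_def plane_rot_axis ab ax)
  qed simp
  have "continuous_map (top_of_set unit_square) SO_top (\<lambda>z. M (h z))"
    using cont rot by (auto simp: continuous_map_in_subtopology)
  then have "path_hom SO_top (mat 1) (mat 1) (rot_loop (1::3) 2 1) (\<lambda>t. mat 1)"
    by (rule path_homI) (simp_all add: loop edge(2-4) M1)
  then show False using rot_loop_3_not_null by blast
qed

lemma rot_loop_cancel:
  assumes ab: "a \<noteq> b" and "path_hom SO_top (mat 1) (mat 1) (rot_loop a b m) (rot_loop a b k)"
  shows "path_hom SO_top (mat 1) (mat 1) (rot_loop a b (m + l)) (rot_loop a b (k + l))"
proof -
  from path_hom_sym[OF rot_loop_join[OF ab, of m l]]
    path_hom_join[OF assms(2) path_hom_refl[OF path_from_rot_loop[OF ab, of l]]]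
  have "path_hom SO_top (mat 1) (mat 1) (rot_loop a b (m + l)) (join_loops (rot_loop a b k) (rot_loop a b l))"
    by (rule path_hom_trans)
  from this rot_loop_join[OF ab, of k l] show ?thesis by (rule path_hom_trans)
qed

lemma rot_loop_eq_iff_3:
  fixes a b :: "'n::finite"
  assumes ab: "a \<noteq> b" and card: "3 \<le> CARD('n)"
  shows "path_hom SO_top (mat 1) (mat 1) (rot_loop a b m) (rot_loop a b k) \<longleftrightarrow> even (m - k)"
proof -
  have "\<not> (UNIV :: 'n set) \<subseteq> {a, b}" using card_mono[of "{a, b}" UNIV] card ab by auto
  then obtain c where c: "c \<noteq> a" "c \<noteq> b" by blast
  have two: "path_hom SO_top (mat 1) (mat 1) (rot_loop a b (2 + l)) (rot_loop a b l)" for l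
    using rot_loop_cancel[OF ab, of 2 0 l] rot_loop_2_null[OF ab c] by (simp add: rot_loop_0)
  have even: "path_hom SO_top (mat 1) (mat 1) (rot_loop a b (2 * j + l)) (rot_loop a b l)" for j l
  proof (induction j rule: int_induct[of _ 0])
    case base
    show ?case using path_hom_refl[OF path_from_rot_loop[OF ab]] by simp
  next
    case (step1 j)
    have "path_hom SO_top (mat 1) (mat 1) (rot_loop a b (2 * (j + 1) + l)) (rot_loop a b (2 * j + l))"
      using two[of "2 * j + l"] by (simp add: algebra_simps)
    from path_hom_trans[OF this step1(2)] show ?case .
  next
    case (step2 j)
    have "path_hom SO_top (mat 1) (mat 1) (rot_loop a b (2 * (j - 1) + l)) (rot_loop a b (2 * j + l))"
      using path_hom_sym[OF two[of "2 * (j - 1) + l"]] by (simp add: algebra_simps)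
    from path_hom_trans[OF this step2(2)] show ?case .
  qed
  show ?thesis
  proof
    assume "even (m - k)"
    then obtain j where "m - k = 2 * j" by (rule evenE)
    then have "m = 2 * j + k" by simp
    then show "path_hom SO_top (mat 1) (mat 1) (rot_loop a b m) (rot_loop a b k)"
      using even[of j k] by simp
  next
    assume mk: "path_hom SO_top (mat 1) (mat 1) (rot_loop a b m) (rot_loop a b k)"
    show "even (m - k)"
    proof (rule ccontr)
      assume "odd (m - k)"
      then obtain j where j: "m - k = 2 * j + 1" by (rule oddE)
      \<comment> \<open>Cancelling \<open>k\<close> leaves an odd number of turns contractible, and
        removing pairs of turns leaves a single one.\<close>
      have "path_hom SO_top (mat 1) (mat 1) (rot_loop a b (2 * j + 1)) (rot_loop a b 0)"
        using rot_loop_cancel[OF ab mk, of "- k"] j by simp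
      from path_hom_trans[OF path_hom_sym[OF even[of j 1]] this]
      show False using rot_loop_1_not_null[OF ab card] by (simp add: rot_loop_0)
    qed
  qed
qed

section \<open>Patches and the point group\<close>

declare transpose_matrix_vector [simp del]

section \<open>Motions acting on tilings and patches\<close>

lemma moved_comp: "moved f (moved g P) = moved (f \<circ> g) P"
  by (force simp: moved_def image_image image_comp)

lemma moved_ident: "moved (\<lambda>x. x) P = P"
  by (force simp: moved_def)

lemma moved_mono: "P \<subseteq> Q \<Longrightarrow> moved f P \<subseteq> moved f Q"
  unfolding moved_def by (rule image_mono)

lemma finite_moved: "finite P \<Longrightarrow> finite (moved f P)"
  by (simp add: moved_def)

lemma translated_0: "translated 0 P = P"
  by (simp add: moved_ident)

lemma translated_translated: "translated u (translated v P) = translated (u + v) P"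
  by (simp add: moved_comp o_def add.assoc)

lemma rotated_rotated: "rotated A (rotated B P) = rotated (A ** B) P"
  by (simp add: moved_comp o_def matrix_vector_mul_assoc)

lemma rotated_1: "rotated (mat 1) P = P"
  by (simp add: moved_ident)

lemma rotated_translated: "rotated A (translated v P) = translated (A *v v) (rotated A P)"
  by (simp add: moved_comp o_def matrix_vector_right_distrib)

lemma rotation_transpose:
  fixes A :: "real^'n^'n"
  assumes "rotation_matrix A"
  shows "rotation_matrix (transpose A)" "A ** transpose A = mat 1" "transpose A ** A = mat 1"
  using assms by (auto simp: rotation_matrix_def orthogonal_matrix_def det_transpose)

lemma rotation_mult: "rotation_matrix A \<Longrightarrow> rotation_matrix B \<Longrightarrow> rotation_matrix (A ** B)"
  for A B :: "real^'n^'n"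
  by (simp add: rotation_matrix_def orthogonal_matrix_mul det_mul)

lemma norm_rotation: "rotation_matrix A \<Longrightarrow> norm (A *v x) = norm x" for A :: "real^'n^'n"
  using norm_SO_sub[of A UNIV] by (simp add: SO_sub_UNIV)

lemma rotated_inverse:
  fixes A :: "real^'n^'n"
  assumes "rotation_matrix A"
  shows "rotated A (rotated (transpose A) P) = P" "rotated (transpose A) (rotated A P) = P"
  using rotation_transpose[OF assms] by (simp_all only: rotated_rotated rotated_1)

lemma patch_subset: "patch r x T \<subseteq> T"
  by (auto simp: patch_def)

lemma patch_cong:
  assumes "patch r x T = patch r x T'" "cball y s \<subseteq> cball x r"
  shows "patch s y T = patch s y T'"
proof -
  have *: "patch s y R = {t \<in> patch r x R. fst t \<inter> cball y s \<noteq> {}}" for R :: "('a, 'b) tiling"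
    using assms(2) unfolding patch_def by blast
  show ?thesis unfolding *[of T] *[of T'] assms(1) ..
qed

lemma patch_mono: "s \<le> r \<Longrightarrow> patch s x T \<subseteq> patch r x T"
  using subset_cball[of s r x] unfolding patch_def by blast

lemma moved_filter: "{t \<in> moved f T. Q (fst t)} = moved f {t \<in> T. Q (f ` fst t)}"
  by (auto simp: moved_def image_iff split: prod.splits)

lemma patch_translated: "patch r x (translated v T) = translated v (patch r (x - v) T)"
proof -
  have "(+) v ` S \<inter> cball x r \<noteq> {} \<longleftrightarrow> S \<inter> cball (x - v) r \<noteq> {}" for S
  proof -
    have "v + s \<in> cball x r \<longleftrightarrow> s \<in> cball (x - v) r" for s
      by (simp add: dist_norm algebra_simps)
    then show ?thesis by blast
  qed
  then show ?thesis
    by (simp only: patch_def moved_filter[where Q = "\<lambda>S. S \<inter> cball x r \<noteq> {}"])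
qed

lemma patch_rotated:
  assumes "rotation_matrix A"
  shows "patch r (A *v x) (rotated A T) = rotated A (patch r x T)"
proof -
  have "(*v) A ` S \<inter> cball (A *v x) r \<noteq> {} \<longleftrightarrow> S \<inter> cball x r \<noteq> {}" for S
  proof -
    have "A *v s \<in> cball (A *v x) r \<longleftrightarrow> s \<in> cball x r" for s
      using norm_rotation[OF assms, of "x - s"] by (simp add: dist_norm matrix_vector_mult_diff_distrib)
    then show ?thesis by blast
  qed
  then show ?thesis
    by (simp only: patch_def moved_filter[where Q = "\<lambda>S. S \<inter> cball (A *v x) r \<noteq> {}"])
qed

lemma patch_rotated_0: "rotation_matrix A \<Longrightarrow> patch r 0 (rotated A T) = rotated A (patch r 0 T)"
  using patch_rotated[of A r 0 T] by simp

section \<open>Regularity of tiles and finiteness of patches\<close>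

lemma polyhedral_body_props:
  fixes S :: "'a::euclidean_space set"
  assumes "polyhedral_body S"
  shows "compact S" "interior S \<noteq> {}" "S \<subseteq> closure (interior S)"
proof -
  obtain F where F: "finite F" "\<And>p. p \<in> F \<Longrightarrow> polytope p \<and> aff_dim p = int DIM('a)" "S = \<Union>F"
    using assms unfolding polyhedral_body_def by blast
  show "compact S" using F polytope_imp_compact by (auto intro: compact_Union)
  have p: "p \<subseteq> closure (interior p)" "interior p \<noteq> {}" if "p \<in> F" for p
  proof -
    have c: "convex p" "aff_dim p = int DIM('a)" using F(2)[OF that] polytope_imp_convex by auto
    have "p \<noteq> {}" using c(2) by auto
    then show i: "interior p \<noteq> {}" using c rel_interior_eq_empty[OF c(1)] by (simp add: interior_rel_interior_gen)
    show "p \<subseteq> closure (interior p)" using convex_closure_interior[OF c(1) i] closure_subset by blast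
  qed
  have "closure (interior p) \<subseteq> closure (interior S)" if "p \<in> F" for p
    using that F(3) by (intro closure_mono interior_mono) auto
  then show sub: "S \<subseteq> closure (interior S)" using p(1) F(3) by blast
  have "S \<noteq> {}" using assms by (simp add: polyhedral_body_def)
  with sub show "interior S \<noteq> {}" by auto
qed

lemma tilingD:
  assumes "tiling T"
  shows "t \<in> T \<Longrightarrow> polyhedral_body (fst t)" and "(\<Union>t\<in>T. fst t) = UNIV"
    and "t \<in> T \<Longrightarrow> t' \<in> T \<Longrightarrow> t \<noteq> t' \<Longrightarrow> fst t \<inter> fst t' \<subseteq> frontier (fst t) \<inter> frontier (fst t')"
    and "t \<in> T \<Longrightarrow> t' \<in> T \<Longrightarrow> t \<noteq> t' \<Longrightarrow> meet_face_to_face (fst t) (fst t')"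
    and "\<exists>\<P>. finite \<P> \<and> (\<forall>t\<in>T. \<exists>p\<in>\<P>. \<exists>v. {t} = translated v {p})"
    and "finite_local_complexity T"
  using assms unfolding tiling_def by (elim conjE; simp)+

lemma tiling_tile:
  assumes "tiling T" "t \<in> T"
  shows "compact (fst t)" "interior (fst t) \<noteq> {}" "fst t \<subseteq> closure (interior (fst t))"
  using polyhedral_body_props[OF tilingD(1)[OF assms]] by simp_all

lemma tiling_interior_disjoint:
  assumes "tiling T" "t \<in> T" "t' \<in> T" "t \<noteq> t'"
  shows "interior (fst t) \<inter> fst t' = {}"
proof -
  have "fst t \<inter> fst t' \<subseteq> frontier (fst t)" using tilingD(3)[OF assms] by simp
  then show ?thesis using interior_subset[of "fst t"] unfolding frontier_def by blast
qed

lemma tiling_cover: "tiling T \<Longrightarrow> \<exists>t\<in>T. x \<in> fst t"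
  using tilingD(2)[of T] by blast

lemma tiling_uniform:
  fixes T :: "('a::euclidean_space, 'l) tiling"
  assumes T: "tiling T"
  obtains \<rho> D c where "\<rho> > 0" "\<And>t. t \<in> T \<Longrightarrow> ball (c t) \<rho> \<subseteq> fst t" "\<And>t. t \<in> T \<Longrightarrow> fst t \<subseteq> cball (c t) D"
proof -
  obtain \<P> where \<P>: "finite \<P>" "\<forall>t\<in>T. \<exists>p\<in>\<P>. \<exists>v. {t} = translated v {p}"
    using tilingD(5)[OF T] by blast
  \<comment> \<open>Prototiles that represent no tile are discarded: nothing is known of their
    shape, so they have no inner and outer radius to contribute.\<close>
  define \<Q> where "\<Q> = {p \<in> \<P>. \<exists>t\<in>T. \<exists>v. {t} = translated v {p}}"
  have fin: "finite \<Q>" using \<P>(1) by (simp add: \<Q>_def)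
  have shift: "fst t = (+) v ` fst p" if "{t} = translated v {p}" for t p :: "('a, 'l) tile" and v
    using that by (auto simp: moved_def split: prod.splits)
  have "\<exists>c \<rho> D. \<rho> > 0 \<and> ball c \<rho> \<subseteq> fst p \<and> fst p \<subseteq> cball c D" if "p \<in> \<Q>" for p
  proof -
    obtain t v where t: "t \<in> T" "{t} = translated v {p}" using \<open>p \<in> \<Q>\<close> unfolding \<Q>_def by blast
    note t = t(1) shift[OF t(2)]
    obtain z where "z \<in> interior (fst t)" using tiling_tile(2)[OF T t(1)] by blast
    then obtain \<rho> where \<rho>: "\<rho> > 0" "ball z \<rho> \<subseteq> fst t" using mem_interior by blast
    obtain D where D: "fst t \<subseteq> cball z D"
      using compact_imp_bounded[OF tiling_tile(1)[OF T t(1)]] unfolding bounded_any_center[where a=z]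
      by (auto simp: subset_iff)
    have p: "x \<in> fst p \<longleftrightarrow> v + x \<in> fst t" for x unfolding t(2) by auto
    have "ball (z - v) \<rho> \<subseteq> fst p" "fst p \<subseteq> cball (z - v) D"
      using \<rho>(2) D p by (auto simp: dist_norm algebra_simps subset_iff)
    with \<rho>(1) show ?thesis by blast
  qed
  then obtain c \<rho> D where pD: "\<And>p. p \<in> \<Q> \<Longrightarrow> \<rho> p > 0 \<and> ball (c p) (\<rho> p) \<subseteq> fst p \<and> fst p \<subseteq> cball (c p) (D p)"
    by metis
  define \<rho>' where "\<rho>' = Min (insert 1 (\<rho> ` \<Q>))"
  define D' where "D' = Max (insert 1 (D ` \<Q>))"
  have "\<rho>' > 0" using fin pD by (simp add: \<rho>'_def)
  have le: "\<rho>' \<le> \<rho> p" "D p \<le> D'" if "p \<in> \<Q>" for p using fin that by (auto simp: \<rho>'_def D'_def)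
  have "\<exists>z. ball z \<rho>' \<subseteq> fst t \<and> fst t \<subseteq> cball z D'" if "t \<in> T" for t
  proof -
    obtain p v where p: "p \<in> \<P>" "{t} = translated v {p}" using \<P>(2) \<open>t \<in> T\<close> by blast
    then have "p \<in> \<Q>" using \<open>t \<in> T\<close> unfolding \<Q>_def by blast
    note p = this shift[OF p(2)]
    have "ball (c p) \<rho>' \<subseteq> fst p" "fst p \<subseteq> cball (c p) D'"
      using pD[OF p(1)] le[OF p(1)] subset_ball[of \<rho>' "\<rho> p"] subset_cball[of "D p" D'] by blast+
    then have "(+) v ` ball (c p) \<rho>' \<subseteq> fst t" "fst t \<subseteq> (+) v ` cball (c p) D'" unfolding p(2) by blast+
    then have "ball (v + c p) \<rho>' \<subseteq> fst t" "fst t \<subseteq> cball (v + c p) D'"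
      by (simp_all only: ball_translation cball_translation)
    then show ?thesis by blast
  qed
  then obtain z where "\<And>t. t \<in> T \<Longrightarrow> ball (z t) \<rho>' \<subseteq> fst t \<and> fst t \<subseteq> cball (z t) D'" by metis
  with \<open>\<rho>' > 0\<close> show ?thesis using that by blast
qed

lemma finite_if_separated:
  fixes S :: "'a::heine_borel set"
  assumes "\<rho> > 0" and sep: "\<And>y z. y \<in> S \<Longrightarrow> z \<in> S \<Longrightarrow> dist y z < \<rho> \<Longrightarrow> y = z" and "bounded S"
  shows "finite S"
proof (rule ccontr)
  assume "infinite S"
  then obtain x where x: "x islimpt S"
    using bounded_infinite_imp_islimpt[OF order_refl assms(3)] by blast
  then obtain y where y: "y \<in> S" "y \<noteq> x" "dist y x < \<rho> / 2"
    unfolding islimpt_approachable using assms(1) by (meson half_gt_zero)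
  then obtain z where z: "z \<in> S" "z \<noteq> x" "dist z x < min (\<rho> / 2) (dist y x)"
    using x assms(1) unfolding islimpt_approachable by (metis half_gt_zero min_less_iff_conj zero_less_dist_iff)
  have "dist y z < \<rho>" using dist_triangle_half_r[of x y \<rho> z] y(3) z(3) by (simp add: dist_commute)
  then have "y = z" using sep y(1) z(1) by blast
  then show False using z(3) by simp
qed

text \<open>Every tile contains a ball of one fixed radius and meets no interior of another tile, so
  the centres are separated; those of a patch are also bounded.\<close>

lemma finite_patch:
  fixes T :: "('a::euclidean_space, 'l) tiling"
  assumes T: "tiling T" shows "finite (patch r x T)"
proof -
  obtain \<rho> D c where \<rho>: "\<rho> > 0" and c: "\<And>t. t \<in> T \<Longrightarrow> ball (c t) \<rho> \<subseteq> fst t"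
    and D: "\<And>t. t \<in> T \<Longrightarrow> fst t \<subseteq> cball (c t) D" using tiling_uniform[OF T] by metis
  have sep: "t = t'" if t: "t \<in> T" "t' \<in> T" "dist (c t) (c t') < \<rho>" for t t'
  proof (rule ccontr)
    assume "t \<noteq> t'"
    have "c t' \<in> ball (c t) \<rho>" using t(3) by simp
    moreover have "ball (c t) \<rho> \<subseteq> interior (fst t)" using c[OF t(1)] by (simp add: interior_maximal)
    moreover have "c t' \<in> fst t'" using c[OF t(2)] \<rho> by auto
    ultimately show False using tiling_interior_disjoint[OF T t(1,2) \<open>t \<noteq> t'\<close>] by blast
  qed
  have "finite (c ` patch r x T)"
  proof (rule finite_if_separated[OF \<rho>])
    show "y = z" if "y \<in> c ` patch r x T" "z \<in> c ` patch r x T" "dist y z < \<rho>" for y z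
      using sep that unfolding patch_def by blast
    have "c t \<in> cball x (r + D)" if t: "t \<in> patch r x T" for t
    proof -
      obtain y where y: "y \<in> fst t" "y \<in> cball x r" using t unfolding patch_def by blast
      have "t \<in> T" using t patch_subset by blast
      then have "dist (c t) y \<le> D" using D[of t] y(1) by auto
      with y(2) show ?thesis using dist_triangle[of x "c t" y] by (simp add: dist_commute)
    qed
    then show "bounded (c ` patch r x T)" by (meson bounded_cball bounded_subset image_subsetI)
  qed
  moreover have "inj_on c (patch r x T)"
    using sep \<rho> unfolding patch_def inj_on_def by (metis (no_types, lifting) dist_self mem_Collect_eq)
  ultimately show ?thesis by (rule finite_imageD)
qed

text \<open>A patch around a ball covers a neighbourhood of the ball, so no further tile can meet it.\<close>

lemma patch_transfer:
  fixes S T :: "('a::euclidean_space, 'l) tiling"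
  assumes S: "tiling S" and T: "tiling T" and sub: "translated w (patch r x S) \<subseteq> T"
  shows "patch r (w + x) T = translated w (patch r x S)"
proof
  show "translated w (patch r x S) \<subseteq> patch r (w + x) T"
  proof
    fix t assume t: "t \<in> translated w (patch r x S)"
    then have "t \<in> translated w (patch r ((w + x) - w) S)" by simp
    then have "t \<in> patch r (w + x) (translated w S)" by (simp only: patch_translated)
    with t sub show "t \<in> patch r (w + x) T" unfolding patch_def by blast
  qed
  show "patch r (w + x) T \<subseteq> translated w (patch r x S)"
  proof
    fix t assume "t \<in> patch r (w + x) T"
    then obtain y where t: "t \<in> T" and y: "y \<in> fst t" "y \<in> cball (w + x) r" unfolding patch_def by blast
    define x' where "x' = y - w"
    have x': "x' \<in> cball x r" using y(2) by (simp add: x'_def dist_norm algebra_simps)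
    \<comment> \<open>The tiles near \<open>x'\<close> that miss \<open>x'\<close>. They are
      finitely many and closed, so a small ball around \<open>x'\<close> avoids them and is covered
      by tiles through \<open>x'\<close>, which belong to the patch.\<close>
    define N where "N = {s \<in> patch 1 x' S. x' \<notin> fst s}"
    have "finite N" using finite_patch[OF S] by (simp add: N_def)
    moreover have "closed (fst s)" if "s \<in> N" for s
      using that tiling_tile(1)[OF S] compact_imp_closed unfolding N_def patch_def by blast
    ultimately have "closed (\<Union>(fst ` N))" by (intro closed_Union) auto
    then have "open (- \<Union>(fst ` N) \<inter> ball x' 1)" by (intro open_Int open_Compl open_ball)
    moreover have "x' \<in> - \<Union>(fst ` N) \<inter> ball x' 1" by (auto simp: N_def)
    ultimately obtain \<epsilon> where \<epsilon>: "\<epsilon> > 0" "ball x' \<epsilon> \<subseteq> - \<Union>(fst ` N) \<inter> ball x' 1"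
      using open_contains_ball by metis
    have cov: "\<exists>s\<in>patch r x S. z \<in> fst s" if z: "z \<in> ball x' \<epsilon>" for z
    proof -
      obtain s where s: "s \<in> S" "z \<in> fst s" using tiling_cover[OF S] by blast
      have "z \<in> cball x' 1" using z \<epsilon>(2) by (meson IntD2 ball_subset_cball subsetD)
      then have "s \<in> patch 1 x' S" using s unfolding patch_def by blast
      moreover have "s \<notin> N" using z \<epsilon>(2) s(2) by blast
      ultimately have "x' \<in> fst s" by (simp add: N_def)
      then show ?thesis using s x' unfolding patch_def by blast
    qed
    \<comment> \<open>\<open>t\<close> has interior points arbitrarily near \<open>y\<close>. Such a
      point also lies in a translated tile of the patch, and a tile meeting the interior of another
      is equal to it.\<close>
    have "y \<in> closure (interior (fst t))" using y(1) tiling_tile(3)[OF T t] by blast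
    then obtain z where z: "z \<in> interior (fst t)" "dist z y < \<epsilon>"
      using \<epsilon>(1) closure_approachable by blast
    have "z - w \<in> ball x' \<epsilon>" using z(2) by (simp add: x'_def dist_norm norm_minus_commute)
    then obtain s where s: "s \<in> patch r x S" "z - w \<in> fst s" using cov by blast
    define s' where "s' = ((+) w ` fst s, snd s)"
    have s': "s' \<in> translated w (patch r x S)"
      using s(1) by (force simp: s'_def moved_def)
    have "z \<in> fst s'" using s(2) by (force simp: s'_def)
    then have "t = s'"
      using tiling_interior_disjoint[OF T t, of s'] s' sub z(1) by blast
    with s' show "t \<in> translated w (patch r x S)" by simp
  qed
qed

section \<open>Rotations preserve tilings\<close>

lemma same_germ_image:
  fixes f :: "'a::euclidean_space \<Rightarrow> 'a"
  assumes f: "orthogonal_transformation f"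
  shows "same_germ (f ` S) (f x) (f y) \<longleftrightarrow> same_germ S x y"
proof -
  have lin: "linear f" and inj: "inj f" and surj: "surj f" and n: "norm (f v) = norm v" for v
    using f orthogonal_transformation_linear orthogonal_transformation_inj orthogonal_transformation_surj
      orthogonal_transformation_norm by blast+
  have mem: "f x + f v \<in> f ` S \<longleftrightarrow> x + v \<in> S" for x v
    using inj by (simp add: linear_add[OF lin, symmetric] inj_image_mem_iff)
  have "(\<forall>v. norm v < \<epsilon> \<longrightarrow> (f x + v \<in> f ` S \<longleftrightarrow> f y + v \<in> f ` S)) \<longleftrightarrow>
      (\<forall>v. norm v < \<epsilon> \<longrightarrow> (x + v \<in> S \<longleftrightarrow> y + v \<in> S))" for \<epsilon>
    using surj n mem by (metis surjD)
  then show ?thesis by (simp add: same_germ_def)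
qed

lemma faces_image:
  fixes f :: "'a::euclidean_space \<Rightarrow> 'a"
  assumes f: "orthogonal_transformation f"
  shows "faces (f ` S) = (`) f ` faces S"
proof -
  have lin: "linear f" and inj: "inj f" and surj: "surj f"
    using f orthogonal_transformation_linear orthogonal_transformation_inj orthogonal_transformation_surj by blast+
  obtain g where g: "linear g" "g \<circ> f = id" using linear_injective_left_inverse[OF lin inj] by blast
  have comp: "connected_component_set (f ` X) (f x) = f ` connected_component_set X x" for X x
  proof (intro equalityI subsetI)
    fix y assume "y \<in> connected_component_set (f ` X) (f x)"
    then obtain t where t: "connected t" "t \<subseteq> f ` X" "f x \<in> t" "y \<in> t" by (auto simp: connected_component_def)
    have gf: "g (f z) = z" for z using g(2) by (metis comp_apply id_apply)
    have "connected (g ` t)" using t(1) g(1) by (rule connected_linear_image[rotated])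
    moreover have "g ` t \<subseteq> X" using t(2) by (auto simp: gf)
    moreover have "x \<in> g ` t" using t(3) gf[of x] by (metis imageI)
    moreover have "g y \<in> g ` t" using t(4) by (rule imageI)
    moreover have "y = f (g y)" using t(2,4) by (auto simp: gf)
    ultimately have "g y \<in> connected_component_set X x" by (auto simp: connected_component_def)
    with \<open>y = f (g y)\<close> show "y \<in> f ` connected_component_set X x" by blast
  next
    fix y assume "y \<in> f ` connected_component_set X x"
    then obtain z t where t: "connected t" "t \<subseteq> X" "x \<in> t" "z \<in> t" "y = f z" by (auto simp: connected_component_def)
    have "connected (f ` t)" using t(1) lin by (rule connected_linear_image[rotated])
    then show "y \<in> connected_component_set (f ` X) (f x)"
      using t by (auto simp: connected_component_def intro!: exI[of _ "f ` t"])
  qed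
  have set: "{y \<in> f ` S. same_germ (f ` S) (f x) y} = f ` {y \<in> S. same_germ S x y}" for x
    using same_germ_image[OF f] by auto
  have face: "closure (connected_component_set {y \<in> f ` S. same_germ (f ` S) (f x) y} (f x)) =
      f ` closure (connected_component_set {y \<in> S. same_germ S x y} x)" for x
    unfolding set comp by (rule closure_injective_linear_image[OF lin inj, symmetric])
  have "faces X = (\<lambda>x. closure (connected_component_set {y \<in> X. same_germ X x y} x)) ` X" for X :: "'a set"
    unfolding faces_def by blast
  then show ?thesis by (simp add: image_image face)
qed

lemma meet_face_to_face_image:
  fixes f :: "'a::euclidean_space \<Rightarrow> 'a"
  assumes f: "orthogonal_transformation f" and "meet_face_to_face S S'"
  shows "meet_face_to_face (f ` S) (f ` S')"
proof -
  obtain F where F: "F \<subseteq> faces S \<inter> faces S'" "S \<inter> S' = \<Union>F"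
    using assms(2) unfolding meet_face_to_face_def by blast
  have "f ` S \<inter> f ` S' = \<Union>((`) f ` F)"
    using image_Int[OF orthogonal_transformation_inj[OF f], of S S'] F(2) by (simp add: image_Union)
  moreover have "(`) f ` F \<subseteq> faces (f ` S) \<inter> faces (f ` S')"
    unfolding faces_image[OF f] using F(1) by blast
  ultimately show ?thesis unfolding meet_face_to_face_def by blast
qed

lemma polyhedral_body_image:
  fixes f :: "'a::euclidean_space \<Rightarrow> 'a"
  assumes f: "orthogonal_transformation f" and "polyhedral_body S"
  shows "polyhedral_body (f ` S)"
proof -
  have lin: "linear f" and inj: "inj f"
    using f orthogonal_transformation_linear orthogonal_transformation_inj by blast+
  obtain F where F: "finite F" "\<forall>p\<in>F. polytope p \<and> aff_dim p = int DIM('a)" "S = \<Union>F" "S \<noteq> {}"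
    using assms(2) unfolding polyhedral_body_def by blast
  have "f ` S = \<Union>((`) f ` F)" using F(3) by blast
  then show ?thesis
    unfolding polyhedral_body_def using F lin inj
    by (intro conjI exI[of _ "(`) f ` F"]) (auto simp: polytope_linear_image aff_dim_injective_linear_image)
qed

lemma tiling_rotated:
  fixes T :: "(real^'n, 'l) tiling"
  assumes A: "rotation_matrix A" and T: "tiling T"
  shows "tiling (rotated A T)"
proof -
  let ?f = "\<lambda>x. A *v x"
  have f: "orthogonal_transformation ?f"
    using A by (simp add: rotation_matrix_def orthogonal_matrix_transformation)
  have lin: "linear ?f" and inj: "inj ?f" and surj: "surj ?f"
    using f orthogonal_transformation_linear orthogonal_transformation_inj orthogonal_transformation_surj by blast+
  have front: "frontier (?f ` S) = ?f ` frontier S" for S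
    unfolding frontier_def closure_injective_linear_image[OF lin inj, symmetric]
      interior_injective_linear_image[OF lin inj] using image_set_diff[OF inj] by blast
  have mem: "t \<in> rotated A T \<longleftrightarrow> (\<exists>s\<in>T. t = (?f ` fst s, snd s))" for t
    by (force simp: moved_def)
  show ?thesis
    unfolding tiling_def
  proof (intro conjI ballI impI)
    fix t assume "t \<in> rotated A T"
    then show "polyhedral_body (fst t)"
      using tilingD(1)[OF T] polyhedral_body_image[OF f] unfolding mem by auto
  next
    have "(\<Union>t\<in>rotated A T. fst t) = ?f ` (\<Union>t\<in>T. fst t)"
      by (force simp: moved_def)
    then show "(\<Union>t\<in>rotated A T. fst t) = UNIV" using tilingD(2)[OF T] surj by simp
  next
    fix t t' assume "t \<in> rotated A T" "t' \<in> rotated A T" "t \<noteq> t'"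
    then obtain s s' where s': "s \<in> T" "s' \<in> T" "t = (?f ` fst s, snd s)" "t' = (?f ` fst s', snd s')"
      unfolding mem by blast
    with \<open>t \<noteq> t'\<close> have "s \<noteq> s'" by blast
    with s' have s: "s \<in> T" "s' \<in> T" "s \<noteq> s'" "t = (?f ` fst s, snd s)" "t' = (?f ` fst s', snd s')" by simp_all
    then have *: "fst s \<inter> fst s' \<subseteq> frontier (fst s) \<inter> frontier (fst s')" "meet_face_to_face (fst s) (fst s')"
      using tilingD(3,4)[OF T s(1-3)] by simp_all
    have "fst t \<inter> fst t' = ?f ` (fst s \<inter> fst s')" using s image_Int[OF inj] by simp
    with *(1) show "fst t \<inter> fst t' \<subseteq> frontier (fst t) \<inter> frontier (fst t')"
      using s by (auto simp: front)
    show "meet_face_to_face (fst t) (fst t')"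
      using meet_face_to_face_image[OF f *(2)] s by simp
  next
    obtain \<P> where \<P>: "finite \<P>" "\<forall>t\<in>T. \<exists>p\<in>\<P>. \<exists>v. {t} = translated v {p}"
      using tilingD(5)[OF T] by blast
    have "\<exists>p\<in>rotated A \<P>. \<exists>v. {t} = translated v {p}" if "t \<in> rotated A T" for t
    proof -
      obtain s where s: "s \<in> T" "t = (?f ` fst s, snd s)" using \<open>t \<in> rotated A T\<close> unfolding mem by blast
      then have s: "s \<in> T" "{t} = rotated A {s}" by (simp_all add: moved_def case_prod_unfold)
      obtain p v where p: "p \<in> \<P>" "{s} = translated v {p}" using \<P>(2) s(1) by blast
      obtain q where q: "rotated A {p} = {q}" by (simp add: moved_def)
      have "q \<in> rotated A \<P>" using moved_mono[of "{p}" \<P> ?f] p(1) q by blast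
      moreover have "{t} = translated (A *v v) {q}" using s(2) p(2) q by (simp add: rotated_translated)
      ultimately show ?thesis by blast
    qed
    then show "\<exists>\<P>. finite \<P> \<and> (\<forall>t\<in>rotated A T. \<exists>p\<in>\<P>. \<exists>v. {t} = translated v {p})"
      by (intro exI[of _ "rotated A \<P>"] conjI finite_moved[OF \<P>(1)] ballI)
  next
    show "finite_local_complexity (rotated A T)"
      unfolding finite_local_complexity_def
    proof (intro allI impI)
      fix r :: real assume "r > 0"
      then obtain \<P> where \<P>: "finite \<P>" "\<forall>x. \<exists>P\<in>\<P>. \<exists>v. patch r x T = translated v P"
        using tilingD(6)[OF T] unfolding finite_local_complexity_def by blast
      have "\<exists>P\<in>rotated A ` \<P>. \<exists>v. patch r x (rotated A T) = translated v P" for x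
      proof -
        obtain y where y: "x = A *v y" using surj by blast
        obtain P v where P: "P \<in> \<P>" "patch r y T = translated v P" using \<P>(2) by blast
        have "patch r x (rotated A T) = translated (A *v v) (rotated A P)"
          using P(2) by (simp add: y patch_rotated[OF A] rotated_translated)
        then show ?thesis using imageI[OF P(1), of "rotated A"] by (intro bexI exI)
      qed
      then show "\<exists>\<P>. finite \<P> \<and> (\<forall>x. \<exists>P\<in>\<P>. \<exists>v. patch r x (rotated A T) = translated v P)"
        by (intro exI[of _ "rotated A ` \<P>"] conjI finite_imageI[OF \<P>(1)] allI)
    qed
  qed
qed

section \<open>The rotation group, the point group and the two hulls\<close>

lemma SO_group_simps:
  "carrier SO_group = {A. rotation_matrix A}" "A \<otimes>\<^bsub>SO_group\<^esub> B = A ** B" "\<one>\<^bsub>SO_group\<^esub> = mat 1"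
  by (simp_all add: SO_group_def)

lemma rotation_1: "rotation_matrix (mat 1 :: real^'n^'n)"
  using mat_1_in_SO_sub[of UNIV] by (simp add: SO_sub_UNIV)

lemma group_SO_group: "group (SO_group :: (real^'n^'n) monoid)"
proof (rule groupI)
  show "\<exists>B\<in>carrier SO_group. B \<otimes>\<^bsub>SO_group\<^esub> A = \<one>\<^bsub>SO_group\<^esub>"
    if "A \<in> carrier SO_group" for A :: "real^'n^'n"
    using rotation_transpose[of A] that by (auto simp: SO_group_simps)
qed (auto simp: SO_group_simps rotation_mult rotation_1 matrix_mul_assoc)

lemma inv_SO_group: "rotation_matrix A \<Longrightarrow> inv\<^bsub>SO_group\<^esub> A = transpose A"
  using group.inv_equality[OF group_SO_group, of "transpose A" A] rotation_transpose[of A]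
  by (simp add: SO_group_simps)

locale point_group_tiling =
  fixes T :: "(real^'n, 'l) tiling" and G :: "(real^'n^'n) set"
  assumes T: "tiling T" and pg: "has_point_group T G"
begin

abbreviation "\<Omega>t \<equiv> translational_hull T"
abbreviation "\<Omega>r \<equiv> rotational_hull T"

lemma finite_G: "finite G" and subgroup_G: "subgroup G SO_group"
  and occurs_G: "\<And>P g. finite P \<Longrightarrow> P \<subseteq> T \<Longrightarrow> g \<in> G \<Longrightarrow> occurs_up_to_translation (rotated g P) T"
  using pg unfolding has_point_group_def by blast+

lemma G_rotation: "g \<in> G \<Longrightarrow> rotation_matrix g"
  using subgroup.subset[OF subgroup_G] by (auto simp: SO_group_simps)

lemma G_one: "mat 1 \<in> G"
  using subgroup.one_closed[OF subgroup_G] by (simp add: SO_group_simps)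

lemma G_mult: "g \<in> G \<Longrightarrow> h \<in> G \<Longrightarrow> g ** h \<in> G"
  using subgroup.m_closed[OF subgroup_G, of g h] by (simp add: SO_group_simps)

lemma G_transpose: "g \<in> G \<Longrightarrow> transpose g \<in> G"
  using subgroup.m_inv_closed[OF subgroup_G, of g] by (simp add: inv_SO_group G_rotation)

lemma group_G: "group (SO_group\<lparr>carrier := G\<rparr>)"
  by (rule subgroup.subgroup_is_group[OF subgroup_G group_SO_group])

lemma hull_t_tiling: "S \<in> \<Omega>t \<Longrightarrow> tiling S"
  by (simp add: translational_hull_def)

lemma hull_r_tiling: "S \<in> \<Omega>r \<Longrightarrow> tiling S"
  by (simp add: rotational_hull_def)

lemma hull_t_occurs:
  assumes "S \<in> \<Omega>t" "finite P" "P \<subseteq> S" shows "\<exists>v. translated v P \<subseteq> T"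
  using assms unfolding translational_hull_def occurs_up_to_translation_def by blast

lemma T_in_hull: "T \<in> \<Omega>t"
proof -
  have "occurs_up_to_translation P T" if "P \<subseteq> T" for P
    unfolding occurs_up_to_translation_def using that by (intro exI[of _ 0]) (simp add: translated_0)
  then show ?thesis using T by (simp add: translational_hull_def)
qed

lemma rotated_subset:
  assumes "rotation_matrix A" "P \<subseteq> rotated A S" "finite P"
  obtains Q where "Q \<subseteq> S" "finite Q" "P = rotated A Q"
proof (rule that[of "rotated (transpose A) P"])
  show "rotated (transpose A) P \<subseteq> S"
    using moved_mono[OF assms(2), of "\<lambda>x. transpose A *v x"] by (simp only: rotated_inverse[OF assms(1)])
  show "P = rotated A (rotated (transpose A) P)" by (simp only: rotated_inverse[OF assms(1)])
qed (rule finite_moved[OF assms(3)])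

lemma hull_t_rotated:
  assumes S: "S \<in> \<Omega>t" and g: "g \<in> G"
  shows "rotated g S \<in> \<Omega>t"
proof -
  have "occurs_up_to_translation P T" if P: "finite P" "P \<subseteq> rotated g S" for P
  proof -
    obtain Q where Q: "Q \<subseteq> S" "finite Q" "P = rotated g Q"
      using rotated_subset[OF G_rotation[OF g] P(2,1)] .
    obtain v where v: "translated v Q \<subseteq> T" using hull_t_occurs[OF S Q(2,1)] by blast
    obtain u where "translated u (rotated g (translated v Q)) \<subseteq> T"
      using occurs_G[OF finite_moved[OF Q(2)] v g] unfolding occurs_up_to_translation_def by blast
    then have "translated (u + g *v v) P \<subseteq> T"
      by (simp only: rotated_translated translated_translated Q(3))
    then show ?thesis unfolding occurs_up_to_translation_def by blast
  qed
  then show ?thesis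
    using tiling_rotated[OF G_rotation[OF g] hull_t_tiling[OF S]] by (simp add: translational_hull_def)
qed

lemma hull_r_rotated:
  assumes S: "S \<in> \<Omega>t" and A: "rotation_matrix A"
  shows "rotated A S \<in> \<Omega>r"
proof -
  have "occurs_up_to_rigid_motion P T" if P: "finite P" "P \<subseteq> rotated A S" for P
  proof -
    obtain Q where Q: "Q \<subseteq> S" "finite Q" "P = rotated A Q"
      using rotated_subset[OF A P(2,1)] .
    obtain v where v: "translated v Q \<subseteq> T" using hull_t_occurs[OF S Q(2,1)] by blast
    have "translated v (rotated (transpose A) P) \<subseteq> T"
      using v by (simp only: Q(3) rotated_inverse[OF A])
    then have "moved (\<lambda>x. v + transpose A *v x) P \<subseteq> T" by (simp add: moved_comp o_def)
    moreover have "rigid_motion (\<lambda>x. v + transpose A *v x)"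
      unfolding rigid_motion_def using rotation_transpose(1)[OF A] by blast
    ultimately show ?thesis unfolding occurs_up_to_rigid_motion_def by blast
  qed
  then show ?thesis
    using tiling_rotated[OF A hull_t_tiling[OF S]] by (simp add: rotational_hull_def)
qed

lemma ex_radius: "\<exists>r>0. \<forall>x g. rotation_matrix g \<and> occurs_up_to_translation (rotated g (patch r x T)) T \<longrightarrow> g \<in> G"
  using pg unfolding has_point_group_def by blast

text \<open>A size at which patches determine their orientation up to \<open>G\<close>. From the
  level \<open>radius\<close> on, the approximants are the quotients by the diagonal action.\<close>

definition radius :: real where
  "radius = (SOME r. r > 0 \<and> (\<forall>x g. rotation_matrix g \<and> occurs_up_to_translation (rotated g (patch r x T)) T \<longrightarrow> g \<in> G))"

lemma radius: "radius > 0"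
  and radius_G: "rotation_matrix g \<Longrightarrow> occurs_up_to_translation (rotated g (patch radius x T)) T \<Longrightarrow> g \<in> G"
  using someI_ex[OF ex_radius] unfolding radius_def by blast+

text \<open>\<open>has_point_group\<close> speaks of patches of \<open>T\<close>. The patch of
  \<open>S\<close> has a translate inside \<open>T\<close>, which by \<open>patch_transfer\<close>
  is a complete patch there, so the property carries over to the hull.\<close>

lemma recognise:
  assumes S: "S \<in> \<Omega>t" and A: "rotation_matrix A" and occ: "translated w (rotated A (patch radius x S)) \<subseteq> T"
  shows "A \<in> G"
proof -
  obtain u where u: "translated u (patch radius x S) \<subseteq> T"
    using hull_t_occurs[OF S finite_patch[OF hull_t_tiling[OF S]] patch_subset] by blast
  have "patch radius (u + x) T = translated u (patch radius x S)"
    by (rule patch_transfer[OF hull_t_tiling[OF S] T u])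
  then have "translated (w - A *v u) (rotated A (patch radius (u + x) T)) \<subseteq> T"
    using occ by (simp only: rotated_translated translated_translated diff_add_cancel)
  then show ?thesis
    using radius_G[OF A] unfolding occurs_up_to_translation_def by blast
qed

lemma recognise_hull:
  assumes S: "S \<in> \<Omega>t" and S': "S' \<in> \<Omega>t" and A: "rotation_matrix A"
    and sub: "rotated A (patch radius x S) \<subseteq> S'"
  shows "A \<in> G"
proof -
  obtain w where "translated w (rotated A (patch radius x S)) \<subseteq> T"
    using hull_t_occurs[OF S' finite_moved[OF finite_patch[OF hull_t_tiling[OF S]]] sub] by blast
  then show ?thesis by (rule recognise[OF S A])
qed

lemma rigid_occurs:
  assumes "S \<in> \<Omega>r" "finite P" "P \<subseteq> S"
  obtains A v where "rotation_matrix A" "translated v (rotated A P) \<subseteq> T"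
proof -
  have "occurs_up_to_rigid_motion P T" using assms unfolding rotational_hull_def by blast
  then obtain A v where "rotation_matrix A" "moved (\<lambda>x. v + A *v x) P \<subseteq> T"
    unfolding occurs_up_to_rigid_motion_def rigid_motion_def by blast
  moreover from this have "translated v (rotated A P) \<subseteq> T" by (simp add: moved_comp o_def)
  ultimately show ?thesis by (rule_tac that)
qed

text \<open>The rotation that moves a fixed patch of size \<open>radius\<close> into \<open>T\<close> works for every larger patch up to
  an element of the point group.\<close>

lemma hull_r_decompose:
  assumes R: "R \<in> \<Omega>r"
  obtains A S where "rotation_matrix A" "S \<in> \<Omega>t" "R = rotated A S"
proof -
  have tR: "tiling R" using hull_r_tiling[OF R] .
  let ?P = "patch radius 0 R"
  obtain A v where A: "rotation_matrix A" "translated v (rotated A ?P) \<subseteq> T"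
    using rigid_occurs[OF R finite_patch[OF tR] patch_subset] .
  define S where "S = rotated A R"
  have tS: "tiling S" unfolding S_def by (rule tiling_rotated[OF A(1) tR])
  have occ: "\<exists>w. translated w P \<subseteq> T" if P: "finite P" "P \<subseteq> S" for P
  proof -
    obtain Q where Q: "Q \<subseteq> R" "finite Q" "P = rotated A Q"
      using rotated_subset[OF A(1) _ P(1)] P(2) unfolding S_def by blast
    \<comment> \<open>Adding \<open>?P\<close> to the patch ties the new rotation \<open>B\<close>
      to \<open>A\<close>: the quotient \<open>?g\<close> moves a patch of \<open>T\<close> of size
      \<open>radius\<close> back into \<open>T\<close> and so lies in \<open>G\<close>, after which
      \<open>occurs_G\<close> undoes it on \<open>Q\<close>.\<close>
    obtain B w where B: "rotation_matrix B" "translated w (rotated B (Q \<union> ?P)) \<subseteq> T"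
      using rigid_occurs[OF R, of "Q \<union> ?P"] finite_patch[OF tR] Q patch_subset by blast
    let ?g = "B ** transpose A"
    have g: "rotation_matrix ?g" using B(1) A(1) rotation_transpose(1) rotation_mult by blast
    have BP: "rotated B X = rotated ?g (rotated A X)" for X :: "(real^'n, 'l) tiling"
      by (simp only: rotated_rotated matrix_mul_assoc[symmetric] rotation_transpose(3)[OF A(1)] matrix_mul_rid)
    have "patch radius (v + 0) T = translated v (patch radius 0 S)"
      using A(2) by (intro patch_transfer[OF tS T]) (simp only: S_def patch_rotated_0[OF A(1)])
    then have pT: "patch radius (v + 0) T = translated v (rotated A ?P)"
      by (simp only: S_def patch_rotated_0[OF A(1)])
    have "rotated B ?P \<subseteq> rotated B (Q \<union> ?P)" by (rule moved_mono) blast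
    then have "translated w (rotated B ?P) \<subseteq> T" using B(2) moved_mono by blast
    then have "translated (w - ?g *v v) (rotated ?g (translated v (rotated A ?P))) \<subseteq> T"
      by (simp only: rotated_translated translated_translated diff_add_cancel BP)
    then have gG: "?g \<in> G"
      using radius_G[OF g] unfolding pT[symmetric] occurs_up_to_translation_def by blast
    have "rotated B Q \<subseteq> rotated B (Q \<union> ?P)" by (rule moved_mono) blast
    then have sub: "translated w (rotated B Q) \<subseteq> T" using B(2) moved_mono by blast
    have "occurs_up_to_translation (rotated (transpose ?g) (translated w (rotated B Q))) T"
      using finite_moved[OF finite_moved[OF Q(2)]] sub G_transpose[OF gG] by (rule occurs_G)
    then obtain u where "translated u (rotated (transpose ?g) (translated w (rotated B Q))) \<subseteq> T"
      unfolding occurs_up_to_translation_def by blast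
    then have "translated (u + transpose ?g *v w) P \<subseteq> T"
      by (simp only: rotated_translated translated_translated BP rotated_inverse[OF g] Q(3))
    then show ?thesis by blast
  qed
  then have "S \<in> \<Omega>t" using tS unfolding translational_hull_def occurs_up_to_translation_def by blast
  moreover have "R = rotated (transpose A) S" unfolding S_def by (simp only: rotated_inverse[OF A(1)])
  ultimately show ?thesis using that rotation_transpose(1)[OF A(1)] by blast
qed

end

section \<open>The tiling topology\<close>

lemma norm_transpose: "norm (transpose X) = norm X" for X :: "real^'n^'m"
  by (simp add: norm_eq_sqrt_inner inner_vec_def transpose_def) (subst sum.swap, simp)

lemma norm_mult_rotation_left:
  fixes X A :: "real^'n^'n"
  assumes "rotation_matrix A" shows "norm (X ** A) = norm X"
proof -
  have "(X ** A) $ i = transpose A *v (X $ i)" for i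
    by (simp add: matrix_matrix_mult_def matrix_vector_mult_def transpose_def vec_eq_iff mult.commute)
  then have "norm ((X ** A) $ i) = norm (X $ i)" for i
    using norm_rotation[OF rotation_transpose(1)[OF assms]] by simp
  then show ?thesis by (simp add: norm_vec_def)
qed

lemma norm_mult_rotation_right:
  fixes X A :: "real^'n^'n"
  assumes "rotation_matrix A" shows "norm (A ** X) = norm X"
proof -
  have "norm (A ** X) = norm (transpose X ** transpose A)"
    by (metis matrix_transpose_mul norm_transpose)
  also have "\<dots> = norm X"
    by (simp add: norm_mult_rotation_left rotation_transpose(1)[OF assms] norm_transpose)
  finally show ?thesis .
qed

lemma matrix_diff_distrib: "(A - B) ** C = A ** C - B ** C" "C ** (A - B) = C ** A - C ** B"
  "(A + B) ** C = A ** C + B ** C" for A B C :: "real^'n^'n"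
  by (simp_all add: matrix_matrix_mult_def vec_eq_iff algebra_simps sum_subtractf sum.distrib)

text \<open>A translation by \<open>v\<close> costs at most \<open>norm v\<close> of the radius of
  agreement, a rotation costs nothing.\<close>

lemma agree_move:
  assumes "patch r 0 X = patch r 0 X'" "s + norm v \<le> r" "rotation_matrix A"
  shows "patch s 0 (rotated A (translated v X)) = patch s 0 (rotated A (translated v X'))"
proof -
  have "cball (0 - v) s \<subseteq> cball 0 r"
  proof
    fix y assume "y \<in> cball (0 - v) s"
    then have "norm (y + v) \<le> s" by (simp add: dist_norm norm_minus_commute)
    then show "y \<in> cball 0 r" using norm_triangle_ineq4[of "y + v" v] assms(2) by simp
  qed
  from patch_cong[OF assms(1) this] show ?thesis
    by (simp only: patch_rotated_0[OF assms(3)] patch_translated)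
qed

lemma close_by_moving_iff:
  "close_by_moving \<epsilon> S S' \<longleftrightarrow> (\<exists>v A. norm v < \<epsilon> \<and> rotation_matrix A \<and> norm (A - mat 1) < \<epsilon> \<and>
     patch (1 / \<epsilon>) 0 (rotated A (translated v S)) = patch (1 / \<epsilon>) 0 S')"
  by (simp add: close_by_moving_def agree_on_ball_def)

lemma close_by_moving_mono:
  assumes "close_by_moving \<delta> S S'" "0 < \<delta>" "\<delta> \<le> \<epsilon>"
  shows "close_by_moving \<epsilon> S S'"
proof -
  obtain v A where vA: "norm v < \<delta>" "rotation_matrix A" "norm (A - mat 1) < \<delta>"
    "patch (1 / \<delta>) 0 (rotated A (translated v S)) = patch (1 / \<delta>) 0 S'"
    using assms(1) unfolding close_by_moving_iff by blast
  have "cball 0 (1 / \<epsilon>) \<subseteq> cball (0::real^'a) (1 / \<delta>)"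
    using assms by (intro subset_cball frac_le) auto
  from patch_cong[OF vA(4) this] show ?thesis
    unfolding close_by_moving_iff using vA(1-3) assms(3) by (meson order_less_le_trans)
qed

lemma close_by_moving_refl: "0 < \<epsilon> \<Longrightarrow> close_by_moving \<epsilon> S S"
  unfolding close_by_moving_iff
  by (rule exI[of _ 0], rule exI[of _ "mat 1"]) (simp add: rotation_1 translated_0 rotated_1 del: moved_ident)

text \<open>The inverse motion rotates before it translates; exchanging the two turns the
  displacement into minus \<open>A *v v\<close>, of the same length. That length is lost from the
  radius of agreement, and for small \<epsilon> a factor 2 pays for it.\<close>

lemma close_by_moving_sym:
  assumes "close_by_moving \<epsilon> S S'" "0 < \<epsilon>" "\<epsilon> \<le> 1 / 2"
  shows "close_by_moving (2 * \<epsilon>) S' S"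
proof -
  obtain v A where vA: "norm v < \<epsilon>" "rotation_matrix A" "norm (A - mat 1) < \<epsilon>"
    "patch (1 / \<epsilon>) 0 (rotated A (translated v S)) = patch (1 / \<epsilon>) 0 S'"
    using assms(1) unfolding close_by_moving_iff by blast
  let ?B = "transpose A" and ?u = "- (A *v v)"
  note B = rotation_transpose[OF vA(2)]
  have nu: "norm ?u < \<epsilon>" using vA(1) norm_rotation[OF vA(2)] by simp
  have "\<epsilon> * \<epsilon> \<le> 1 / 2 * (1 / 2)" using assms by (intro mult_mono) auto
  then have "1 / (2 * \<epsilon>) + \<epsilon> \<le> 1 / \<epsilon>" using assms(2) by (simp add: field_simps)
  then have "patch (1 / (2 * \<epsilon>)) 0 (rotated ?B (translated ?u (rotated A (translated v S))))
      = patch (1 / (2 * \<epsilon>)) 0 (rotated ?B (translated ?u S'))"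
    using nu by (intro agree_move[OF vA(4) _ B(1)]) simp
  moreover have "rotated ?B (translated ?u (rotated A (translated v S))) = S"
    by (simp only: rotated_translated translated_translated left_minus translated_0 rotated_inverse[OF vA(2)])
  ultimately have eq: "patch (1 / (2 * \<epsilon>)) 0 (rotated ?B (translated ?u S')) = patch (1 / (2 * \<epsilon>)) 0 S"
    by (simp only:)
  have "?B - mat 1 = transpose (A - mat 1)"
    by (auto simp: transpose_def vec_eq_iff mat_def)
  then have "norm (?B - mat 1) = norm (A - mat 1)" by (simp only: norm_transpose)
  with vA(3) assms(2) have "norm (?B - mat 1) < 2 * \<epsilon>" by linarith
  moreover have "norm ?u < 2 * \<epsilon>" using nu assms(2) by linarith
  ultimately show ?thesis
    unfolding close_by_moving_iff using eq B(1) by blast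
qed

text \<open>A triangle inequality up to a factor 3: displacements and rotations add up to less than
  \<open>2 * \<epsilon>\<close>, and the radius \<open>1 / (3 * \<epsilon>)\<close> leaves room for
  the second displacement.\<close>

lemma close_by_moving_trans:
  assumes "close_by_moving \<epsilon> S S'" "close_by_moving \<epsilon> S' S''" "0 < \<epsilon>" "\<epsilon> \<le> 1 / 2"
  shows "close_by_moving (3 * \<epsilon>) S S''"
proof -
  obtain v A where vA: "norm v < \<epsilon>" "rotation_matrix A" "norm (A - mat 1) < \<epsilon>"
    "patch (1 / \<epsilon>) 0 (rotated A (translated v S)) = patch (1 / \<epsilon>) 0 S'"
    using assms(1) unfolding close_by_moving_iff by blast
  obtain u B where uB: "norm u < \<epsilon>" "rotation_matrix B" "norm (B - mat 1) < \<epsilon>"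
    "patch (1 / \<epsilon>) 0 (rotated B (translated u S')) = patch (1 / \<epsilon>) 0 S''"
    using assms(2) unfolding close_by_moving_iff by blast
  let ?w = "v + transpose A *v u"
  have "norm ?w < 2 * \<epsilon>"
    using norm_triangle_ineq[of v "transpose A *v u"] norm_rotation[OF rotation_transpose(1)[OF vA(2)]] vA(1) uB(1)
    by simp
  moreover have "norm (B ** A - mat 1) < 2 * \<epsilon>"
  proof -
    have "B ** A - mat 1 = (B - mat 1) ** A + (A - mat 1)" by (simp add: matrix_diff_distrib)
    then have "norm (B ** A - mat 1) = norm ((B - mat 1) ** A + (A - mat 1))" by (rule arg_cong)
    then show ?thesis
      using norm_triangle_ineq[of "(B - mat 1) ** A" "A - mat 1"] norm_mult_rotation_left[OF vA(2), of "B - mat 1"]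
        vA(3) uB(3) by linarith
  qed
  moreover have "patch (1 / (3 * \<epsilon>)) 0 (rotated (B ** A) (translated ?w S)) = patch (1 / (3 * \<epsilon>)) 0 S''"
  proof -
    have "\<epsilon> * \<epsilon> \<le> 1 / 2 * (1 / 2)" using assms by (intro mult_mono) auto
    then have r: "1 / (3 * \<epsilon>) + \<epsilon> \<le> 1 / \<epsilon>" using assms(3) by (simp add: field_simps)
    have "rotated (B ** A) (translated ?w S) = rotated B (translated u (rotated A (translated v S)))"
    proof -
      have w: "A *v ?w = u + A *v v"
        by (simp only: matrix_vector_right_distrib matrix_vector_mul_assoc rotation_transpose(2)[OF vA(2)]
            matrix_vector_mul_lid add.commute)
      have "rotated (B ** A) (translated ?w S) = rotated B (translated (A *v ?w) (rotated A S))"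
        by (simp only: rotated_rotated[symmetric] rotated_translated matrix_vector_mul_assoc)
      also have "translated (A *v ?w) (rotated A S) = translated u (rotated A (translated v S))"
        by (simp only: w rotated_translated translated_translated)
      finally show ?thesis .
    qed
    also have "patch (1 / (3 * \<epsilon>)) 0 \<dots> = patch (1 / (3 * \<epsilon>)) 0 (rotated B (translated u S'))"
      using r uB(1) by (intro agree_move[OF vA(4) _ uB(2)]) simp
    also have "\<dots> = patch (1 / (3 * \<epsilon>)) 0 S''"
      by (rule patch_cong[OF uB(4)], rule subset_cball) (use r assms(3) in simp)
    finally show ?thesis .
  qed
  ultimately show ?thesis
    unfolding close_by_moving_iff using rotation_mult[OF uB(2) vA(2)] assms(3)
    by (intro exI[of _ ?w] exI[of _ "B ** A"]) simp
qed

text \<open>By approximate symmetry the one-sided relation defines the same topology, so only one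
  direction of closeness has to be tracked.\<close>

lemma openin_moving:
  "openin (tiling_topology \<Omega>) U \<longleftrightarrow>
     U \<subseteq> \<Omega> \<and> (\<forall>S\<in>U. \<exists>\<epsilon>>0. \<forall>S'\<in>\<Omega>. close_by_moving \<epsilon> S S' \<longrightarrow> S' \<in> U)"
  unfolding openin_tiling_topology
proof (intro conj_cong refl ball_cong iffI)
  fix S assume "\<exists>\<epsilon>>0. \<forall>S'\<in>\<Omega>. close \<epsilon> S S' \<longrightarrow> S' \<in> U"
  then show "\<exists>\<epsilon>>0. \<forall>S'\<in>\<Omega>. close_by_moving \<epsilon> S S' \<longrightarrow> S' \<in> U"
    unfolding close_def by blast
next
  fix S assume "\<exists>\<epsilon>>0. \<forall>S'\<in>\<Omega>. close_by_moving \<epsilon> S S' \<longrightarrow> S' \<in> U"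
  then obtain \<epsilon> where \<epsilon>: "\<epsilon> > 0" "\<forall>S'\<in>\<Omega>. close_by_moving \<epsilon> S S' \<longrightarrow> S' \<in> U" by blast
  let ?d = "min (\<epsilon> / 2) (1 / 2)"
  have d: "0 < ?d" "?d \<le> 1 / 2" "?d \<le> \<epsilon>" "2 * ?d \<le> \<epsilon>" using \<epsilon>(1) by auto
  have "close_by_moving \<epsilon> S S'" if "close ?d S S'" for S'
    using that unfolding close_def
  proof
    assume "close_by_moving ?d S S'"
    then show ?thesis using d by (intro close_by_moving_mono[OF _ d(1,3)])
  next
    assume "close_by_moving ?d S' S"
    from close_by_moving_sym[OF this d(1,2)] show ?thesis
      by (rule close_by_moving_mono) (use d in auto)
  qed
  with \<epsilon>(2) d(1) show "\<exists>\<epsilon>>0. \<forall>S'\<in>\<Omega>. close \<epsilon> S S' \<longrightarrow> S' \<in> U" by blast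
qed

text \<open>The tilings close to \<open>S\<close> are not claimed to form an open set;
  \<open>U\<close> is the interior of that set, and its openness is the approximate triangle
  inequality.\<close>

lemma ex_open_nhd:
  assumes S: "S \<in> \<Omega>" and \<epsilon>: "\<epsilon> > 0"
  obtains U where "openin (tiling_topology \<Omega>) U" "S \<in> U" "\<And>S'. S' \<in> U \<Longrightarrow> close_by_moving \<epsilon> S S'"
proof -
  define U where "U = {S'\<in>\<Omega>. \<exists>\<delta>>0. \<forall>R\<in>\<Omega>. close_by_moving \<delta> S' R \<longrightarrow> close_by_moving \<epsilon> S R}"
  have "openin (tiling_topology \<Omega>) U"
    unfolding openin_moving
  proof (intro conjI ballI)
    show "U \<subseteq> \<Omega>" by (auto simp: U_def)
    fix S' assume "S' \<in> U"
    then obtain \<delta> where \<delta>: "\<delta> > 0" "\<forall>R\<in>\<Omega>. close_by_moving \<delta> S' R \<longrightarrow> close_by_moving \<epsilon> S R"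
      unfolding U_def by blast
    let ?d = "min (\<delta> / 3) (1 / 2)"
    have d: "0 < ?d" "?d \<le> 1 / 2" "3 * ?d \<le> \<delta>" using \<delta>(1) by auto
    have "R \<in> U" if R: "R \<in> \<Omega>" "close_by_moving ?d S' R" for R
    proof -
      have "close_by_moving \<epsilon> S R'" if R': "R' \<in> \<Omega>" "close_by_moving ?d R R'" for R'
      proof -
        have "close_by_moving (3 * ?d) S' R'"
          by (rule close_by_moving_trans[OF R(2) R'(2) d(1,2)])
        then have "close_by_moving \<delta> S' R'"
          by (rule close_by_moving_mono) (use d in auto)
        with \<delta>(2) R'(1) show ?thesis by blast
      qed
      with R(1) d(1) show ?thesis unfolding U_def by blast
    qed
    with d(1) show "\<exists>\<epsilon>>0. \<forall>R\<in>\<Omega>. close_by_moving \<epsilon> S' R \<longrightarrow> R \<in> U" by blast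
  qed
  moreover have "S \<in> U" using S \<epsilon> by (auto simp: U_def)
  moreover have "close_by_moving \<epsilon> S S'" if "S' \<in> U" for S'
    using that close_by_moving_refl unfolding U_def by blast
  ultimately show ?thesis by (rule that)
qed

text \<open>\<open>M\<close> is kept general to cover both a single element of the point group
  acting on the translational hull and the whole rotation group carrying that hull into the
  rotational one.\<close>

lemma continuous_map_rotate:
  assumes M: "\<And>A. A \<in> M \<Longrightarrow> rotation_matrix A"
    and into: "\<And>S A. S \<in> \<Omega> \<Longrightarrow> A \<in> M \<Longrightarrow> rotated A S \<in> \<Omega>'"
  shows "continuous_map (prod_topology (tiling_topology \<Omega>) (top_of_set M)) (tiling_topology \<Omega>') (\<lambda>(S, A). rotated A S)"
  unfolding continuous_map_def
proof (intro conjI allI impI)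
  show "(\<lambda>(S, A). rotated A S) \<in> topspace (prod_topology (tiling_topology \<Omega>) (top_of_set M)) \<rightarrow> topspace (tiling_topology \<Omega>')"
    using into by auto
  fix W assume W: "openin (tiling_topology \<Omega>') W"
  let ?pre = "{x \<in> topspace (prod_topology (tiling_topology \<Omega>) (top_of_set M)). (case x of (S, A) \<Rightarrow> rotated A S) \<in> W}"
  show "openin (prod_topology (tiling_topology \<Omega>) (top_of_set M)) ?pre"
  proof (subst openin_subopen, intro ballI)
    fix x assume "x \<in> ?pre"
    then obtain S0 B0 where x: "x = (S0, B0)" "S0 \<in> \<Omega>" "rotation_matrix B0" "rotated B0 S0 \<in> W" "B0 \<in> M" using M by auto
    obtain \<epsilon> where \<epsilon>: "\<epsilon> > 0" "\<forall>R\<in>\<Omega>'. close_by_moving \<epsilon> (rotated B0 S0) R \<longrightarrow> R \<in> W"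
      using W x(4) unfolding openin_moving by blast
    obtain U where U: "openin (tiling_topology \<Omega>) U" "S0 \<in> U" "\<And>S. S \<in> U \<Longrightarrow> close_by_moving (\<epsilon> / 2) S0 S"
      using ex_open_nhd[OF x(2), of "\<epsilon> / 2"] \<epsilon>(1) by auto
    let ?V = "M \<inter> ball B0 (\<epsilon> / 2)"
    have V: "openin (top_of_set M) ?V" by (intro openin_open_Int) simp
    have "rotated B S \<in> W" if S: "S \<in> U" and B: "B \<in> ?V" for S B
    proof -
      have SO: "S \<in> \<Omega>" using openin_subset[OF U(1)] S by auto
      have BM: "B \<in> M" and rB: "rotation_matrix B" and nB: "norm (B - B0) < \<epsilon> / 2"
        using B M by (auto simp: dist_norm norm_minus_commute)
      obtain v A where vA: "norm v < \<epsilon> / 2" "rotation_matrix A" "norm (A - mat 1) < \<epsilon> / 2"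
        "patch (1 / (\<epsilon> / 2)) 0 (rotated A (translated v S0)) = patch (1 / (\<epsilon> / 2)) 0 S"
        using U(3)[OF S] unfolding close_by_moving_iff by blast
      \<comment> \<open>The motion from \<open>S0\<close> to \<open>S\<close> conjugated by
        \<open>B0\<close>, then corrected by the change from \<open>B0\<close> to \<open>B\<close>:
        it takes \<open>rotated B0 S0\<close> to a tiling that agrees with
        \<open>rotated B S\<close> around the origin.\<close>
      let ?C = "B ** (A ** transpose B0)" and ?u = "B0 *v v"
      note tB0 = rotation_transpose[OF x(3)]
      have C: "rotation_matrix ?C" using rB vA(2) tB0(1) by (intro rotation_mult)
      have "rotated ?C (translated ?u (rotated B0 S0)) = rotated B (rotated A (translated v S0))"
        by (simp only: rotated_translated[symmetric] rotated_rotated[symmetric] rotated_inverse[OF x(3)])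
      moreover have "patch (1 / \<epsilon>) 0 (rotated B (rotated A (translated v S0))) = patch (1 / \<epsilon>) 0 (rotated B S)"
      proof -
        have "cball 0 (1 / \<epsilon>) \<subseteq> cball (0::real^'a) (1 / (\<epsilon> / 2))"
          using \<epsilon>(1) by (intro subset_cball) (simp add: field_simps)
        from patch_cong[OF vA(4) this] show ?thesis by (simp only: patch_rotated_0[OF rB])
      qed
      moreover have "norm (?C - mat 1) < \<epsilon>"
      proof -
        have "?C - mat 1 = (B ** (A - mat 1) + (B - B0)) ** transpose B0"
          by (simp add: matrix_diff_distrib matrix_mul_assoc[symmetric] tB0)
        then have "norm (?C - mat 1) = norm (B ** (A - mat 1) + (B - B0))"
          by (simp add: norm_mult_rotation_left[OF tB0(1)])
        also have "\<dots> \<le> norm (A - mat 1) + norm (B - B0)"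
          using norm_triangle_ineq[of "B ** (A - mat 1)" "B - B0"] norm_mult_rotation_right[OF rB, of "A - mat 1"] by simp
        finally show ?thesis using vA(3) nB by simp
      qed
      moreover have "norm ?u < \<epsilon>" using vA(1) \<epsilon>(1) norm_rotation[OF x(3), of v] by simp
      ultimately have "close_by_moving \<epsilon> (rotated B0 S0) (rotated B S)"
        unfolding close_by_moving_iff using C by metis
      then show ?thesis using \<epsilon>(2) into[OF SO BM] by blast
    qed
    then have "U \<times> ?V \<subseteq> ?pre" using openin_subset[OF U(1)] by auto
    moreover have "openin (prod_topology (tiling_topology \<Omega>) (top_of_set M)) (U \<times> ?V)"
      using U(1) V by (simp add: openin_prod_Times_iff)
    moreover have "x \<in> U \<times> ?V" using x U(2) \<epsilon>(1) by simp
    ultimately show "\<exists>N. openin (prod_topology (tiling_topology \<Omega>) (top_of_set M)) N \<and> x \<in> N \<and> N \<subseteq> ?pre"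
      by blast
  qed
qed

section \<open>Approximants\<close>

abbreviation tclass :: "(real^'n, 'l) tiling set \<Rightarrow> nat \<Rightarrow> (real^'n, 'l) tiling \<Rightarrow> (real^'n, 'l) tiling set" where
  "tclass \<Omega> n S \<equiv> agree_rel \<Omega> n `` {S}"

lemma tclass_eq_iff:
  assumes "S \<in> \<Omega>" "S' \<in> \<Omega>"
  shows "tclass \<Omega> n S = tclass \<Omega> n S' \<longleftrightarrow> patch (real n) 0 S = patch (real n) 0 S'"
  using eq_equiv_class_iff[OF equiv_agree_rel assms] assms by (auto simp: agree_rel_def agree_on_ball_def)

lemma tclass_iff: "R \<in> tclass \<Omega> n S \<longleftrightarrow> S \<in> \<Omega> \<and> R \<in> \<Omega> \<and> patch (real n) 0 S = patch (real n) 0 R"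
  by (simp add: agree_rel_def agree_on_ball_def)

lemma topspace_approximant: "topspace (approximant \<Omega> n) = tclass \<Omega> n ` \<Omega>"
  using topspace_quotient_space[of "tiling_topology \<Omega>" "agree_rel \<Omega> n"] equiv_agree_rel[of \<Omega> n]
  by (auto simp: approximant_def quotient_def)

lemma quotient_map_approximant: "quotient_map (tiling_topology \<Omega>) (approximant \<Omega> n) (tclass \<Omega> n)"
  using quotient_map_quotient_space[of "tiling_topology \<Omega>" "agree_rel \<Omega> n"] equiv_agree_rel[of \<Omega> n]
  by (simp add: approximant_def)

lemma forget_tclass:
  assumes S: "S \<in> \<Omega>" shows "forget \<Omega> n (tclass \<Omega> (Suc n) S) = tclass \<Omega> n S"
proof -
  have "patch (real n) 0 S = patch (real n) 0 R" if "patch (real (Suc n)) 0 S = patch (real (Suc n)) 0 R" for R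
    by (rule patch_cong[OF that]) (simp add: subset_cball)
  note down = this
  show ?thesis
  proof (intro equalityI subsetI)
    fix R assume "R \<in> forget \<Omega> n (tclass \<Omega> (Suc n) S)"
    then obtain S' where S': "S' \<in> tclass \<Omega> (Suc n) S" "R \<in> tclass \<Omega> n S'" unfolding forget_def by blast
    have "patch (real n) 0 S = patch (real n) 0 S'" using S'(1) down by (simp only: tclass_iff)
    with S S' show "R \<in> tclass \<Omega> n S" by (simp only: tclass_iff)
  next
    fix R assume "R \<in> tclass \<Omega> n S"
    moreover have "S \<in> tclass \<Omega> (Suc n) S" using S by (simp only: tclass_iff)
    ultimately show "R \<in> forget \<Omega> n (tclass \<Omega> (Suc n) S)" unfolding forget_def by blast
  qed
qed

lemma continuous_map_forget: "continuous_map (approximant \<Omega> (Suc n)) (approximant \<Omega> n) (forget \<Omega> n)"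
proof (rule continuous_compose_quotient_map[OF quotient_map_approximant])
  have "continuous_map (tiling_topology \<Omega>) (approximant \<Omega> n) (tclass \<Omega> n)"
    by (rule quotient_imp_continuous_map[OF quotient_map_approximant])
  then show "continuous_map (tiling_topology \<Omega>) (approximant \<Omega> n) (forget \<Omega> n \<circ> tclass \<Omega> (Suc n))"
    by (rule continuous_map_eq) (simp add: forget_tclass)
qed

text \<open>A rotated class need only be part of a class of the target hull, hence the saturation on
  the right.\<close>

lemma image_tclass:
  assumes A: "rotation_matrix A" and S: "S \<in> \<Omega>"
    and into: "\<And>R. R \<in> \<Omega> \<Longrightarrow> rotated A R \<in> \<Omega>'"
  shows "tclass \<Omega>' n (rotated A S) = agree_rel \<Omega>' n `` (rotated A ` tclass \<Omega> n S)"
proof -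
  have "S \<in> tclass \<Omega> n S" using S by (simp only: tclass_iff)
  then have "tclass \<Omega>' n (rotated A S) \<subseteq> agree_rel \<Omega>' n `` (rotated A ` tclass \<Omega> n S)" by blast
  moreover have "Q \<in> tclass \<Omega>' n (rotated A S)" if R: "R \<in> tclass \<Omega> n S" and Q: "Q \<in> tclass \<Omega>' n (rotated A R)" for R Q
  proof -
    have "patch (real n) 0 (rotated A S) = patch (real n) 0 (rotated A R)"
      using R by (simp only: tclass_iff patch_rotated_0[OF A])
    with Q into[OF S] show ?thesis by (simp only: tclass_iff)
  qed
  ultimately show ?thesis by blast
qed

lemma compact_rotations: "compact {A :: real^'n^'n. rotation_matrix A}"
proof -
  have "closed {A :: real^'n^'n. transpose A ** A = mat 1 \<and> det A = 1}"
    unfolding transpose_def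
    by (intro closed_Collect_conj closed_Collect_eq continuous_on_matrix_mult continuous_on_det continuous_intros)
  then have "closed {A :: real^'n^'n. rotation_matrix A}"
    by (simp add: rotation_matrix_def orthogonal_matrix)
  moreover have "norm A = norm (mat 1 :: real^'n^'n)" if "rotation_matrix A" for A :: "real^'n^'n"
    using norm_mult_rotation_left[OF that, of "mat 1"] by simp
  then have "bounded {A :: real^'n^'n. rotation_matrix A}"
    by (intro boundedI[of _ "norm (mat 1 :: real^'n^'n)"]) simp
  ultimately show ?thesis by (simp add: compact_eq_bounded_closed)
qed

section \<open>The map from K_n x SO(d) to J_n\<close>

context point_group_tiling
begin

abbreviation "\<G> \<equiv> SO_group\<lparr>carrier := G\<rparr>"
abbreviation "SOn \<equiv> (SO_top :: (real^'n^'n) topology)"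
abbreviation "K n \<equiv> approximant \<Omega>t n"
abbreviation "J n \<equiv> approximant \<Omega>r n"

lemma \<G>_simps: "carrier \<G> = G" "g \<otimes>\<^bsub>\<G>\<^esub> h = g ** h" "\<one>\<^bsub>\<G>\<^esub> = mat 1"
  by (simp_all add: SO_group_def)

text \<open>Elements of the point group permute the translational hull, so they map whole classes to
  whole classes and the elementwise action on \<open>K n\<close> requires no saturation.\<close>

lemma rotated_tclass:
  assumes g: "g \<in> G" and S: "S \<in> \<Omega>t"
  shows "rotated g ` tclass \<Omega>t n S = tclass \<Omega>t n (rotated g S)"
proof (intro equalityI subsetI)
  note rg = G_rotation[OF g]
  fix R assume "R \<in> rotated g ` tclass \<Omega>t n S"
  then obtain Q where Q: "Q \<in> tclass \<Omega>t n S" "R = rotated g Q" by blast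
  then show "R \<in> tclass \<Omega>t n (rotated g S)"
    using hull_t_rotated[OF _ g] by (simp only: tclass_iff patch_rotated_0[OF rg] simp_thms)
next
  note rg = G_rotation[OF g]
  fix R assume R: "R \<in> tclass \<Omega>t n (rotated g S)"
  let ?R = "rotated (transpose g) R"
  have "patch (real n) 0 ?R = rotated (transpose g) (patch (real n) 0 (rotated g S))"
    using R by (simp only: patch_rotated_0[OF rotation_transpose(1)[OF rg]] tclass_iff)
  also have "\<dots> = patch (real n) 0 S"
    by (simp only: patch_rotated_0[OF rg] rotated_inverse[OF rg])
  finally have "?R \<in> tclass \<Omega>t n S"
    using R S hull_t_rotated[OF _ G_transpose[OF g]] by (simp only: tclass_iff simp_thms)
  moreover have "R = rotated g ?R" by (simp only: rotated_inverse[OF rg])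
  ultimately show "R \<in> rotated g ` tclass \<Omega>t n S" by blast
qed

lemma continuous_map_K_rotated:
  assumes g: "g \<in> G" shows "continuous_map (K n) (K n) ((`) (rotated g))"
proof (rule continuous_compose_quotient_map[OF quotient_map_approximant])
  have "continuous_map (prod_topology (tiling_topology \<Omega>t) (top_of_set {g})) (tiling_topology \<Omega>t) (\<lambda>(S, A). rotated A S)"
    using G_rotation[OF g] hull_t_rotated[OF _ g] by (intro continuous_map_rotate) auto
  moreover have "continuous_map (tiling_topology \<Omega>t) (prod_topology (tiling_topology \<Omega>t) (top_of_set {g})) (\<lambda>S. (S, g))"
    by (simp add: continuous_map_pairwise o_def)
  ultimately have "continuous_map (tiling_topology \<Omega>t) (tiling_topology \<Omega>t) ((\<lambda>(S, A). rotated A S) \<circ> (\<lambda>S. (S, g)))"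
    by (rule continuous_map_compose[rotated])
  then have "continuous_map (tiling_topology \<Omega>t) (tiling_topology \<Omega>t) (rotated g)"
    by (simp add: o_def)
  from continuous_map_compose[OF this quotient_imp_continuous_map[OF quotient_map_approximant]]
  have "continuous_map (tiling_topology \<Omega>t) (K n) (tclass \<Omega>t n \<circ> rotated g)" .
  then show "continuous_map (tiling_topology \<Omega>t) (K n) ((`) (rotated g) \<circ> tclass \<Omega>t n)"
    by (rule continuous_map_eq) (simp add: rotated_tclass[OF g])
qed

lemma K_action:
  "C \<in> topspace (K n) \<Longrightarrow> rotated (mat 1) ` C = C"
  "rotated (g ** h) ` C = rotated g ` (rotated h ` C)"
  by (simp_all add: moved_ident image_image flip: rotated_rotated)

text \<open>On representatives, a tiling and a rotation go to the rotated tiling; for large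
  \<open>n\<close> this is the projection of the free diagonal action.\<close>

definition \<pi>J :: "nat \<Rightarrow> (real^'n, 'l) tiling set \<times> (real^'n^'n) \<Rightarrow> (real^'n, 'l) tiling set" where
  "\<pi>J n = (\<lambda>(C, A). agree_rel \<Omega>r n `` (rotated A ` C))"

lemma \<pi>J_tclass:
  assumes "S \<in> \<Omega>t" "rotation_matrix A"
  shows "\<pi>J n (tclass \<Omega>t n S, A) = tclass \<Omega>r n (rotated A S)"
  using image_tclass[OF assms(2,1) hull_r_rotated[OF _ assms(2)]] by (simp add: \<pi>J_def)

text \<open>The product of the class map with the identity of the rotation group is again a quotient
  map, the group being compact and Hausdorff; so continuity can be checked on tilings.\<close>

lemma \<pi>J_cont: "continuous_map (prod_topology (K n) SOn) (J n) (\<pi>J n)"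
proof -
  have "compact_space SOn"
    using compact_rotations by (intro compact_space_subtopology) simp
  then have "locally_compact_space SOn"
    by (intro compact_imp_locally_compact_space) (auto simp: Hausdorff_space_subtopology)
  then have q: "quotient_map (prod_topology (tiling_topology \<Omega>t) SOn) (prod_topology (K n) SOn)
      (\<lambda>(S, A). (tclass \<Omega>t n S, A))"
    by (intro quotient_map_prod_left quotient_map_approximant) (auto simp: Hausdorff_space_subtopology)
  have "continuous_map (prod_topology (tiling_topology \<Omega>t) SOn) (tiling_topology \<Omega>r) (\<lambda>(S, A). rotated A S)"
    using hull_r_rotated by (intro continuous_map_rotate) auto
  from continuous_map_compose[OF this quotient_imp_continuous_map[OF quotient_map_approximant]]
  have "continuous_map (prod_topology (tiling_topology \<Omega>t) SOn) (J n) (tclass \<Omega>r n \<circ> (\<lambda>(S, A). rotated A S))" .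
  then have "continuous_map (prod_topology (tiling_topology \<Omega>t) SOn) (J n) (\<pi>J n \<circ> (\<lambda>(S, A). (tclass \<Omega>t n S, A)))"
    by (rule continuous_map_eq) (auto simp: \<pi>J_tclass)
  then show ?thesis by (rule continuous_compose_quotient_map[OF q])
qed

text \<open>\<open>transpose A' ** A\<close> takes the patch of \<open>S\<close> to that of
  \<open>S'\<close>. Both tilings lie in the translational hull, so a patch of size
  \<open>radius\<close> suffices to place this rotation in \<open>G\<close>.\<close>

lemma recognise_patch:
  assumes n: "radius \<le> real n" and S: "S \<in> \<Omega>t" and S': "S' \<in> \<Omega>t"
    and A: "rotation_matrix A" and A': "rotation_matrix A'"
    and eq: "patch (real n) 0 (rotated A S) = patch (real n) 0 (rotated A' S')"
  shows "transpose A' ** A \<in> G" "patch (real n) 0 S' = patch (real n) 0 (rotated (transpose A' ** A) S)"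
proof -
  let ?g = "transpose A' ** A"
  have g: "rotation_matrix ?g" using A rotation_transpose(1)[OF A'] by (intro rotation_mult)
  have "rotated ?g (patch (real n) 0 S) = rotated (transpose A') (patch (real n) 0 (rotated A S))"
    by (simp only: rotated_rotated[symmetric] patch_rotated_0[OF A])
  also have "\<dots> = patch (real n) 0 S'"
    unfolding eq by (simp only: patch_rotated_0[OF A'] rotated_inverse[OF A'])
  finally have e: "rotated ?g (patch (real n) 0 S) = patch (real n) 0 S'" .
  then show "patch (real n) 0 S' = patch (real n) 0 (rotated ?g S)"
    by (simp only: patch_rotated_0[OF g])
  have "rotated ?g (patch radius 0 S) \<subseteq> rotated ?g (patch (real n) 0 S)"
    by (intro moved_mono patch_mono n)
  also have "\<dots> \<subseteq> S'" unfolding e by (rule patch_subset)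
  finally show "?g \<in> G" by (rule recognise_hull[OF S S' g])
qed

text \<open>Acting on rotations by \<open>A ** transpose g\<close> undoes the rotation of the tiling
  by \<open>g\<close>, so the rotated tiling stays the same. Conversely, two presentations of one
  patch differ by an element of \<open>G\<close>.\<close>

lemma \<pi>J_eq:
  assumes n: "radius \<le> real n" and C: "C \<in> topspace (K n)" and C': "C' \<in> topspace (K n)"
    and A: "rotation_matrix A" and A': "rotation_matrix A'"
  shows "\<pi>J n (C, A) = \<pi>J n (C', A') \<longleftrightarrow> (\<exists>g\<in>G. C' = rotated g ` C \<and> A' = A ** transpose g)"
proof -
  obtain S S' where S: "S \<in> \<Omega>t" "C = tclass \<Omega>t n S" and S': "S' \<in> \<Omega>t" "C' = tclass \<Omega>t n S'"
    using C C' unfolding topspace_approximant by blast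
  have iff: "\<pi>J n (C, A) = \<pi>J n (C', A') \<longleftrightarrow> patch (real n) 0 (rotated A S) = patch (real n) 0 (rotated A' S')"
    unfolding S(2) S'(2) \<pi>J_tclass[OF S(1) A] \<pi>J_tclass[OF S'(1) A']
    by (rule tclass_eq_iff) (use hull_r_rotated S(1) S'(1) A A' in auto)
  show ?thesis
  proof
    assume "\<pi>J n (C, A) = \<pi>J n (C', A')"
    then have eq: "patch (real n) 0 (rotated A S) = patch (real n) 0 (rotated A' S')" using iff by simp
    let ?g = "transpose A' ** A"
    note g = recognise_patch[OF n S(1) S'(1) A A' eq]
    have "C' = tclass \<Omega>t n (rotated ?g S)"
      unfolding S'(2) using tclass_eq_iff[OF S'(1) hull_t_rotated[OF S(1) g(1)]] g(2) by simp
    then have "C' = rotated ?g ` C" unfolding S(2) using rotated_tclass[OF g(1) S(1)] by simp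
    moreover have "A' = A ** transpose ?g"
      by (simp add: matrix_transpose_mul matrix_mul_assoc rotation_transpose(2)[OF A])
    ultimately show "\<exists>g\<in>G. C' = rotated g ` C \<and> A' = A ** transpose g" using g(1) by blast
  next
    assume "\<exists>g\<in>G. C' = rotated g ` C \<and> A' = A ** transpose g"
    then obtain g where g: "g \<in> G" "C' = rotated g ` C" "A' = A ** transpose g" by blast
    have "tclass \<Omega>t n S' = tclass \<Omega>t n (rotated g S)"
      using g(2) rotated_tclass[OF g(1) S(1)] S(2) S'(2) by simp
    then have "patch (real n) 0 S' = patch (real n) 0 (rotated g S)"
      using tclass_eq_iff[OF S'(1) hull_t_rotated[OF S(1) g(1)]] by simp
    then have e: "patch (real n) 0 S' = rotated g (patch (real n) 0 S)"
      by (simp only: patch_rotated_0[OF G_rotation[OF g(1)]])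
    have "patch (real n) 0 (rotated A' S') = rotated A' (patch (real n) 0 S')" by (rule patch_rotated_0[OF A'])
    also have "\<dots> = rotated (A ** transpose g) (rotated g (patch (real n) 0 S))" by (simp only: e g(3))
    also have "\<dots> = patch (real n) 0 (rotated A S)"
      by (simp only: rotated_rotated[symmetric] rotated_inverse[OF G_rotation[OF g(1)]] patch_rotated_0[OF A])
    finally show "\<pi>J n (C, A) = \<pi>J n (C', A')" using iff by simp
  qed
qed

lemma \<pi>J_in: "C \<in> topspace (K n) \<Longrightarrow> rotation_matrix A \<Longrightarrow> \<pi>J n (C, A) \<in> topspace (J n)"
  using \<pi>J_tclass hull_r_rotated unfolding topspace_approximant by auto

text \<open>A tiling close to \<open>rotated A S\<close> is \<open>rotated (B ** A) S'\<close> with \<open>B\<close> close to the identity and \<open>S'\<close>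
  in the translational hull and close to \<open>S\<close>, because the patch at the origin determines the
  orientation up to the point group.\<close>

lemma nearby_decompose:
  assumes S: "S \<in> \<Omega>t" and A: "rotation_matrix A" and \<epsilon>: "0 < \<epsilon>" "radius \<le> 1 / \<epsilon>"
    and R: "R \<in> \<Omega>r" and near: "close_by_moving \<epsilon> (rotated A S) R"
  obtains B S' where "rotation_matrix B" "norm (B - mat 1) < \<epsilon>" "S' \<in> \<Omega>t" "R = rotated (B ** A) S'"
    "close_by_moving \<epsilon> S S'"
proof -
  obtain v B where vB: "norm v < \<epsilon>" "rotation_matrix B" "norm (B - mat 1) < \<epsilon>"
    "patch (1 / \<epsilon>) 0 (rotated B (translated v (rotated A S))) = patch (1 / \<epsilon>) 0 R"
    using near unfolding close_by_moving_iff by blast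
  \<comment> \<open>Any presentation of \<open>R\<close>. Its orientation differs from
    \<open>B ** A\<close> by an element \<open>?h\<close> of \<open>G\<close>, which is then
    absorbed into the tiling.\<close>
  obtain A1 S1 where A1: "rotation_matrix A1" "S1 \<in> \<Omega>t" "R = rotated A1 S1" using hull_r_decompose[OF R] .
  let ?D = "B ** A" and ?u = "transpose A *v v"
  have D: "rotation_matrix ?D" using vB(2) A by (rule rotation_mult)
  have Au: "A *v ?u = v"
    by (simp only: matrix_vector_mul_assoc rotation_transpose(2)[OF A] matrix_vector_mul_lid)
  have "rotated ?D (translated ?u S) = rotated B (rotated A (translated ?u S))"
    by (simp only: rotated_rotated)
  also have "rotated A (translated ?u S) = translated v (rotated A S)"
    by (simp only: rotated_translated Au)
  finally have "rotated ?D (translated ?u S) = rotated B (translated v (rotated A S))" .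
  then have eq: "rotated ?D (patch (1 / \<epsilon>) 0 (translated ?u S)) = rotated A1 (patch (1 / \<epsilon>) 0 S1)"
    using vB(4) by (simp only: A1(3) patch_rotated_0[OF D, symmetric] patch_rotated_0[OF A1(1), symmetric])
  let ?h = "transpose ?D ** A1"
  have h: "rotation_matrix ?h" using rotation_transpose(1)[OF D] A1(1) by (rule rotation_mult)
  have "rotated (transpose ?D) (rotated ?D (patch (1 / \<epsilon>) 0 (translated ?u S))) = rotated ?h (patch (1 / \<epsilon>) 0 S1)"
    unfolding eq by (simp only: rotated_rotated)
  then have eq': "patch (1 / \<epsilon>) 0 (translated ?u S) = rotated ?h (patch (1 / \<epsilon>) 0 S1)"
    by (simp only: rotated_inverse[OF D])
  obtain w where w: "translated w (patch (1 / \<epsilon>) (0 - ?u) S) \<subseteq> T"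
    using hull_t_occurs[OF S finite_patch[OF hull_t_tiling[OF S]] patch_subset] by blast
  have "rotated ?h (patch radius 0 S1) \<subseteq> rotated ?h (patch (1 / \<epsilon>) 0 S1)"
    by (intro moved_mono patch_mono \<epsilon>)
  also have "\<dots> = translated ?u (patch (1 / \<epsilon>) (0 - ?u) S)"
    by (simp only: eq'[symmetric] patch_translated)
  finally have "translated (w - ?u) (rotated ?h (patch radius 0 S1))
      \<subseteq> translated (w - ?u) (translated ?u (patch (1 / \<epsilon>) (0 - ?u) S))"
    by (rule moved_mono)
  also have "\<dots> \<subseteq> T" using w by (simp only: translated_translated diff_add_cancel)
  finally have hG: "?h \<in> G" by (rule recognise[OF A1(2) h])
  let ?S = "rotated ?h S1"
  have "rotated ?D ?S = rotated (?D ** ?h) S1" by (simp only: rotated_rotated)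
  also have "?D ** ?h = A1"
    by (simp only: matrix_mul_assoc rotation_transpose(2)[OF D] matrix_mul_lid)
  finally have "R = rotated ?D ?S" by (simp only: A1(3))
  moreover have "close_by_moving \<epsilon> S ?S"
    unfolding close_by_moving_iff
  proof (intro exI conjI)
    show "norm ?u < \<epsilon>" using vB(1) norm_rotation[OF rotation_transpose(1)[OF A]] by simp
    show "rotation_matrix (mat 1 :: real^'n^'n)" by (rule rotation_1)
    show "norm (mat 1 - mat 1 :: real^'n^'n) < \<epsilon>" using \<epsilon>(1) by simp
    show "patch (1 / \<epsilon>) 0 (rotated (mat 1) (translated ?u S)) = patch (1 / \<epsilon>) 0 ?S"
      unfolding rotated_1 eq' by (simp only: patch_rotated_0[OF h])
  qed
  ultimately show ?thesis
    using that vB(2,3) hull_t_rotated[OF A1(2) hG] by blast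
qed

text \<open>Openness is tested on the rotational hull. A tiling over the image of \<open>U\<close>
  is rewritten as \<open>rotated A S1\<close>, where \<open>A\<close> and the class of
  \<open>S1\<close> form a point of \<open>U\<close>; every tiling close to it then has a
  presentation with a rotation near \<open>A\<close> and a tiling near \<open>S1\<close>.\<close>

lemma \<pi>J_open:
  assumes n: "radius \<le> real n"
  shows "open_map (prod_topology (K n) SOn) (J n) (\<pi>J n)"
  unfolding open_map_def
proof (intro allI impI)
  fix U assume U: "openin (prod_topology (K n) SOn) U"
  have Usub: "U \<subseteq> topspace (K n) \<times> {A. rotation_matrix A}" using openin_subset[OF U] by simp
  have sub: "\<pi>J n ` U \<subseteq> topspace (J n)" using Usub \<pi>J_in by blast
  let ?pre = "{R \<in> \<Omega>r. tclass \<Omega>r n R \<in> \<pi>J n ` U}"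
  let ?q = "\<lambda>(S, A). (tclass \<Omega>t n S, A)"
  have "continuous_map (prod_topology (tiling_topology \<Omega>t) SOn) (prod_topology (K n) SOn) ?q"
    using quotient_imp_continuous_map[OF quotient_map_approximant[of \<Omega>t n]]
    by (simp add: continuous_map_prod_top)
  from openin_continuous_map_preimage[OF this U]
  have U': "openin (prod_topology (tiling_topology \<Omega>t) SOn)
      {x \<in> \<Omega>t \<times> {A. rotation_matrix A}. ?q x \<in> U}" by simp
  have "openin (tiling_topology \<Omega>r) ?pre"
    unfolding openin_moving
  proof (intro conjI ballI)
    fix R assume "R \<in> ?pre"
    then obtain C A where R: "R \<in> \<Omega>r" "(C, A) \<in> U" "tclass \<Omega>r n R = \<pi>J n (C, A)" by auto
    have A: "rotation_matrix A" and "C \<in> topspace (K n)" using R(2) Usub by auto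
    then obtain S where S: "S \<in> \<Omega>t" "C = tclass \<Omega>t n S" unfolding topspace_approximant by blast
    obtain A0 S0 where A0: "rotation_matrix A0" "S0 \<in> \<Omega>t" "R = rotated A0 S0" using hull_r_decompose[OF R(1)] .
    have "patch (real n) 0 (rotated A0 S0) = patch (real n) 0 (rotated A S)"
      using R(1,3) tclass_eq_iff[OF R(1) hull_r_rotated[OF S(1) A]]
      unfolding S(2) \<pi>J_tclass[OF S(1) A] A0(3) by simp
    note g = recognise_patch[OF n A0(2) S(1) A0(1) A this]
    define S1 where "S1 = rotated (transpose A ** A0) S0"
    have S1: "S1 \<in> \<Omega>t" unfolding S1_def by (rule hull_t_rotated[OF A0(2) g(1)])
    have C1: "C = tclass \<Omega>t n S1" unfolding S(2) using tclass_eq_iff[OF S(1) S1] g(2) by (simp add: S1_def)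
    have R1: "R = rotated A S1"
      by (simp only: S1_def A0(3) rotated_rotated matrix_mul_assoc rotation_transpose(2)[OF A] matrix_mul_lid)
    have "(S1, A) \<in> {x \<in> \<Omega>t \<times> {A. rotation_matrix A}. ?q x \<in> U}"
      using S1 A R(2) C1 by simp
    then obtain U1 V1 where UV: "openin (tiling_topology \<Omega>t) U1" "openin SOn V1" "S1 \<in> U1" "A \<in> V1"
      "U1 \<times> V1 \<subseteq> {x \<in> \<Omega>t \<times> {A. rotation_matrix A}. ?q x \<in> U}"
      using U' unfolding openin_prod_topology_alt by meson
    obtain \<epsilon>1 where \<epsilon>1: "\<epsilon>1 > 0" "\<forall>S'\<in>\<Omega>t. close_by_moving \<epsilon>1 S1 S' \<longrightarrow> S' \<in> U1"
      using UV(1,3) unfolding openin_moving by blast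
    obtain \<epsilon>2 where \<epsilon>2: "\<epsilon>2 > 0" "\<forall>B. rotation_matrix B \<and> dist B A < \<epsilon>2 \<longrightarrow> B \<in> V1"
      using UV(2,4) unfolding openin_euclidean_subtopology_iff by blast
    \<comment> \<open>The bound \<open>1 / radius\<close> makes the ball of agreement large enough
      to determine orientations.\<close>
    let ?\<epsilon> = "min (min \<epsilon>1 \<epsilon>2) (1 / radius)"
    have \<epsilon>: "0 < ?\<epsilon>" "?\<epsilon> \<le> \<epsilon>1" "?\<epsilon> \<le> \<epsilon>2" using \<epsilon>1(1) \<epsilon>2(1) radius by auto
    have flip: "y \<le> 1 / z" if "z \<le> 1 / y" "0 < y" "0 < z" for y z :: real
      using that by (simp add: field_simps)
    have r: "radius \<le> 1 / ?\<epsilon>" by (rule flip[OF _ radius \<epsilon>(1)]) simp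
    have "R' \<in> ?pre" if R': "R' \<in> \<Omega>r" "close_by_moving ?\<epsilon> R R'" for R'
    proof -
      obtain B S' where B: "rotation_matrix B" "norm (B - mat 1) < ?\<epsilon>" "S' \<in> \<Omega>t" "R' = rotated (B ** A) S'"
        "close_by_moving ?\<epsilon> S1 S'"
        using nearby_decompose[OF S1 A \<epsilon>(1) r R'(1)] R'(2) unfolding R1 by blast
      have BA: "rotation_matrix (B ** A)" using B(1) A by (rule rotation_mult)
      have "S' \<in> U1" using \<epsilon>1(2) B(3) close_by_moving_mono[OF B(5) \<epsilon>(1,2)] by blast
      moreover have "dist (B ** A) A < \<epsilon>2"
      proof -
        have "B ** A - A = (B - mat 1) ** A" by (simp add: matrix_diff_distrib)
        then show ?thesis using B(2) \<epsilon>(3) norm_mult_rotation_left[OF A, of "B - mat 1"] by (simp add: dist_norm)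
      qed
      then have "B ** A \<in> V1" using \<epsilon>2(2) BA by blast
      ultimately have "(S', B ** A) \<in> {x \<in> \<Omega>t \<times> {A. rotation_matrix A}. ?q x \<in> U}" using UV(5) by blast
      then have inU: "(tclass \<Omega>t n S', B ** A) \<in> U" by simp
      have "tclass \<Omega>r n R' = \<pi>J n (tclass \<Omega>t n S', B ** A)" unfolding B(4) using \<pi>J_tclass[OF B(3) BA] by simp
      then show ?thesis using imageI[OF inU, of "\<pi>J n"] R'(1) by simp
    qed
    then show "\<exists>\<epsilon>>0. \<forall>R'\<in>\<Omega>r. close_by_moving \<epsilon> R R' \<longrightarrow> R' \<in> ?pre" using \<epsilon>(1) by blast
  qed auto
  then show "openin (J n) (\<pi>J n ` U)"
    using quotient_map_approximant[of \<Omega>r n] sub unfolding quotient_map_def by simp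
qed

lemma \<pi>J_surj: "\<pi>J n ` (topspace (K n) \<times> {A. rotation_matrix A}) = topspace (J n)"
proof (intro equalityI subsetI)
  fix D assume "D \<in> topspace (J n)"
  then obtain R where R: "R \<in> \<Omega>r" "D = tclass \<Omega>r n R" unfolding topspace_approximant by blast
  obtain A S where A: "rotation_matrix A" "S \<in> \<Omega>t" "R = rotated A S" using hull_r_decompose[OF R(1)] .
  have "D = \<pi>J n (tclass \<Omega>t n S, A)" using \<pi>J_tclass[OF A(2,1)] A(3) R(2) by simp
  moreover have "tclass \<Omega>t n S \<in> topspace (K n)" using A(2) unfolding topspace_approximant by blast
  ultimately show "D \<in> \<pi>J n ` (topspace (K n) \<times> {A. rotation_matrix A})" using A(1) by blast
qed (use \<pi>J_in in auto)

lemma diagonal_quotient_J: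
  assumes n: "radius \<le> real n"
  shows "diagonal_quotient (K n) SOn \<G> (\<lambda>g. (`) (rotated g)) (\<lambda>g A. A ** transpose g) (J n) (\<pi>J n)"
proof (rule diagonal_quotient.intro)
  show "group \<G>" by (rule group_G)
  show "finite (carrier \<G>)" using finite_G by (simp add: \<G>_simps)
  show "continuous_map (K n) (K n) ((`) (rotated g))" if "g \<in> carrier \<G>" for g
    using that continuous_map_K_rotated by (simp add: \<G>_simps)
  show "continuous_map SOn SOn (\<lambda>A. A ** transpose g)" if "g \<in> carrier \<G>" for g
    using that G_rotation rotation_mult rotation_transpose(1)
    by (auto simp: \<G>_simps continuous_map_in_subtopology intro!: continuous_on_matrix_mult continuous_intros)
  show "A ** transpose (g \<otimes>\<^bsub>\<G>\<^esub> h) = (A ** transpose h) ** transpose g" for A g h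
    by (simp add: SO_group_simps matrix_transpose_mul matrix_mul_assoc)
  show "g = \<one>\<^bsub>\<G>\<^esub>" if "g \<in> carrier \<G>" "A \<in> topspace SOn" "A ** transpose g = A" for g A
  proof -
    have A: "rotation_matrix A" using that(2) by simp
    have "transpose g = transpose A ** (A ** transpose g)"
      by (simp only: matrix_mul_assoc rotation_transpose(3)[OF A] matrix_mul_lid)
    also have "\<dots> = mat 1" by (simp only: that(3) rotation_transpose(3)[OF A])
    finally have "transpose (transpose g) = transpose (mat 1)" by (rule arg_cong)
    then show ?thesis by (simp add: SO_group_simps)
  qed
  show "Hausdorff_space SOn" by (simp add: Hausdorff_space_subtopology)
  show "continuous_map (prod_topology (K n) SOn) (J n) (\<pi>J n)" by (rule \<pi>J_cont)
  show "open_map (prod_topology (K n) SOn) (J n) (\<pi>J n)" by (rule \<pi>J_open[OF n])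
  show "\<pi>J n ` (topspace (K n) \<times> topspace SOn) = topspace (J n)" using \<pi>J_surj by simp
  show "\<pi>J n (C, A) = \<pi>J n (C', A') \<longleftrightarrow> (\<exists>g\<in>carrier \<G>. C' = rotated g ` C \<and> A' = A ** transpose g)"
    if "C \<in> topspace (K n)" "C' \<in> topspace (K n)" "A \<in> topspace SOn" "A' \<in> topspace SOn" for C C' A A'
    using \<pi>J_eq[OF n that(1,2)] that(3,4) by (simp add: \<G>_simps)
qed (simp_all add: SO_group_simps K_action moved_ident)

end

section \<open>The Borel construction\<close>

locale borel_tiling = point_group_tiling T G
  for T :: "(real^'n, 'l) tiling" and G :: "(real^'n^'n) set" +
  fixes E :: "'e topology" and \<phi> :: "real^'n^'n \<Rightarrow> 'e \<Rightarrow> 'e"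
  assumes EG: "free_contractible_space G E \<phi>"
begin

lemma E_contractible: "contractible_space E" and E_Hausdorff: "Hausdorff_space E"
  and \<phi>_action: "group_action \<G> (topspace E) \<phi>" and \<phi>_cont: "\<And>g. g \<in> G \<Longrightarrow> continuous_map E E (\<phi> g)"
  and \<phi>_free: "\<And>g e. g \<in> G \<Longrightarrow> e \<in> topspace E \<Longrightarrow> \<phi> g e = e \<Longrightarrow> g = mat 1"
  using EG unfolding free_contractible_space_def by blast+

lemma \<phi>_in: "g \<in> G \<Longrightarrow> e \<in> topspace E \<Longrightarrow> \<phi> g e \<in> topspace E"
  using group_action.element_image[OF \<phi>_action] by simp

lemma \<phi>_mult: "g \<in> G \<Longrightarrow> h \<in> G \<Longrightarrow> e \<in> topspace E \<Longrightarrow> \<phi> (g ** h) e = \<phi> g (\<phi> h e)"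
  using group_action.composition_rule[OF \<phi>_action, of e g h] by (simp add: SO_group_simps)

lemma \<phi>_one: "e \<in> topspace E \<Longrightarrow> \<phi> (mat 1) e = e"
  using group_action.id_eq_one[OF \<phi>_action] by (metis \<G>_simps(3) restrict_apply')

abbreviation "Y n \<equiv> prod_topology (K n) E"
abbreviation "R n \<equiv> diagonal_rel G (K n) E \<phi>"
abbreviation "B n \<equiv> borel_approximant \<Omega>t G E \<phi> n"
abbreviation act :: "real^'n^'n \<Rightarrow> (real^'n, 'l) tiling set \<times> 'e \<Rightarrow> (real^'n, 'l) tiling set \<times> 'e" where
  "act g \<equiv> \<lambda>(C, e). (rotated g ` C, \<phi> g e)"

lemma K_in: "g \<in> G \<Longrightarrow> C \<in> topspace (K n) \<Longrightarrow> rotated g ` C \<in> topspace (K n)"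
  using continuous_map_funspace[OF continuous_map_K_rotated] by blast

lemma act_in: "g \<in> G \<Longrightarrow> y \<in> topspace (Y n) \<Longrightarrow> act g y \<in> topspace (Y n)"
  using K_in \<phi>_in by auto

lemma act_mult: "g \<in> G \<Longrightarrow> h \<in> G \<Longrightarrow> y \<in> topspace (Y n) \<Longrightarrow> act (g ** h) y = act g (act h y)"
  using \<phi>_mult K_action(2) by auto

lemma act_one: "y \<in> topspace (Y n) \<Longrightarrow> act (mat 1) y = y"
  using \<phi>_one by (auto simp: moved_ident)

lemma R_iff: "(y, y') \<in> R n \<longleftrightarrow> y \<in> topspace (Y n) \<and> (\<exists>g\<in>G. y' = act g y)"
  by (cases y; cases y') (simp add: diagonal_rel_def)

lemma equiv_R: "equiv (topspace (Y n)) (R n)"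
proof (rule equivI)
  show "R n \<subseteq> topspace (Y n) \<times> topspace (Y n)"
    using act_in by (auto simp only: R_iff)
  show "refl_on (topspace (Y n)) (R n)"
    using act_one G_one by (intro refl_onI) (metis R_iff)
  show "sym (R n)"
  proof (rule symI)
    fix y y' assume "(y, y') \<in> R n"
    then obtain g where g: "y \<in> topspace (Y n)" "g \<in> G" "y' = act g y" unfolding R_iff by blast
    have "act (transpose g) y' = y"
      using act_mult[OF G_transpose[OF g(2)] g(2,1)] act_one[OF g(1)]
      by (simp only: g(3) rotation_transpose(3)[OF G_rotation[OF g(2)]])
    then show "(y', y) \<in> R n"
      unfolding R_iff using act_in[OF g(2,1)] G_transpose[OF g(2)] g(3) by metis
  qed
  show "trans (R n)"
    unfolding trans_def R_iff using act_mult G_mult by metis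
qed

lemma B_eq: "B n = quotient_space (Y n) (R n)"
  by (simp add: borel_approximant_def)

lemma quotient_map_B: "quotient_map (Y n) (B n) (\<lambda>y. R n `` {y})"
  unfolding B_eq by (rule quotient_map_quotient_space[OF equiv_R])

lemma R_class_eq_iff:
  assumes "y \<in> topspace (Y n)" "y' \<in> topspace (Y n)"
  shows "R n `` {y} = R n `` {y'} \<longleftrightarrow> (\<exists>g\<in>G. y' = act g y)"
  using eq_equiv_class_iff[OF equiv_R assms] assms(1) by (simp only: R_iff simp_thms)

lemma act_cont: "g \<in> G \<Longrightarrow> continuous_map (Y n) (Y n) (act g)"
  using continuous_map_K_rotated \<phi>_cont by (simp add: continuous_map_prod_top)

text \<open>The saturation of an open set is the union of its preimages under the action.\<close>

lemma B_open: "open_map (Y n) (B n) (\<lambda>y. R n `` {y})"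
  unfolding open_map_def
proof (intro allI impI)
  fix U assume U: "openin (Y n) U"
  have sub: "U \<subseteq> topspace (Y n)" using openin_subset[OF U] .
  have pre: "{y \<in> topspace (Y n). R n `` {y} \<in> (\<lambda>y. R n `` {y}) ` U} = (\<Union>g\<in>G. {y \<in> topspace (Y n). act g y \<in> U})"
  proof (intro equalityI subsetI)
    fix y assume "y \<in> {y \<in> topspace (Y n). R n `` {y} \<in> (\<lambda>y. R n `` {y}) ` U}"
    then obtain u where u: "y \<in> topspace (Y n)" "u \<in> U" "R n `` {y} = R n `` {u}" by blast
    then obtain g where "g \<in> G" "u = act g y" using R_class_eq_iff[OF u(1)] sub by blast
    then show "y \<in> (\<Union>g\<in>G. {y \<in> topspace (Y n). act g y \<in> U})" using u by blast
  next
    fix y assume "y \<in> (\<Union>g\<in>G. {y \<in> topspace (Y n). act g y \<in> U})"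
    then obtain g where g: "g \<in> G" "y \<in> topspace (Y n)" "act g y \<in> U" by blast
    then have "R n `` {y} = R n `` {act g y}" using R_class_eq_iff act_in by blast
    with g show "y \<in> {y \<in> topspace (Y n). R n `` {y} \<in> (\<lambda>y. R n `` {y}) ` U}" by blast
  qed
  have open_pre: "openin (Y n) {y \<in> topspace (Y n). R n `` {y} \<in> (\<lambda>y. R n `` {y}) ` U}"
    unfolding pre using openin_continuous_map_preimage[OF act_cont U] by (intro openin_Union) blast
  have "(\<lambda>y. R n `` {y}) ` U \<subseteq> topspace (B n)"
    using quotient_imp_surjective_map[OF quotient_map_B[of n]] sub by blast
  then have "openin (Y n) {y \<in> topspace (Y n). R n `` {y} \<in> (\<lambda>y. R n `` {y}) ` U} =
      openin (B n) ((\<lambda>y. R n `` {y}) ` U)"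
    using quotient_map_B[of n, unfolded quotient_map_def] by (elim conjE allE impE)
  with open_pre show "openin (B n) ((\<lambda>y. R n `` {y}) ` U)" by (rule iffD1[rotated])
qed

lemma diagonal_quotient_B:
  "diagonal_quotient (K n) E \<G> (\<lambda>g. (`) (rotated g)) \<phi> (B n) (\<lambda>y. R n `` {y})"
proof (rule diagonal_quotient.intro)
  show "group \<G>" by (rule group_G)
  show "finite (carrier \<G>)" using finite_G by simp
  show "continuous_map (K n) (K n) ((`) (rotated g))" if "g \<in> carrier \<G>" for g
    using that continuous_map_K_rotated by simp
  show "continuous_map E E (\<phi> g)" if "g \<in> carrier \<G>" for g using that \<phi>_cont by simp
  show "\<phi> \<one>\<^bsub>\<G>\<^esub> e = e" if "e \<in> topspace E" for e using \<phi>_one[OF that] by (simp only: \<G>_simps)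
  show "\<phi> (g \<otimes>\<^bsub>\<G>\<^esub> h) e = \<phi> g (\<phi> h e)" if "g \<in> carrier \<G>" "h \<in> carrier \<G>" "e \<in> topspace E" for g h e
    using \<phi>_mult that by (simp only: \<G>_simps)
  show "g = \<one>\<^bsub>\<G>\<^esub>" if "g \<in> carrier \<G>" "e \<in> topspace E" "\<phi> g e = e" for g e
    using \<phi>_free that by (simp only: \<G>_simps)
  show "Hausdorff_space E" by (rule E_Hausdorff)
  show "continuous_map (Y n) (B n) (\<lambda>y. R n `` {y})"
    by (rule quotient_imp_continuous_map[OF quotient_map_B])
  show "open_map (Y n) (B n) (\<lambda>y. R n `` {y})" by (rule B_open)
  show "(\<lambda>y. R n `` {y}) ` (topspace (K n) \<times> topspace E) = topspace (B n)"
    using quotient_imp_surjective_map[OF quotient_map_B[of n]] by simp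
  show "R n `` {(C, e)} = R n `` {(C', e')} \<longleftrightarrow> (\<exists>g\<in>carrier \<G>. C' = rotated g ` C \<and> e' = \<phi> g e)"
    if "C \<in> topspace (K n)" "C' \<in> topspace (K n)" "e \<in> topspace E" "e' \<in> topspace E" for C C' e e'
    using R_class_eq_iff[of "(C, e)" n "(C', e')"] that by simp
qed (simp_all add: SO_group_simps K_action moved_ident)

lemma forget_rotated:
  assumes "g \<in> G" "C \<in> topspace (K (Suc n))"
  shows "forget \<Omega>t n (rotated g ` C) = rotated g ` forget \<Omega>t n C"
proof -
  obtain S where S: "S \<in> \<Omega>t" "C = tclass \<Omega>t (Suc n) S" using assms(2) unfolding topspace_approximant by blast
  show ?thesis
    by (simp only: S(2) rotated_tclass[OF assms(1) S(1)] forget_tclass[OF S(1)]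
        forget_tclass[OF hull_t_rotated[OF S(1) assms(1)]])
qed

lemma forget_in: "C \<in> topspace (K (Suc n)) \<Longrightarrow> forget \<Omega>t n C \<in> topspace (K n)"
  using continuous_map_funspace[OF continuous_map_forget] by blast

text \<open>A class is a full orbit and forgetting commutes with \<open>G\<close>, so the
  elementwise image is exactly one class.\<close>

lemma borel_forget_class:
  assumes C: "C \<in> topspace (K (Suc n))" and e: "e \<in> topspace E"
  shows "borel_forget \<Omega>t n (R (Suc n) `` {(C, e)}) = R n `` {(forget \<Omega>t n C, e)}"
proof -
  have cl: "R m `` {(D, e)} = (\<lambda>g. (rotated g ` D, \<phi> g e)) ` G" if "D \<in> topspace (K m)" for m D
    using that e by (auto simp: diagonal_rel_def)
  have "borel_forget \<Omega>t n (R (Suc n) `` {(C, e)}) = (\<lambda>g. (forget \<Omega>t n (rotated g ` C), \<phi> g e)) ` G"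
    unfolding borel_forget_def cl[OF C] by (simp add: image_image)
  also have "\<dots> = R n `` {(forget \<Omega>t n C, e)}"
    unfolding cl[OF forget_in[OF C]] using forget_rotated[OF _ C] by (intro image_cong) auto
  finally show ?thesis .
qed

lemma continuous_map_borel_forget: "continuous_map (B (Suc n)) (B n) (borel_forget \<Omega>t n)"
proof (rule continuous_compose_quotient_map[OF quotient_map_B])
  have "continuous_map (Y (Suc n)) (Y n) (\<lambda>(C, e). (forget \<Omega>t n C, e))"
    using continuous_map_forget[of \<Omega>t n] by (simp add: continuous_map_prod_top)
  from continuous_map_compose[OF this quotient_imp_continuous_map[OF quotient_map_B]]
  have "continuous_map (Y (Suc n)) (B n) ((\<lambda>y. R n `` {y}) \<circ> (\<lambda>(C, e). (forget \<Omega>t n C, e)))" .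
  then show "continuous_map (Y (Suc n)) (B n) (borel_forget \<Omega>t n \<circ> (\<lambda>y. R (Suc n) `` {y}))"
    by (rule continuous_map_eq) (auto simp: borel_forget_class)
qed

lemma E_path_connected:
  assumes "u \<in> topspace E" "v \<in> topspace E" shows "\<exists>p. path_from E u v p"
proof -
  have "path_connected_space E"
    using E_contractible by (rule contractible_imp_path_connected_space)
  then show ?thesis
    using assms unfolding path_connected_space_def path_from_def by blast
qed

lemma E_simply_connected: "path_from E u v p \<Longrightarrow> path_from E u v q \<Longrightarrow> path_hom E u v p q"
  by (rule contractible_space_path_hom[OF E_contractible])

lemma forget_J:
  assumes "C \<in> topspace (K (Suc n))" "rotation_matrix A"
  shows "forget \<Omega>r n (\<pi>J (Suc n) (C, A)) = \<pi>J n (forget \<Omega>t n C, A)"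
proof -
  obtain S where S: "S \<in> \<Omega>t" "C = tclass \<Omega>t (Suc n) S" using assms(1) unfolding topspace_approximant by blast
  show ?thesis
    unfolding S(2) using \<pi>J_tclass[OF S(1) assms(2)] forget_tclass[OF hull_r_rotated[OF S(1) assms(2)]]
      forget_tclass[OF S(1)] by simp
qed

lemma T_class_in: "tclass \<Omega>t n T \<in> topspace (K n)"
  using T_in_hull unfolding topspace_approximant by blast

section \<open>Assembling the exact sequence of inverse limits\<close>

text \<open>Two distinct indices exist as soon as the dimension is at least 2; they span the plane
  of the full turn that generates the kernel.\<close>

context
  fixes a b :: 'n and e :: 'e
  assumes ab: "a \<noteq> b" and e: "e \<in> topspace E"
begin

lemma diagonal_pair:
  assumes n: "radius \<le> real n"
  shows "diagonal_pair (K n) SOn E \<G> (\<lambda>g. (`) (rotated g)) (\<lambda>g A. A ** transpose g) \<phi> (J n) (B n)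
    (\<pi>J n) (\<lambda>y. R n `` {y}) (tclass \<Omega>t n T) (mat 1) e"
proof (rule diagonal_pair.intro[OF diagonal_quotient_J[OF n] diagonal_quotient_B], rule diagonal_pair_axioms.intro)
  show "\<exists>p. path_from SOn A C p" if AC: "A \<in> topspace SOn" "C \<in> topspace SOn" for A C
  proof -
    obtain p where p: "path_from SOn A (mat 1) p"
      using SO_top_path_connected[OF ab, of A] AC(1) by auto
    obtain q where "path_from SOn C (mat 1) q"
      using SO_top_path_connected[OF ab, of C] AC(2) by auto
    from path_from_join[OF p path_from_reverse[OF this]] show ?thesis by blast
  qed
qed (use T_class_in e E_path_connected E_simply_connected rotation_1 in auto)

lemma diagonal_pair_map:
  assumes n: "radius \<le> real n"
  shows "diagonal_pair_map (K (Suc n)) SOn E \<G> (\<lambda>g. (`) (rotated g)) (\<lambda>g A. A ** transpose g) \<phi> (J (Suc n)) (B (Suc n))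
    (\<pi>J (Suc n)) (\<lambda>y. R (Suc n) `` {y}) (tclass \<Omega>t (Suc n) T) (mat 1) e
    (K n) (\<lambda>g. (`) (rotated g)) (J n) (B n) (\<pi>J n) (\<lambda>y. R n `` {y}) (tclass \<Omega>t n T)
    (forget \<Omega>t n) (forget \<Omega>r n) (borel_forget \<Omega>t n)"
proof (rule diagonal_pair_map.intro[OF diagonal_pair diagonal_pair[OF n]], use n in simp, rule diagonal_pair_map_axioms.intro)
  show "continuous_map (K (Suc n)) (K n) (forget \<Omega>t n)" "continuous_map (J (Suc n)) (J n) (forget \<Omega>r n)"
    by (rule continuous_map_forget)+
  show "continuous_map (B (Suc n)) (B n) (borel_forget \<Omega>t n)" by (rule continuous_map_borel_forget)
  show "forget \<Omega>t n (tclass \<Omega>t (Suc n) T) = tclass \<Omega>t n T" by (rule forget_tclass[OF T_in_hull])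
  then show "forget \<Omega>t n (rotated g ` tclass \<Omega>t (Suc n) T) = rotated g ` tclass \<Omega>t n T" if "g \<in> carrier \<G>" for g
    using forget_rotated[OF _ T_class_in] that by simp
qed (use forget_J borel_forget_class in auto)

text \<open>The hypotheses say that \<open>j\<close> identifies \<open>N\<close> with
  \<pi>_1(SO(d)), an element of \<open>N\<close> standing for that many full turns. The two cases of
  the theorem differ only in the choice of \<open>N\<close>.\<close>

lemma short_exact_shape_groups:
  assumes K: "group N" and mult: "\<And>x y. x \<in> carrier N \<Longrightarrow> y \<in> carrier N \<Longrightarrow>
      path_hom SOn (mat 1) (mat 1) (rot_loop a b (j (x \<otimes>\<^bsub>N\<^esub> y))) (rot_loop a b (j x + j y))"
    and inj: "\<And>x y. x \<in> carrier N \<Longrightarrow> y \<in> carrier N \<Longrightarrow>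
      path_hom SOn (mat 1) (mat 1) (rot_loop a b (j x)) (rot_loop a b (j y)) \<Longrightarrow> x = y"
    and onto: "\<And>m. \<exists>x\<in>carrier N. path_hom SOn (mat 1) (mat 1) (rot_loop a b m) (rot_loop a b (j x))"
  shows "\<exists>i p. short_exact N i (rotational_shape_group T) p (positive_space_group T G E \<phi> e)"
proof -
  define \<Pi>J where "\<Pi>J n = fundamental_group (J n) (tclass \<Omega>r n T)" for n
  define \<Pi>B where "\<Pi>B n = fundamental_group (B n) (R n `` {(tclass \<Omega>t n T, e)})" for n
  define fJ where "fJ n = induced_map (J n) (tclass \<Omega>r n T) (forget \<Omega>r n)" for n
  define fB where "fB n = induced_map (B n) (R n `` {(tclass \<Omega>t n T, e)}) (borel_forget \<Omega>t n)" for n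
  have T_r: "T \<in> \<Omega>r" using hull_r_rotated[OF T_in_hull rotation_1] by (simp only: rotated_1)
  have base: "\<pi>J n (tclass \<Omega>t n T, mat 1) = tclass \<Omega>r n T" for n
    using \<pi>J_tclass[OF T_in_hull rotation_1, of n] by (simp only: rotated_1)
  have gJ: "group (\<Pi>J n)" for n
    unfolding \<Pi>J_def using T_r by (intro group_fundamental_group) (auto simp: topspace_approximant)
  have gB: "group (\<Pi>B n)" for n
    unfolding \<Pi>B_def using quotient_imp_surjective_map[OF quotient_map_B[of n]] T_class_in[of n] e
    by (intro group_fundamental_group) auto
  have hJ: "fJ n \<in> hom (\<Pi>J (Suc n)) (\<Pi>J n)" for n
    unfolding \<Pi>J_def fJ_def by (rule induced_map_hom[OF continuous_map_forget forget_tclass[OF T_r]])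
  have hB: "fB n \<in> hom (\<Pi>B (Suc n)) (\<Pi>B n)" for n
    unfolding \<Pi>B_def fB_def
    using borel_forget_class[OF T_class_in e] forget_tclass[OF T_in_hull]
    by (intro induced_map_hom[OF continuous_map_borel_forget]) simp
  obtain k :: nat where k: "radius \<le> real k" using real_arch_simple by blast
  have r: "radius \<le> real (n + k)" for n using k by simp
  define i where "i n x = diagonal_pair.fibre_class (J (n + k)) (\<pi>J (n + k)) (tclass \<Omega>t (n + k) T) (mat 1) (rot_loop a b (j x))"
    for n x
  define p where "p n = diagonal_pair.compare (K (n + k)) SOn E \<G> (\<lambda>g. (`) (rotated g)) (\<lambda>g A. A ** transpose g) \<phi> (J (n + k)) (B (n + k))
    (\<pi>J (n + k)) (\<lambda>y. R (n + k) `` {y}) (tclass \<Omega>t (n + k) T) (mat 1) e" for n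
  note loop = path_from_rot_loop[OF ab]
  have "\<exists>i p. short_exact N i (inverse_limit_group (\<lambda>n. \<Pi>J (n + k)) (\<lambda>n. fJ (n + k))) p
      (inverse_limit_group (\<lambda>n. \<Pi>B (n + k)) (\<lambda>n. fB (n + k)))"
  proof (rule short_exact_inverse_limit[OF K, where i = i and p = p])
    fix n
    interpret D: diagonal_pair "K (n + k)" SOn E \<G> "\<lambda>g. (`) (rotated g)" "\<lambda>g A. A ** transpose g" \<phi> "J (n + k)" "B (n + k)"
      "\<pi>J (n + k)" "\<lambda>y. R (n + k) `` {y}" "tclass \<Omega>t (n + k) T" "mat 1" e
      by (rule diagonal_pair[OF r])
    interpret M: diagonal_pair_map "K (Suc (n + k))" SOn E \<G> "\<lambda>g. (`) (rotated g)" "\<lambda>g A. A ** transpose g" \<phi>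
      "J (Suc (n + k))" "B (Suc (n + k))" "\<pi>J (Suc (n + k))" "\<lambda>y. R (Suc (n + k)) `` {y}" "tclass \<Omega>t (Suc (n + k)) T" "mat 1" e
      "K (n + k)" "\<lambda>g. (`) (rotated g)" "J (n + k)" "B (n + k)" "\<pi>J (n + k)" "\<lambda>y. R (n + k) `` {y}" "tclass \<Omega>t (n + k) T"
      "forget \<Omega>t (n + k)" "forget \<Omega>r (n + k)" "borel_forget \<Omega>t (n + k)"
      by (rule diagonal_pair_map[OF r])
    have \<Pi>: "\<Pi>J (n + k) = D.\<Pi>1" "\<Pi>B (n + k) = D.\<Pi>2" by (simp_all add: \<Pi>J_def \<Pi>B_def base)
    have i: "i n x = D.fibre_class (rot_loop a b (j x))" for x by (simp add: i_def)
    have p: "p n = D.compare" by (simp add: p_def)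
    show "group (\<Pi>J (n + k))" "group (\<Pi>B (n + k))" by (rule gJ gB)+
    show "fJ (n + k) \<in> hom (\<Pi>J (Suc n + k)) (\<Pi>J (n + k))" using hJ[of "n + k"] by simp
    show "fB (n + k) \<in> hom (\<Pi>B (Suc n + k)) (\<Pi>B (n + k))" using hB[of "n + k"] by simp
    show "i n \<in> hom N (\<Pi>J (n + k))"
      unfolding \<Pi>
    proof (rule homI)
      show "i n x \<in> carrier D.\<Pi>1" for x unfolding i by (rule D.fibre_class_carrier[OF loop])
      show "i n (x \<otimes>\<^bsub>N\<^esub> y) = i n x \<otimes>\<^bsub>D.\<Pi>1\<^esub> i n y" if "x \<in> carrier N" "y \<in> carrier N" for x y
        unfolding i D.fibre_class_mult[OF loop loop] D.fibre_class_eq_iff[OF loop path_from_join[OF loop loop]]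
        using mult[OF that] path_hom_sym[OF rot_loop_join[OF ab]] by (rule path_hom_trans)
    qed
    show "inj_on (i n) (carrier N)"
      by (rule inj_onI) (use inj in \<open>simp add: i D.fibre_class_eq_iff[OF loop loop]\<close>)
    show "fJ (n + k) (i (Suc n) x) = i n x" for x
      using M.fibre_class_natural[OF loop] by (simp add: fJ_def i_def base)
    show "p n \<in> hom (\<Pi>J (n + k)) (\<Pi>B (n + k))" unfolding \<Pi> p by (rule D.compare_hom)
    show "p n ` carrier (\<Pi>J (n + k)) = carrier (\<Pi>B (n + k))" unfolding \<Pi> p by (rule D.compare_surj)
    show "fB (n + k) (p (Suc n) x) = p n (fJ (n + k) x)" if "x \<in> carrier (\<Pi>J (Suc n + k))" for x
      using M.compare_natural[of x] that by (simp add: fJ_def fB_def p_def base \<Pi>J_def)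
    show "i n ` carrier N = kernel (\<Pi>J (n + k)) (\<Pi>B (n + k)) (p n)"
    proof (intro equalityI subsetI)
      fix y assume "y \<in> i n ` carrier N"
      then obtain x where "y = D.fibre_class (rot_loop a b (j x))" using i by blast
      then show "y \<in> kernel (\<Pi>J (n + k)) (\<Pi>B (n + k)) (p n)"
        unfolding kernel_def \<Pi> p using D.compare_kernel D.fibre_class_carrier[OF loop] loop by blast
    next
      fix y assume "y \<in> kernel (\<Pi>J (n + k)) (\<Pi>B (n + k)) (p n)"
      then have y: "y \<in> carrier D.\<Pi>1" "D.compare y = \<one>\<^bsub>D.\<Pi>2\<^esub>" unfolding kernel_def \<Pi> p by blast+
      then obtain q where q: "path_from SOn (mat 1) (mat 1) q" "y = D.fibre_class q"
        using D.compare_kernel by blast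
      obtain m where m: "path_hom SOn (mat 1) (mat 1) q (rot_loop a b m)" using rot_loop_generates[OF ab q(1)] .
      obtain x where x: "x \<in> carrier N" "path_hom SOn (mat 1) (mat 1) (rot_loop a b m) (rot_loop a b (j x))"
        using onto by blast
      have "y = i n x"
        unfolding q(2) i D.fibre_class_eq_iff[OF q(1) loop] using m x(2) by (rule path_hom_trans)
      with x(1) show "y \<in> i n ` carrier N" by blast
    qed
  qed
  then obtain i' p' where ex: "short_exact N i' (inverse_limit_group (\<lambda>n. \<Pi>J (n + k)) (\<lambda>n. fJ (n + k))) p'
      (inverse_limit_group (\<lambda>n. \<Pi>B (n + k)) (\<lambda>n. fB (n + k)))" by blast
  have "rotational_shape_group T = inverse_limit_group \<Pi>J fJ"
    by (simp add: rotational_shape_group_def shape_group_def Let_def \<Pi>J_def[abs_def] fJ_def[abs_def])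
  moreover have "positive_space_group T G E \<phi> e = inverse_limit_group \<Pi>B fB"
    by (simp add: positive_space_group_def shape_group_def Let_def \<Pi>B_def[abs_def] fB_def[abs_def])
  ultimately show ?thesis
    using short_exact_iso[OF ex inverse_limit_shift[where H = \<Pi>J and \<beta> = fJ, OF gJ hJ]
        inverse_limit_shift[where H = \<Pi>B and \<beta> = fB, OF gB hB]
        group_inverse_limit[where H = \<Pi>J and \<beta> = fJ, OF gJ hJ]
        group_inverse_limit[where H = \<Pi>B and \<beta> = fB, OF gB hB]] by simp
qed

end

end

theorem proposition5p18:
  fixes T :: "(real^'n, 'l) tiling"
    and G :: "(real^'n^'n) set"
    and E :: "'e topology"
    and \<phi> :: "real^'n^'n \<Rightarrow> 'e \<Rightarrow> 'e"
    and e :: 'e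
  assumes "tiling T"
    and "has_point_group T G"
    and "free_contractible_space G E \<phi>"
    and "e \<in> topspace E"
  shows "(CARD('n) = 2 \<longrightarrow>
            (\<exists>i p. short_exact integer_group i (rotational_shape_group T) p
                     (positive_space_group T G E \<phi> e))) \<and>
         (CARD('n) > 2 \<longrightarrow>
            (\<exists>i p. short_exact (integer_mod_group 2) i (rotational_shape_group T) p
                     (positive_space_group T G E \<phi> e)))"
proof -
  interpret borel_tiling T G E \<phi>
    using assms by unfold_locales
  have pair: "\<exists>a b :: 'n. a \<noteq> b" if "CARD('n) \<ge> 2"
  proof -
    have "\<not> (UNIV :: 'n set) \<subseteq> {undefined}"
      using card_mono[of "{undefined :: 'n}" UNIV] that by auto
    then show ?thesis by blast
  qed
  show ?thesis
  proof (intro conjI impI)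
    assume 2: "CARD('n) = 2"
    then obtain a b :: 'n where ab: "a \<noteq> b" using pair by auto
    show "\<exists>i p. short_exact integer_group i (rotational_shape_group T) p (positive_space_group T G E \<phi> e)"
    proof (rule short_exact_shape_groups[OF ab assms(4), where j = "\<lambda>x. x"])
      show "path_hom SO_top (mat 1) (mat 1) (rot_loop a b (x \<otimes>\<^bsub>integer_group\<^esub> y)) (rot_loop a b (x + y))" for x y
        using path_hom_refl[OF path_from_rot_loop[OF ab]] by simp
      show "x = y" if "path_hom SO_top (mat 1) (mat 1) (rot_loop a b x) (rot_loop a b y)" for x y
        using rot_loop_inj_2[OF ab 2 that] .
      show "\<exists>x\<in>carrier integer_group. path_hom SO_top (mat 1) (mat 1) (rot_loop a b m) (rot_loop a b x)" for m
        using path_hom_refl[OF path_from_rot_loop[OF ab]] by auto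
    qed simp
  next
    assume 3: "CARD('n) > 2"
    then obtain a b :: 'n where ab: "a \<noteq> b" using pair by auto
    have iff: "path_hom SO_top (mat 1) (mat 1) (rot_loop a b m) (rot_loop a b k) \<longleftrightarrow> even (m - k)" for m k
      using rot_loop_eq_iff_3[OF ab] 3 by simp
    show "\<exists>i p. short_exact (integer_mod_group 2) i (rotational_shape_group T) p (positive_space_group T G E \<phi> e)"
    \<comment> \<open>The elements of the group are the integers 0 and 1; addition modulo 2 alters
      the number of turns by an even amount.\<close>
    proof (rule short_exact_shape_groups[OF ab assms(4), where j = "\<lambda>x. x"])
      show "path_hom SO_top (mat 1) (mat 1) (rot_loop a b (x \<otimes>\<^bsub>integer_mod_group 2\<^esub> y)) (rot_loop a b (x + y))" for x y
        unfolding iff by (simp add: mult_integer_mod_group)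
      show "x = y" if "x \<in> carrier (integer_mod_group 2)" "y \<in> carrier (integer_mod_group 2)"
        "path_hom SO_top (mat 1) (mat 1) (rot_loop a b x) (rot_loop a b y)" for x y
      proof -
        have "0 \<le> x" "x < 2" "0 \<le> y" "y < 2" using that(1,2) by (simp_all add: carrier_integer_mod_group)
        moreover have "even (x - y)" using that(3) unfolding iff .
        ultimately show ?thesis by presburger
      qed
      show "\<exists>x\<in>carrier (integer_mod_group 2). path_hom SO_top (mat 1) (mat 1) (rot_loop a b m) (rot_loop a b x)" for m
        unfolding iff by (rule bexI[of _ "m mod 2"]) (auto simp: carrier_integer_mod_group)
    qed simp
  qed
qed

end
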